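(* Let $\varphi_0=c_0s+\psi_0$ and $\varphi_1=c_0s+\psi_1$ in $\mathcal G$ be Dirichlet polynomial symbols with $\mathrm{char}(\varphi_0)=\mathrm{char}(\varphi_1)=c_0\ge1$. Assume that for all $z\in\Gamma(\mathcal B\psi_0)$ (resp. $z\in\Gamma(\mathcal B\psi_1)$), $\varphi_0$ (resp. $\varphi_1$) has a Dirichlet contact of order $2$ at $z$. Then the following assertions are equivalent: (i) $C_{\varphi_0}-C_{\varphi_1}$ is compact on $\mathcal H$. (ii) $\Gamma(\mathcal B\psi_0)=\Gamma(\mathcal B\psi_1)$ and, for all $z\in\Gamma(\mathcal B\psi_0)$, $\mathcal B\psi_0(z)=\mathcal B\psi_1(z)$ and $\partial_\alpha\mathcal B\psi_0(z)=\partial_\alpha\mathcal B\psi_1(z)$ for every multi-index $\alpha$ with $|\alpha|\le2$.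
   Context: For $\theta\in\mathbb R$, $\mathbb C_\theta=\{s\in\mathbb C:\ \mathrm{Re}\, s>\theta\}$, $\mathbb C_+=\mathbb C_0$; $\mathbb D$ is the open unit disc, $\mathbb T$ the unit circle. $\mathcal H$ is the Hilbert space of Dirichlet series $f(s)=\sum_{n\ge1}a_nn^{-s}$ with $\|f\|^2=\sum_n|a_n|^2<\infty$; its elements are analytic on $\mathbb C_{1/2}$. The Gordon-Hedenmalm class $\mathcal G$ is the set of maps $\varphi:\mathbb C_{1/2}\to\mathbb C_{1/2}$ of the form $\varphi(s)=c_0s+\psi(s)$, where $c_0=:\mathrm{char}(\varphi)$ is a non-negative integer (the characteristic) and $\psi(s)=\sum_{n\ge1}c_nn^{-s}$ converges uniformly in $\mathbb C_\varepsilon$ for every $\varepsilon>0$ and satisfies: (a) if $c_0=0$, then $\psi(\mathbb C_0)\subseteq\mathbb C_{1/2}$; (b) if $c_0\ge1$, then either $\psi\equiv c_1$ with $\mathrm{Re}\,c_1\ge0$ or $\psi(\mathbb C_0)\subseteq\mathbb C_0$. These are exactly the symbols for which $C_\varphi f=f\circ\varphi$ is bounded on $\mathcal H$. $\varphi$ is a Dirichlet polynomial symbol if $\psi$ is a finite sum. Let $p_1<p_2<\cdots$ be the primes. For a Dirichlet polynomial symbol $\varphi=c_0s+\psi$, $c_0\ge1$, let $d\ge1$ be the smallest integer such that only integers $n=p_1^{\alpha_1}\cdots p_d^{\alpha_d}$, $\alpha\in\mathbb N_0^d$, occur in $\psi$. The Bohr lift is the polynomial $\mathcal B\psi(z)=\sum_{n=p_1^{\alpha_1}\cdots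 p_d^{\alpha_d}}c_nz_1^{\alpha_1}\cdots z_d^{\alpha_d}$ in $d$ variables, mapping $\mathbb D^d$ into $\overline{\mathbb C_+}$, and $\Gamma(\mathcal B\psi)=\{z\in\mathbb T^d:\ \mathrm{Re}\,\mathcal B\psi(z)=0\}$. (Equality $\Gamma(\mathcal B\psi_0)=\Gamma(\mathcal B\psi_1)$ is equality of sets; if nonempty it entails that both symbols have the same $d$.) Put $J_\varphi(\theta_1,\dots,\theta_d)=\mathrm{Re}\,\mathcal B\psi(e^{i\theta_1},\dots,e^{i\theta_d})$. For $n\in\mathbb N$, $\varphi$ has a Dirichlet contact of order $2n$ at $z=(e^{i\theta_1^0},\dots,e^{i\theta_d^0})\in\Gamma(\mathcal B\psi)$ if there exist $c>0$ and a neighbourhood $\mathcal U$ of $(\theta_1^0,\dots,\theta_d^0)$ in $\mathbb R^d$ such that $J_\varphi(\theta)\ge c\big((\theta_1-\theta_1^0)^2+\cdots+(\theta_d-\theta_d^0)^2\big)^n$ for all $\theta\in\mathcal U$. *)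

theory Defs
  imports "HOL-Analysis.Analysis"
begin

section \<open>Dirichlet series\<close>

definition halfplane :: "real \<Rightarrow> complex set" where
  "halfplane \<theta> = {s. Re s > \<theta>}"

text \<open>
  Coefficient sequences are functions on \<^typ>\<open>nat\<close>, but Dirichlet series start at
  \<open>n = 1\<close>. Since \<open>0 powr z = 0\<close>, the value at index \<open>0\<close> never contributes.
\<close>

definition dirichlet_series :: "(nat \<Rightarrow> complex) \<Rightarrow> complex \<Rightarrow> complex" where
  "dirichlet_series a s = (\<Sum>n. a n * of_nat n powr (- s))"


section \<open>The Hilbert space of Dirichlet series with square-summable coefficients\<close>

text \<open>
  A Dirichlet series is determined by its coefficients, so the elements are represented by them;
  the condition \<open>a 0 = 0\<close> normalises the index that is not used.
\<close>

typedef dirichlet_H = "{a :: nat \<Rightarrow> complex. a 0 = 0 \<and> summable (\<lambda>n. (cmod (a n))\<^sup>2)}"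
  morphisms coeff_H Abs_dirichlet_H
  by (rule exI[of _ "\<lambda>_. 0"]) auto

setup_lifting type_definition_dirichlet_H

definition eval_H :: "dirichlet_H \<Rightarrow> complex \<Rightarrow> complex" where
  "eval_H f s = dirichlet_series (coeff_H f) s"

lemma summable_coeff_H: "summable (\<lambda>n. (cmod (coeff_H f n))\<^sup>2)"
  using coeff_H[of f] by simp

lemma summable_cmod_add_sq:
  fixes a b :: "nat \<Rightarrow> complex"
  assumes "summable (\<lambda>n. (cmod (a n))\<^sup>2)" "summable (\<lambda>n. (cmod (b n))\<^sup>2)"
  shows "summable (\<lambda>n. (cmod (a n + b n))\<^sup>2)"
proof (rule summable_comparison_test')
  show "summable (\<lambda>n. 2 * (cmod (a n))\<^sup>2 + 2 * (cmod (b n))\<^sup>2)"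
    using assms by (intro summable_add summable_mult)
  fix n
  have "(cmod (a n + b n))\<^sup>2 \<le> (cmod (a n) + cmod (b n))\<^sup>2"
    by (intro power_mono norm_triangle_ineq) auto
  also have "\<dots> \<le> 2 * (cmod (a n))\<^sup>2 + 2 * (cmod (b n))\<^sup>2"
    using sum_squares_bound[of "cmod (a n)" "cmod (b n)"] by (simp add: power2_sum)
  finally show "norm ((cmod (a n + b n))\<^sup>2) \<le> 2 * (cmod (a n))\<^sup>2 + 2 * (cmod (b n))\<^sup>2"
    by simp
qed

lemma summable_inner_sq:
  fixes a b :: "nat \<Rightarrow> complex"
  assumes "summable (\<lambda>n. (cmod (a n))\<^sup>2)" "summable (\<lambda>n. (cmod (b n))\<^sup>2)"
  shows "summable (\<lambda>n. inner (a n) (b n))"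
proof (rule summable_comparison_test')
  show "summable (\<lambda>n. (cmod (a n))\<^sup>2 + (cmod (b n))\<^sup>2)"
    using assms by (intro summable_add)
  fix n
  have "\<bar>inner (a n) (b n)\<bar> \<le> cmod (a n) * cmod (b n)"
    by (rule Cauchy_Schwarz_ineq2)
  also have "\<dots> \<le> (cmod (a n))\<^sup>2 + (cmod (b n))\<^sup>2"
  proof -
    have "0 \<le> cmod (a n) * cmod (b n)" by simp
    then show ?thesis
      using sum_squares_bound[of "cmod (a n)" "cmod (b n)"] by linarith
  qed
  finally show "norm (inner (a n) (b n)) \<le> (cmod (a n))\<^sup>2 + (cmod (b n))\<^sup>2"
    by simp
qed

text \<open>
  The real inner product below is the real part of the usual complex one; it induces the norm
  \<open>norm f = sqrt (\<Sum>n. (cmod (coeff_H f n))\<^sup>2)\<close>.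
\<close>

instantiation dirichlet_H :: real_inner
begin

lift_definition zero_dirichlet_H :: dirichlet_H is "\<lambda>_. 0" by simp

lift_definition plus_dirichlet_H :: "dirichlet_H \<Rightarrow> dirichlet_H \<Rightarrow> dirichlet_H"
  is "\<lambda>a b n. a n + b n" by (simp add: summable_cmod_add_sq)

lift_definition uminus_dirichlet_H :: "dirichlet_H \<Rightarrow> dirichlet_H" is "\<lambda>a n. - a n" by simp

lift_definition minus_dirichlet_H :: "dirichlet_H \<Rightarrow> dirichlet_H \<Rightarrow> dirichlet_H"
  is "\<lambda>a b n. a n - b n"
  subgoal for a b using summable_cmod_add_sq[of a "\<lambda>n. - b n"] by simp
  done

lift_definition scaleR_dirichlet_H :: "real \<Rightarrow> dirichlet_H \<Rightarrow> dirichlet_H"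
  is "\<lambda>r a n. scaleR r (a n)"
  by (simp add: power_mult_distrib summable_mult)

definition inner_dirichlet_H :: "dirichlet_H \<Rightarrow> dirichlet_H \<Rightarrow> real" where
  "inner_dirichlet_H f g = (\<Sum>n. inner (coeff_H f n) (coeff_H g n))"

definition norm_dirichlet_H :: "dirichlet_H \<Rightarrow> real" where
  "norm_dirichlet_H f = sqrt (inner f f)"

definition sgn_dirichlet_H :: "dirichlet_H \<Rightarrow> dirichlet_H" where
  "sgn_dirichlet_H f = scaleR (inverse (norm f)) f"

definition dist_dirichlet_H :: "dirichlet_H \<Rightarrow> dirichlet_H \<Rightarrow> real" where
  "dist_dirichlet_H f g = norm (f - g)"

definition uniformity_dirichlet_H :: "(dirichlet_H \<times> dirichlet_H) filter" where
  "uniformity_dirichlet_H = (INF e\<in>{0 <..}. principal {(f, g). dist f g < e})"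

definition open_dirichlet_H :: "dirichlet_H set \<Rightarrow> bool" where
  "open_dirichlet_H U \<longleftrightarrow> (\<forall>f\<in>U. eventually (\<lambda>(f', g). f' = f \<longrightarrow> g \<in> U) uniformity)"

instance
proof
  fix f g h :: dirichlet_H and r q :: real and U :: "dirichlet_H set"
  show "f + g + h = f + (g + h)" by transfer (simp add: add.assoc)
  show "f + g = g + f" by transfer (simp add: add.commute)
  show "0 + f = f" by transfer simp
  show "- f + f = 0" by transfer simp
  show "f - g = f + - g" by transfer simp
  show "r *\<^sub>R (f + g) = r *\<^sub>R f + r *\<^sub>R g" by transfer (simp add: scaleR_add_right)
  show "(r + q) *\<^sub>R f = r *\<^sub>R f + q *\<^sub>R f" by transfer (simp add: scaleR_add_left)
  show "r *\<^sub>R q *\<^sub>R f = (r * q) *\<^sub>R f" by transfer simp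
  show "1 *\<^sub>R f = f" by transfer simp
  show "sgn f = inverse (norm f) *\<^sub>R f" by (rule sgn_dirichlet_H_def)
  show "dist f g = norm (f - g)" by (rule dist_dirichlet_H_def)
  show "uniformity = (INF e\<in>{0 <..}. principal {(x, y :: dirichlet_H). dist x y < e})"
    by (rule uniformity_dirichlet_H_def)
  show "open U \<longleftrightarrow> (\<forall>f\<in>U. eventually (\<lambda>(f', g). f' = f \<longrightarrow> g \<in> U) uniformity)"
    by (rule open_dirichlet_H_def)
  have sum: "summable (\<lambda>n. inner (coeff_H x n) (coeff_H y n))" for x y
    by (intro summable_inner_sq summable_coeff_H)
  show "inner f g = inner g f"
    by (simp add: inner_dirichlet_H_def inner_commute)
  show "inner (f + g) h = inner f h + inner g h"
    by (simp add: inner_dirichlet_H_def plus_dirichlet_H.rep_eq inner_add_left suminf_add sum)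
  show "inner (r *\<^sub>R f) g = r * inner f g"
    by (simp add: inner_dirichlet_H_def scaleR_dirichlet_H.rep_eq suminf_mult sum)
  show "0 \<le> inner f f"
    by (auto simp: inner_dirichlet_H_def intro!: suminf_nonneg sum)
  show "inner f f = 0 \<longleftrightarrow> f = 0"
    using suminf_eq_zero_iff[OF sum[of f f]]
    by (auto simp: inner_dirichlet_H_def zero_dirichlet_H.rep_eq fun_eq_iff
             simp flip: coeff_H_inject)
  show "norm f = sqrt (inner f f)" by (rule norm_dirichlet_H_def)
qed

end

lemma norm_dirichlet_H: "norm f = sqrt (\<Sum>n. (cmod (coeff_H f n))\<^sup>2)"
  by (simp add: norm_dirichlet_H_def inner_dirichlet_H_def power2_norm_eq_inner)

lemma norm_coeff_H_le: "cmod (coeff_H f n) \<le> norm f"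
proof -
  have "(\<Sum>k\<in>{n}. (cmod (coeff_H f k))\<^sup>2) \<le> (\<Sum>k. (cmod (coeff_H f k))\<^sup>2)"
    by (intro sum_le_suminf summable_coeff_H) auto
  then show ?thesis by (simp add: norm_dirichlet_H real_le_rsqrt)
qed

lemma sum_coeff_H_le: "(\<Sum>n<N. (cmod (coeff_H f n))\<^sup>2) \<le> (norm f)\<^sup>2"
proof -
  have "(\<Sum>n<N. (cmod (coeff_H f n))\<^sup>2) \<le> (\<Sum>n. (cmod (coeff_H f n))\<^sup>2)"
    by (intro sum_le_suminf summable_coeff_H) auto
  also have "\<dots> = (norm f)\<^sup>2"
    by (simp add: norm_dirichlet_H suminf_nonneg summable_coeff_H)
  finally show ?thesis .
qed

instance dirichlet_H :: banach
proof
  fix X :: "nat \<Rightarrow> dirichlet_H"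
  assume X: "Cauchy X"
  have "Cauchy (\<lambda>k. coeff_H (X k) n)" for n
    unfolding Cauchy_def
  proof (intro allI impI)
    fix e :: real assume "e > 0"
    then obtain M where M: "\<forall>i\<ge>M. \<forall>j\<ge>M. dist (X i) (X j) < e"
      using X unfolding Cauchy_def by blast
    have "dist (coeff_H (X i) n) (coeff_H (X j) n) \<le> dist (X i) (X j)" for i j
      using norm_coeff_H_le[of "X i - X j" n]
      by (simp add: dist_norm minus_dirichlet_H.rep_eq)
    with M show "\<exists>M. \<forall>i\<ge>M. \<forall>j\<ge>M. dist (coeff_H (X i) n) (coeff_H (X j) n) < e"
      using le_less_trans by blast
  qed
  then have "\<exists>l. (\<lambda>k. coeff_H (X k) n) \<longlonglongrightarrow> l" for n
    using Cauchy_convergent convergent_def by blast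
  then obtain a where a: "\<And>n. (\<lambda>k. coeff_H (X k) n) \<longlonglongrightarrow> a n" by metis
  have bound: "\<exists>M. \<forall>i\<ge>M. \<forall>N. (\<Sum>n<N. (cmod (coeff_H (X i) n - a n))\<^sup>2) \<le> e\<^sup>2"
    if "e > 0" for e :: real
  proof -
    obtain M where M: "\<forall>i\<ge>M. \<forall>j\<ge>M. dist (X i) (X j) < e"
      using X \<open>e > 0\<close> unfolding Cauchy_def by blast
    show ?thesis
    proof (intro exI allI impI)
      fix i N assume "i \<ge> M"
      have lim: "(\<lambda>j. \<Sum>n<N. (cmod (coeff_H (X i) n - coeff_H (X j) n))\<^sup>2)
          \<longlonglongrightarrow> (\<Sum>n<N. (cmod (coeff_H (X i) n - a n))\<^sup>2)"
        by (intro tendsto_intros a)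
      have le: "(\<Sum>n<N. (cmod (coeff_H (X i) n - coeff_H (X j) n))\<^sup>2) \<le> e\<^sup>2" if "j \<ge> M" for j
      proof -
        have "(\<Sum>n<N. (cmod (coeff_H (X i) n - coeff_H (X j) n))\<^sup>2) \<le> (norm (X i - X j))\<^sup>2"
          using sum_coeff_H_le[of "X i - X j" N] by (simp add: minus_dirichlet_H.rep_eq)
        also have "\<dots> \<le> e\<^sup>2"
          using M \<open>i \<ge> M\<close> that by (intro power_mono) (auto simp: dist_norm less_imp_le)
        finally show ?thesis .
      qed
      show "(\<Sum>n<N. (cmod (coeff_H (X i) n - a n))\<^sup>2) \<le> e\<^sup>2"
        by (rule LIMSEQ_le_const2[OF lim]) (use le in blast)
    qed
  qed
  obtain M where M: "\<forall>i\<ge>M. \<forall>N. (\<Sum>n<N. (cmod (coeff_H (X i) n - a n))\<^sup>2) \<le> 1\<^sup>2"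
    using bound[of 1] by auto
  then have sM: "summable (\<lambda>n. (cmod (coeff_H (X M) n - a n))\<^sup>2)"
    by (intro summableI_nonneg_bounded[where x = 1]) auto
  have "summable (\<lambda>n. (cmod (coeff_H (X M) n + - (coeff_H (X M) n - a n)))\<^sup>2)"
    using sM by (intro summable_cmod_add_sq summable_coeff_H) (simp add: norm_minus_commute)
  then have sa: "summable (\<lambda>n. (cmod (a n))\<^sup>2)" by simp
  have "a 0 = 0"
    using LIMSEQ_unique[OF a[of 0]] coeff_H by auto
  define L where "L = Abs_dirichlet_H a"
  have L: "coeff_H L = a"
    unfolding L_def using sa \<open>a 0 = 0\<close> by (simp add: Abs_dirichlet_H_inverse)
  have "X \<longlonglongrightarrow> L"
  proof (rule metric_LIMSEQ_I)
    fix e :: real assume "e > 0"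
    then obtain M where M: "\<forall>i\<ge>M. \<forall>N. (\<Sum>n<N. (cmod (coeff_H (X i) n - a n))\<^sup>2) \<le> (e/2)\<^sup>2"
      using bound[of "e/2"] by auto
    have "dist (X i) L < e" if "i \<ge> M" for i
    proof -
      have "(\<Sum>n. (cmod (coeff_H (X i - L) n))\<^sup>2) \<le> (e/2)\<^sup>2"
        using M that summable_coeff_H[of "X i - L"]
        by (intro suminf_le_const) (auto simp: minus_dirichlet_H.rep_eq L)
      then have "norm (X i - L) \<le> e/2"
        unfolding norm_dirichlet_H using \<open>e > 0\<close> by (intro real_le_lsqrt) auto
      then show ?thesis using \<open>e > 0\<close> by (simp add: dist_norm)
    qed
    then show "\<exists>M. \<forall>i\<ge>M. dist (X i) L < e" by blast
  qed
  then show "convergent X" by (auto simp: convergent_def)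
qed


section \<open>Symbols and composition operators\<close>

text \<open>
  \<open>gordon_hedenmalm \<phi> c0 c\<close>: the map \<open>\<phi>\<close> belongs to the Gordon-Hedenmalm class, with
  characteristic \<open>c0\<close> and \<open>\<psi> = dirichlet_series c\<close>. Only the values of \<open>\<phi>\<close> on the half-plane
  \<open>Re s > 1/2\<close> matter.
\<close>

definition gordon_hedenmalm :: "(complex \<Rightarrow> complex) \<Rightarrow> nat \<Rightarrow> (nat \<Rightarrow> complex) \<Rightarrow> bool" where
  "gordon_hedenmalm \<phi> c0 c \<longleftrightarrow>
     (\<forall>s\<in>halfplane (1/2). \<phi> s = of_nat c0 * s + dirichlet_series c s) \<and>
     \<phi> ` halfplane (1/2) \<subseteq> halfplane (1/2) \<and>
     (\<forall>\<epsilon>>0. uniformly_convergent_on (halfplane \<epsilon>)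
              (\<lambda>N s. \<Sum>n=1..N. c n * of_nat n powr (- s))) \<and>
     (c0 = 0 \<longrightarrow> dirichlet_series c ` halfplane 0 \<subseteq> halfplane (1/2)) \<and>
     (c0 \<ge> 1 \<longrightarrow>
        ((\<forall>s\<in>halfplane 0. dirichlet_series c s = c 1) \<and> Re (c 1) \<ge> 0) \<or>
        dirichlet_series c ` halfplane 0 \<subseteq> halfplane 0)"

definition dirichlet_support :: "(nat \<Rightarrow> complex) \<Rightarrow> nat set" where
  "dirichlet_support c = {n. n \<ge> 1 \<and> c n \<noteq> 0}"

definition dirichlet_polynomial_symbol ::
    "(complex \<Rightarrow> complex) \<Rightarrow> nat \<Rightarrow> (nat \<Rightarrow> complex) \<Rightarrow> bool" where
  "dirichlet_polynomial_symbol \<phi> c0 c \<longleftrightarrow>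
     gordon_hedenmalm \<phi> c0 c \<and> finite (dirichlet_support c)"

text \<open>
  \<open>composition_op \<phi> f\<close> is the element of the Hilbert space whose Dirichlet series represents
  \<open>f \<circ> \<phi>\<close>. It exists for \<open>\<phi>\<close> in the Gordon-Hedenmalm class, and it is unique because a Dirichlet
  series vanishing on a half-plane has zero coefficients.
\<close>

definition composition_op :: "(complex \<Rightarrow> complex) \<Rightarrow> dirichlet_H \<Rightarrow> dirichlet_H" where
  "composition_op \<phi> f = (THE g. \<forall>s\<in>halfplane (1/2). eval_H g s = eval_H f (\<phi> s))"

text \<open>
  Only the real-linear structure is recorded; for a complex-linear operator this changes neither
  boundedness nor compactness.
\<close>

definition compact_operator :: "('a::real_normed_vector \<Rightarrow> 'b::real_normed_vector) \<Rightarrow> bool" where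
  "compact_operator T \<longleftrightarrow> bounded_linear T \<and> compact (closure (T ` cball 0 1))"


section \<open>The Bohr lift\<close>

text \<open>The primes in increasing order, indexed from \<open>0\<close>: \<open>nth_prime 0 = 2\<close>.\<close>

definition nth_prime :: "nat \<Rightarrow> nat" where
  "nth_prime j = enumerate {p. prime p} j"

definition bohr_dim :: "(nat \<Rightarrow> complex) \<Rightarrow> nat" where
  "bohr_dim c = (LEAST d. d \<ge> 1 \<and>
     (\<forall>n\<in>dirichlet_support c. \<exists>\<alpha> :: nat \<Rightarrow> nat. n = (\<Prod>j<d. nth_prime j ^ \<alpha> j)))"

text \<open>
  The number \<open>d\<close> of variables depends on the symbol, so points of \<open>\<complex>\<^sup>d\<close> are functions on
  \<^typ>\<open>nat\<close> of which only the values at \<open>j < d\<close> are used.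
\<close>

definition bohr_lift :: "(nat \<Rightarrow> complex) \<Rightarrow> (nat \<Rightarrow> complex) \<Rightarrow> complex" where
  "bohr_lift c z =
     (\<Sum>n\<in>dirichlet_support c. c n * (\<Prod>j<bohr_dim c. z j ^ multiplicity (nth_prime j) n))"

text \<open>
  Points of the torus \<open>\<T>\<^sup>d\<close> are extended by \<open>0\<close>, so that tori of different dimension are disjoint.
\<close>

definition torus :: "nat \<Rightarrow> (nat \<Rightarrow> complex) set" where
  "torus d = {z. (\<forall>j<d. cmod (z j) = 1) \<and> (\<forall>j\<ge>d. z j = 0)}"

definition Gamma_set :: "(nat \<Rightarrow> complex) \<Rightarrow> (nat \<Rightarrow> complex) set" where
  "Gamma_set c = {z \<in> torus (bohr_dim c). Re (bohr_lift c z) = 0}"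

definition J_fun :: "(nat \<Rightarrow> complex) \<Rightarrow> (nat \<Rightarrow> real) \<Rightarrow> real" where
  "J_fun c \<theta> = Re (bohr_lift c (\<lambda>j. cis (\<theta> j)))"

text \<open>
  Contact of order \<open>2 * n\<close> at \<open>z\<close>. Neighbourhoods in \<open>\<real>\<^sup>d\<close> are given by Euclidean balls. The choice
  of the arguments \<open>\<theta>0\<close> of \<open>z\<close> is irrelevant by periodicity.
\<close>

definition dirichlet_contact :: "(nat \<Rightarrow> complex) \<Rightarrow> nat \<Rightarrow> (nat \<Rightarrow> complex) \<Rightarrow> bool" where
  "dirichlet_contact c n z \<longleftrightarrow> z \<in> Gamma_set c \<and>
     (\<exists>\<theta>0 :: nat \<Rightarrow> real. (\<forall>j<bohr_dim c. z j = cis (\<theta>0 j)) \<and>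
        (\<exists>C>0. \<exists>r>0. \<forall>\<theta>. L2_set (\<lambda>j. \<theta> j - \<theta>0 j) {..<bohr_dim c} < r \<longrightarrow>
           J_fun c \<theta> \<ge> C * (\<Sum>j<bohr_dim c. (\<theta> j - \<theta>0 j)\<^sup>2) ^ n))"


section \<open>Complex partial derivatives\<close>

definition partial_deriv ::
    "nat \<Rightarrow> ((nat \<Rightarrow> complex) \<Rightarrow> complex) \<Rightarrow> (nat \<Rightarrow> complex) \<Rightarrow> complex" where
  "partial_deriv j F z = deriv (\<lambda>w. F (z(j := w))) (z j)"

text \<open>The multi-index consists of the values \<open>\<alpha> j\<close> with \<open>j < d\<close>.\<close>

definition mixed_partial ::
    "nat \<Rightarrow> (nat \<Rightarrow> nat) \<Rightarrow> ((nat \<Rightarrow> complex) \<Rightarrow> complex) \<Rightarrow> (nat \<Rightarrow> complex) \<Rightarrow> complex" where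
  "mixed_partial d \<alpha> F = foldr (\<lambda>j. partial_deriv j ^^ \<alpha> j) [0..<d] F"

end

theory Submission
  imports Defs "HOL-Complex_Analysis.Complex_Analysis"
begin

text \<open>
  Everything is done on the imaginary axis, where the norm of \<open>f \<circ> \<phi>\<close> is a mean value over
  \<open>[-T, T]\<close>. Writing \<open>f \<circ> \<phi> = a\<^sub>1 + exp (- \<mu> \<phi>) * F\<close>, the summands are orthogonal because \<open>c0 \<ge> 1\<close>, and
  \<open>\<bar>exp (- \<mu> \<phi>)\<bar> \<le> 1\<close>; iterating gives \<open>\<parallel>f \<circ> \<phi>\<parallel> \<le> \<parallel>f\<parallel>\<close>, for arbitrary real frequencies in place of \<open>ln n\<close>.

  Sufficiency: agreement of the derivatives up to order two and contact of order two give
  \<open>\<bar>\<psi>\<^sub>0 - \<psi>\<^sub>1\<bar>\<^sup>2 \<le> C * (min (Re \<psi>\<^sub>0) (Re \<psi>\<^sub>1))\<^sup>3\<close> on the imaginary axis. If \<open>f\<close> has its frequencies in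
  \<open>[\<kappa>, 4 \<kappa>]\<close>, then \<open>f \<circ> \<phi>\<^sub>0 - f \<circ> \<phi>\<^sub>1\<close> is an integral of \<open>(\<psi>\<^sub>0 - \<psi>\<^sub>1) * (f' \<circ> \<phi>\<^sub>\<tau>)\<close> over
  \<open>\<tau> \<in> [0, 1]\<close>. Pulling the factor \<open>exp (- \<kappa> \<phi>\<^sub>\<tau>)\<close> out of \<open>f' \<circ> \<phi>\<^sub>\<tau>\<close> and using
  \<open>h\<^sup>3 exp (- 2 \<kappa> h) \<le> 1 / \<kappa>\<^sup>3\<close>, the square of its norm is \<open>O(1/\<kappa>)\<close>. Summing over blocks shows that
  the difference is small on high frequencies, so it is compact.

  Necessity: a compact difference is tested on the differences of the reproducing kernels, over the
  integers composed of the first primes, at \<open>\<phi>\<^sub>0(s)\<close> and \<open>\<phi>\<^sub>1(s)\<close>. This gives \<open>\<psi>\<^sub>0(s) - \<psi>\<^sub>1(s) = o(Re s)\<close>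
  as \<open>Re s \<rightarrow> 0\<close> along points with \<open>Re \<psi>\<^sub>0(s) = O(Re s)\<close>. Given a zero \<open>z\<close> of \<open>Re \<B>\<psi>\<^sub>0\<close> on the torus and a
  real vector \<open>v\<close>, Kronecker's theorem yields such \<open>s\<close> with \<open>Re s = y\<^sup>2\<close> and imaginary part such that the
  unimodular parts of the powers \<open>p\<^sub>j powr (- s)\<close> approximate \<open>z\<^sub>j exp (\<i> y v\<^sub>j)\<close>. The expansion in \<open>y\<close> up to
  order two yields the equality of the derivatives.
\<close>

section \<open>Absolutely convergent Dirichlet series\<close>

text \<open>Domains of convergence shape the proof. A general element lives only on
  \<open>Re s > 1/2\<close>, while the norm estimates need the imaginary axis and the kernel test
  needs \<open>Re s\<close> tending to 0. For a Dirichlet polynomial \<open>f\<close>,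
  \<open>f \<circ> \<phi>\<close> converges absolutely on the closed right half-plane, so estimates
  are made there and extended by truncation. The kernels run over integers composed of finitely many
  primes: their series converge for \<open>Re s > 0\<close>, and composition preserves this subspace
  once the primes include those of the symbol. Means over \<open>[-T, T]\<close> stand for integrals
  over the torus; error terms may depend on the polynomial but not on \<open>T\<close>, and vanish
  after division by \<open>2 T\<close>. The bound \<open>O(1/\<kappa>)\<close> is the cost
  \<open>(4 \<kappa>)\<^sup>2\<close> of differentiating times the gain
  \<open>1/\<kappa>\<^sup>3\<close> from contact. In the converse, \<open>Re s = y\<^sup>2\<close>
  fits a tangential displacement \<open>y\<close>: the real part of the lift, nonnegative and zero
  at the base point, has no first-order term there, so \<open>Re \<psi>\<close> is
  \<open>O(y\<^sup>2)\<close>, while an error \<open>o(y\<^sup>2)\<close> still detects every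
  derivative of order at most two.\<close>

definition dterm :: "nat \<Rightarrow> complex \<Rightarrow> complex" where
  "dterm n s = exp (- (of_real (ln (real n)) * s))"

text \<open>At \<open>n = 0\<close> the two sides differ: \<open>ln 0 = 0\<close> makes
  \<open>dterm 0 s = 1\<close>, whereas \<open>0 powr z = 0\<close>. Supports therefore avoid 0
  throughout.\<close>

lemma powr_eq_dterm: "n > 0 \<Longrightarrow> of_nat n powr (- s) = dterm n s"
  by (simp add: powr_def dterm_def Ln_of_nat mult.commute)

lemma dterm_1 [simp]: "dterm (Suc 0) s = 1"
  by (simp add: dterm_def)

lemma norm_dterm: "norm (dterm n s) = exp (- (ln (real n) * Re s))"
  by (simp add: dterm_def)

lemma norm_dterm_le: "Re s \<ge> 0 \<Longrightarrow> norm (dterm n s) \<le> 1"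
  by (cases "n = 0") (auto simp: norm_dterm)

lemma dterm_mult: "m > 0 \<Longrightarrow> n > 0 \<Longrightarrow> dterm (m * n) s = dterm m s * dterm n s"
  by (simp add: dterm_def ln_mult ring_distribs flip: exp_add)

lemma dterm_power: "n > 0 \<Longrightarrow> dterm (n ^ k) s = dterm n s ^ k"
  by (simp add: dterm_def ln_realpow mult.assoc flip: exp_of_nat_mult)

lemma dterm_add: "dterm n (s + w) = dterm n s * dterm n w"
  by (simp add: dterm_def ring_distribs flip: exp_add)

lemma dterm_of_nat_mult: "dterm n (of_nat k * s) = dterm n s ^ k"
  by (simp add: dterm_def mult.left_commute flip: exp_of_nat_mult)

section \<open>Dirichlet convolution and the algebra of absolutely convergent series\<close>

lemma has_sum_product:
  fixes u :: "'a \<Rightarrow> 'c::{banach, real_normed_field}"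
  assumes "(\<lambda>n. norm (u n)) summable_on A" "(\<lambda>n. norm (v n)) summable_on B" "(u has_sum U) A" "(v has_sum V) B"
  shows "((\<lambda>(i, j). u i * v j) has_sum U * V) (A \<times> B)"
proof (rule has_sum_SigmaI)
  show "((\<lambda>y. case (x, y) of (i, j) \<Rightarrow> u i * v j) has_sum u x * V) B" for x
    using assms by (auto intro: has_sum_cmult_right)
  show "((\<lambda>x. u x * V) has_sum U * V) A"
    using assms by (auto intro: has_sum_cmult_left)
  have "(\<lambda>p. norm (case p of (i, j) \<Rightarrow> u i * v j)) summable_on (A \<times> B)"
    using assms(1,2)
    by (auto simp: Infinite_Sum.abs_summable_on_Sigma_iff norm_mult infsum_cmult_right abs_mult
          intro!: summable_on_cmult_right summable_on_cmult_left)
  then show "(\<lambda>(i, j). u i * v j) summable_on A \<times> B"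
    by (rule abs_summable_summable)
qed

text \<open>A semiring is enough, so the same operation applies to the sequences of norms that
  dominate it. The guard \<open>n > 0\<close> empties the index set at 0, which every number
  divides.\<close>

definition dirichlet_conv :: "(nat \<Rightarrow> 'a::semiring_1) \<Rightarrow> (nat \<Rightarrow> 'a) \<Rightarrow> nat \<Rightarrow> 'a" where
  "dirichlet_conv u v n = (\<Sum>i | i dvd n \<and> n > 0. u i * v (n div i))"

text \<open>The double sum over pairs \<open>(i, j)\<close> is regrouped along the product
  \<open>n = i * j\<close>; the hypotheses at index 0 remove the pairs whose product is 0.\<close>

lemma has_sum_dirichlet_conv:
  fixes u :: "nat \<Rightarrow> 'c::{banach, real_normed_field}"
  assumes "(\<lambda>n. norm (u n)) summable_on UNIV" "(\<lambda>n. norm (v n)) summable_on UNIV"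
    and "(u has_sum U) UNIV" "(v has_sum V) UNIV" and "u 0 = 0" "v 0 = 0"
  shows "(dirichlet_conv u v has_sum U * V) UNIV"
proof -
  have "((\<lambda>(i, j). u i * v j) has_sum U * V) (UNIV \<times> UNIV)"
    by (rule has_sum_product) (use assms in auto)
  then have "((\<lambda>(i, j). u i * v j) has_sum U * V) ({0<..} \<times> {0<..})"
    by (subst has_sum_cong_neutral[where T = "UNIV \<times> UNIV"])
      (use assms(5,6) in \<open>auto intro!: gr0I\<close>)
  also have "?this \<longleftrightarrow> ((\<lambda>(n, i). u i * v (n div i)) has_sum U * V) (SIGMA n:{0<..}. {i. i dvd n \<and> n > 0})"
    by (rule has_sum_reindex_bij_witness[where i = "\<lambda>(n, i). (i, n div i)" and j = "\<lambda>(i, j). (i * j, i)"])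
      (auto elim!: dvdE)
  finally have "((\<lambda>n. \<Sum>i\<in>{i. i dvd n \<and> n > 0}. u i * v (n div i)) has_sum U * V) {0<..}"
    by (rule has_sum_SigmaD) (auto intro!: has_sum_finiteI)
  then show ?thesis
    unfolding dirichlet_conv_def
    by (subst has_sum_cong_neutral[where T = "{0<..}"]) auto
qed

text \<open>Absolute convergence up to the boundary, with control of the support. \<open>S\<close>
  will be all positive integers in the norm estimates and the integers over finitely many primes in
  the kernel test.\<close>

definition abs_dirichlet :: "nat set \<Rightarrow> (nat \<Rightarrow> complex) \<Rightarrow> (complex \<Rightarrow> complex) \<Rightarrow> bool" where
  "abs_dirichlet S b g \<longleftrightarrow> (\<forall>n. n \<notin> S \<longrightarrow> b n = 0) \<and> (\<lambda>n. norm (b n)) summable_on UNIV \<and>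
     (\<forall>s. Re s \<ge> 0 \<longrightarrow> ((\<lambda>n. b n * dterm n s) has_sum g s) UNIV)"

definition mult_monoid :: "nat set \<Rightarrow> bool" where
  "mult_monoid S \<longleftrightarrow> 0 \<notin> S \<and> 1 \<in> S \<and> (\<forall>m\<in>S. \<forall>n\<in>S. m * n \<in> S)"

lemma mult_monoid_power: "mult_monoid S \<Longrightarrow> n \<in> S \<Longrightarrow> n ^ k \<in> S"
  by (induction k) (auto simp: mult_monoid_def)

lemma abs_summable_dterm:
  assumes "(\<lambda>n. norm (b n)) summable_on UNIV" "Re s \<ge> 0"
  shows "(\<lambda>n. norm (b n * dterm n s)) summable_on UNIV"
  by (rule Infinite_Sum.abs_summable_on_comparison_test[OF assms(1)])
    (use norm_dterm_le[OF assms(2)] in \<open>auto simp: norm_mult mult_left_le\<close>)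

lemma abs_dirichlet_mult:
  assumes S: "mult_monoid S" and b: "abs_dirichlet S b g" and d: "abs_dirichlet S d h"
  shows "abs_dirichlet S (dirichlet_conv b d) (\<lambda>s. g s * h s)"
proof -
  have b0: "b 0 = 0" and d0: "d 0 = 0"
    using S b d by (auto simp: abs_dirichlet_def mult_monoid_def)
  have bs: "(\<lambda>n. norm (b n)) summable_on UNIV" and ds: "(\<lambda>n. norm (d n)) summable_on UNIV"
    using b d by (auto simp: abs_dirichlet_def)
  have "dirichlet_conv b d n = 0" if "n \<notin> S" for n
    unfolding dirichlet_conv_def
  proof (rule sum.neutral, safe)
    fix i assume i: "i dvd n" "n > 0"
    have "i * (n div i) = n" using i by auto
    then have "i \<notin> S \<or> n div i \<notin> S" using S that unfolding mult_monoid_def by metis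
    then show "b i * d (n div i) = 0" using b d by (auto simp: abs_dirichlet_def)
  qed
  moreover have "(\<lambda>n. norm (dirichlet_conv b d n)) summable_on UNIV"
  proof (rule Infinite_Sum.abs_summable_on_comparison_test')
    have "(\<lambda>n. norm (norm (b n))) summable_on UNIV" "(\<lambda>n. norm (norm (d n))) summable_on UNIV"
      using bs ds by auto
    from has_sum_dirichlet_conv[OF this has_sum_infsum has_sum_infsum] bs ds b0 d0
    show "dirichlet_conv (\<lambda>n. norm (b n)) (\<lambda>n. norm (d n)) summable_on UNIV"
      by (auto simp: has_sum_imp_summable)
    show "norm (dirichlet_conv b d n) \<le> dirichlet_conv (\<lambda>n. norm (b n)) (\<lambda>n. norm (d n)) n" for n
      unfolding dirichlet_conv_def by (rule sum_norm_le) (simp add: norm_mult)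
  qed
  moreover have "((\<lambda>n. dirichlet_conv b d n * dterm n s) has_sum g s * h s) UNIV" if "Re s \<ge> 0" for s
  proof -
    have "(dirichlet_conv (\<lambda>n. b n * dterm n s) (\<lambda>n. d n * dterm n s) has_sum g s * h s) UNIV"
      using b d that abs_summable_dterm[OF bs that] abs_summable_dterm[OF ds that] b0 d0
      by (intro has_sum_dirichlet_conv) (auto simp: abs_dirichlet_def)
    also have "dirichlet_conv (\<lambda>n. b n * dterm n s) (\<lambda>n. d n * dterm n s) =
        (\<lambda>n. dirichlet_conv b d n * dterm n s)"
      unfolding dirichlet_conv_def sum_distrib_right
    proof (intro ext sum.cong refl, safe)
      fix n i :: nat assume "i dvd n" "n > 0"
      then have "dterm n s = dterm i s * dterm (n div i) s"
        by (subst dterm_mult[symmetric]) (auto elim!: dvdE)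
      then show "b i * dterm i s * (d (n div i) * dterm (n div i) s) = b i * d (n div i) * dterm n s"
        by simp
    qed
    finally show ?thesis .
  qed
  ultimately show ?thesis by (auto simp: abs_dirichlet_def)
qed

lemma abs_dirichlet_const:
  assumes "mult_monoid S"
  shows "abs_dirichlet S (\<lambda>n. if n = 1 then c else 0) (\<lambda>_. c)"
proof -
  have "((\<lambda>n. (if n = 1 then c else 0) * dterm n s) has_sum c) UNIV" for s
    by (subst has_sum_cong_neutral[where T = "{1}" and g = "\<lambda>_. c"]) (auto intro: has_sum_finiteI)
  moreover have "(\<lambda>n. norm (if n = 1 then c else 0)) summable_on UNIV"
    by (subst summable_on_cong_neutral[where T = "{1}" and g = "\<lambda>_. norm c"]) auto
  ultimately show ?thesis
    using assms by (auto simp: abs_dirichlet_def mult_monoid_def simp del: One_nat_def)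
qed

lemma abs_dirichlet_add:
  assumes "abs_dirichlet S b g" "abs_dirichlet S d h"
  shows "abs_dirichlet S (\<lambda>n. b n + d n) (\<lambda>s. g s + h s)"
proof -
  have "(\<lambda>n. norm (b n) + norm (d n)) summable_on UNIV"
    using assms by (auto simp: abs_dirichlet_def intro: summable_on_add)
  then have "(\<lambda>n. norm (b n + d n)) summable_on UNIV"
    by (rule Infinite_Sum.abs_summable_on_comparison_test') (auto intro: norm_triangle_ineq)
  then show ?thesis
    using assms by (auto simp: abs_dirichlet_def ring_distribs intro!: has_sum_add)
qed

lemma abs_dirichlet_cmult:
  assumes "abs_dirichlet S b g"
  shows "abs_dirichlet S (\<lambda>n. c * b n) (\<lambda>s. c * g s)"
  using assms
  by (auto simp: abs_dirichlet_def norm_mult mult.assoc intro!: summable_on_cmult_right has_sum_cmult_right)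

lemma abs_dirichlet_sum:
  assumes "mult_monoid S" "finite F" "\<And>k. k \<in> F \<Longrightarrow> \<exists>b. abs_dirichlet S b (g k)"
  shows "\<exists>b. abs_dirichlet S b (\<lambda>s. \<Sum>k\<in>F. g k s)"
  using assms(2,3)
proof (induction F)
  case empty
  then show ?case using abs_dirichlet_const[OF assms(1), of 0] by auto
next
  case (insert x F)
  then obtain b d where "abs_dirichlet S b (g x)" "abs_dirichlet S d (\<lambda>s. \<Sum>k\<in>F. g k s)" by blast
  from abs_dirichlet_add[OF this] show ?case using insert by auto
qed

lemma abs_dirichlet_prod:
  assumes "mult_monoid S" "finite F" "\<And>k. k \<in> F \<Longrightarrow> \<exists>b. abs_dirichlet S b (g k)"
  shows "\<exists>b. abs_dirichlet S b (\<lambda>s. \<Prod>k\<in>F. g k s)"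
  using assms(2,3)
proof (induction F)
  case empty
  then show ?case using abs_dirichlet_const[OF assms(1), of 1] by auto
next
  case (insert x F)
  then obtain b d where "abs_dirichlet S b (g x)" "abs_dirichlet S d (\<lambda>s. \<Prod>k\<in>F. g k s)" by blast
  from abs_dirichlet_mult[OF assms(1) this] show ?case using insert by auto
qed

text \<open>The exponential series puts \<open>c ^ k / fact k\<close> at the index
  \<open>n ^ k\<close>, so the support stays among the powers of \<open>n\<close>. For
  \<open>n = 1\<close> the powers coincide, hence the separate case.\<close>

lemma abs_dirichlet_exp_dterm:
  assumes S: "mult_monoid S" and n: "n \<in> S"
  shows "\<exists>b. abs_dirichlet S b (\<lambda>s. exp (c * dterm n s))"
proof (cases "n = 1")
  case True
  then show ?thesis using abs_dirichlet_const[OF S, of "exp c"] by auto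
next
  case False
  moreover have "n > 0" using S n by (metis gr0I mult_monoid_def)
  ultimately have n2: "n > 1" by simp
  have inj: "inj ((^) n)" using n2 by (auto intro!: injI)
  define b where "b = (\<lambda>m. if m \<in> range ((^) n) then let k = inv ((^) n) m in c ^ k / fact k else 0)"
  have bn: "b (n ^ k) = c ^ k / fact k" for k
    using inj by (auto simp: b_def Let_def)
  have b0: "b m = 0" if "m \<notin> range ((^) n)" for m using that by (simp add: b_def)
  have exps: "((\<lambda>k. w ^ k / fact k) has_sum exp w) UNIV" for w :: "'z::{banach,real_normed_field}"
  proof (rule norm_summable_imp_has_sum)
    show "summable (\<lambda>k. norm (w ^ k / fact k))"
      using summable_norm_exp[of w] by (simp add: divide_inverse mult.commute norm_mult norm_inverse)
    show "(\<lambda>k. w ^ k / fact k) sums exp w"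
      using exp_converges[of w] by (simp add: scaleR_conv_of_real divide_inverse mult.commute)
  qed
  have "((\<lambda>m. b m * dterm m s) has_sum exp (c * dterm n s)) UNIV" for s
  proof -
    have "((\<lambda>k. b (n ^ k) * dterm (n ^ k) s) has_sum exp (c * dterm n s)) UNIV"
      using exps[of "c * dterm n s"] n2 by (simp add: bn dterm_power power_mult_distrib)
    then have "((\<lambda>m. b m * dterm m s) has_sum exp (c * dterm n s)) (range ((^) n))"
      by (subst has_sum_reindex[OF inj]) (simp add: o_def)
    then show ?thesis
      by (subst has_sum_cong_neutral[where T = "range ((^) n)"]) (auto simp: b0)
  qed
  moreover have "(\<lambda>n. norm (b n)) summable_on UNIV"
  proof -
    have "(\<lambda>k. norm (b (n ^ k))) summable_on UNIV"
      using has_sum_imp_summable[OF exps[of "norm c"]]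
      by (simp add: bn norm_divide norm_power)
    then have "(\<lambda>m. norm (b m)) summable_on (range ((^) n))"
      by (subst summable_on_reindex[OF inj]) (simp add: o_def)
    then show ?thesis
      by (subst summable_on_cong_neutral[where T = "range ((^) n)"]) (auto simp: b0)
  qed
  moreover have "b m = 0" if "m \<notin> S" for m
    using mult_monoid_power[OF S n] that by (intro b0) auto
  ultimately have "abs_dirichlet S b (\<lambda>s. exp (c * dterm n s))"
    by (auto simp: abs_dirichlet_def)
  then show ?thesis by blast
qed

lemma abs_dirichlet_dterm:
  assumes S: "mult_monoid S" and n: "n \<in> S"
  shows "abs_dirichlet S (\<lambda>k. if k = n then 1 else 0) (dterm n)"
proof -
  have "((\<lambda>k. (if k = n then 1 else 0) * dterm k s) has_sum dterm n s) UNIV" for s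
    by (subst has_sum_cong_neutral[where T = "{n}" and g = "\<lambda>_. dterm n s"]) (auto intro: has_sum_finiteI)
  moreover have "(\<lambda>k. norm (if k = n then 1 else (0::complex))) summable_on UNIV"
    by (subst summable_on_cong_neutral[where T = "{n}" and g = "\<lambda>_. 1"]) auto
  ultimately show ?thesis
    using assms by (auto simp: abs_dirichlet_def)
qed

definition dpoly :: "nat set \<Rightarrow> (nat \<Rightarrow> complex) \<Rightarrow> complex \<Rightarrow> complex" where
  "dpoly A c s = (\<Sum>n\<in>A. c n * dterm n s)"

text \<open>Each \<open>dterm k\<close> turns the sum in the symbol into a product:
  \<open>dterm (k ^ c0) s\<close> times the factors \<open>exp (- ln k * c n * dterm n s)\<close>.
  Since \<open>c0\<close> is a natural number, the first factor is again a Dirichlet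
  monomial.\<close>

lemma abs_dirichlet_compose:
  assumes S: "mult_monoid S" and A: "finite A" "A \<subseteq> S" and F: "finite F" "F \<subseteq> S"
  shows "\<exists>b. abs_dirichlet S b (\<lambda>s. dpoly F f (of_nat c0 * s + dpoly A c s))"
  unfolding dpoly_def
proof (rule abs_dirichlet_sum[OF S F(1)])
  fix k assume k: "k \<in> F"
  define l where "l = complex_of_real (ln (real k))"
  have "dterm k (of_nat c0 * s + (\<Sum>n\<in>A. c n * dterm n s)) =
     dterm (k ^ c0) s * (\<Prod>n\<in>A. exp ((- l * c n) * dterm n s))" for s
  proof -
    have "k > 0" using k F S by (metis gr0I mult_monoid_def subsetD)
    then show ?thesis
      unfolding dterm_add dterm_of_nat_mult
      using A by (simp add: dterm_power exp_sum[symmetric] l_def[symmetric] dterm_def[of k "sum _ _"]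
          sum_distrib_left mult.assoc sum_negf)
  qed
  moreover obtain b where "abs_dirichlet S b (\<lambda>s. \<Prod>n\<in>A. exp ((- l * c n) * dterm n s))"
    using abs_dirichlet_prod[OF S A(1), of "\<lambda>n s. exp ((- l * c n) * dterm n s)"] A
      abs_dirichlet_exp_dterm[OF S] by blast
  moreover have "abs_dirichlet S (\<lambda>j. if j = k ^ c0 then 1 else 0) (dterm (k ^ c0))"
    using k F by (intro abs_dirichlet_dterm S mult_monoid_power) auto
  ultimately show "\<exists>b. abs_dirichlet S b (\<lambda>s. f k * dterm k (of_nat c0 * s + (\<Sum>n\<in>A. c n * dterm n s)))"
    using abs_dirichlet_cmult[OF abs_dirichlet_mult[OF S], of _ "dterm (k ^ c0)"] by (simp only:) blast
qed

section \<open>Mean values along the imaginary axis\<close>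

lemma has_integral_norm_le:
  fixes f :: "'n::euclidean_space \<Rightarrow> 'a::banach"
  assumes "(f has_integral I) S" "(g has_integral J) S" "\<And>x. x \<in> S \<Longrightarrow> norm (f x) \<le> g x"
  shows "norm I \<le> J"
  using integral_norm_bound_integral[of f S g] assms
  by (simp add: has_integral_integrable_integral)

text \<open>Contour shift: the vertical segment is replaced by the other three sides of a rectangle.
  Each horizontal side contributes at most the integral of \<open>exp (- \<kappa> * x)\<close>, that
  is \<open>1 / \<kappa>\<close>, and the far side vanishes as its abscissa grows. The point is that
  the bound does not involve \<open>T\<close>.\<close>

lemma integral_vertical_decay_bound:
  assumes G: "G holomorphic_on UNIV" and \<kappa>: "\<kappa> > 0" and T: "T \<ge> 0"
    and bound: "\<And>s. Re s \<ge> 0 \<Longrightarrow> norm (G s) \<le> exp (- \<kappa> * Re s)"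
  shows "norm (integral {-T..T} (\<lambda>t. G (\<i> * of_real t))) \<le> 2 / \<kappa>"
proof -
  \<comment> \<open>An entire primitive takes the place of Cauchy's theorem on the
    rectangle.\<close>
  obtain P where P: "\<And>z. (P has_field_derivative G z) (at z)"
    using holomorphic_convex_primitive'[of UNIV G] G by auto
  have vert: "((\<lambda>t. \<i> * G (of_real R + \<i> * of_real t)) has_integral
      P (of_real R + \<i> * of_real T) - P (of_real R - \<i> * of_real T)) {-T..T}" for R
  proof -
    have "((\<lambda>t. \<i> * G (of_real R + \<i> * of_real t)) has_integral
      P (of_real R + \<i> * of_real T) - P (of_real R + \<i> * of_real (-T))) {-T..T}"
    proof (rule fundamental_theorem_of_calculus)
      fix t :: real
      show "((\<lambda>t. P (of_real R + \<i> * of_real t)) has_vector_derivative \<i> * G (of_real R + \<i> * of_real t))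
          (at t within {-T..T})"
        by (rule has_vector_derivative_at_within)
          (auto intro!: derivative_eq_intros field_vector_diff_chain_at[OF _ P, unfolded o_def])
    qed (use T in auto)
    then show ?thesis by simp
  qed
  have hor: "norm (P (of_real R + \<i> * of_real y) - P (\<i> * of_real y)) \<le> 1 / \<kappa>" if "R \<ge> 0" for R y
  proof -
    have "((\<lambda>x. G (of_real x + \<i> * of_real y)) has_integral
      P (of_real R + \<i> * of_real y) - P (of_real 0 + \<i> * of_real y)) {0..R}"
    proof (rule fundamental_theorem_of_calculus)
      fix x :: real
      have "((\<lambda>x. P (of_real x + \<i> * of_real y)) has_vector_derivative 1 * G (of_real x + \<i> * of_real y)) (at x)"
        by (rule field_vector_diff_chain_at[OF _ P, unfolded o_def]) (auto intro!: derivative_eq_intros)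
      then show "((\<lambda>x. P (of_real x + \<i> * of_real y)) has_vector_derivative G (of_real x + \<i> * of_real y))
          (at x within {0..R})"
        by (simp add: has_vector_derivative_at_within)
    qed (use that in auto)
    moreover have "((\<lambda>x. exp (- \<kappa> * x)) has_integral - exp (- \<kappa> * R) / \<kappa> - (- exp (- \<kappa> * 0) / \<kappa>)) {0..R}"
      by (rule fundamental_theorem_of_calculus)
        (use \<kappa> that in \<open>auto intro!: derivative_eq_intros simp: has_real_derivative_iff_has_vector_derivative[symmetric]\<close>)
    ultimately have "norm (P (of_real R + \<i> * of_real y) - P (of_real 0 + \<i> * of_real y))
        \<le> - exp (- \<kappa> * R) / \<kappa> - (- exp (- \<kappa> * 0) / \<kappa>)"
    proof (rule has_integral_norm_le)
      show "norm (G (of_real x + \<i> * of_real y)) \<le> exp (- \<kappa> * x)" if "x \<in> {0..R}" for x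
        using bound[of "of_real x + \<i> * of_real y"] that by simp
    qed
    also have "\<dots> \<le> 1 / \<kappa>"
      using \<kappa> by (simp add: field_simps)
    finally show ?thesis by simp
  qed
  have "norm (integral {-T..T} (\<lambda>t. G (\<i> * of_real t))) \<le> 2 / \<kappa> + 2 * T * exp (- \<kappa> * R)" if "R \<ge> 0" for R
  proof -
    have "norm (integral {-T..T} (\<lambda>t. G (\<i> * of_real t))) =
        norm (P (\<i> * of_real T) - P (- (\<i> * of_real T)))"
    proof -
      have "integral {-T..T} (\<lambda>t. \<i> * G (\<i> * of_real t)) = P (\<i> * of_real T) - P (- (\<i> * of_real T))"
        using integral_unique[OF vert[of 0]] by simp
      then show ?thesis by (metis integral_mult_right norm_mult norm_ii mult_1)
    qed
    also have "P (\<i> * of_real T) - P (- (\<i> * of_real T)) =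
      (P (of_real R + \<i> * of_real T) - P (of_real R - \<i> * of_real T)) -
      (P (of_real R + \<i> * of_real T) - P (\<i> * of_real T)) +
      (P (of_real R + \<i> * of_real (-T)) - P (\<i> * of_real (-T)))" (is "_ = ?A - ?B + ?C") by simp
    also have "norm (?A - ?B + ?C) \<le> norm ?A + norm ?B + norm ?C"
      by (meson add_right_mono norm_triangle_ineq norm_triangle_ineq4 order_trans)
    also have "norm ?A \<le> 2 * T * exp (- \<kappa> * R)"
    proof -
      have "((\<lambda>_. exp (- \<kappa> * R)) has_integral 2 * T * exp (- \<kappa> * R)) {-T..T}"
        using has_integral_const_real[of "exp (- \<kappa> * R)" "-T" T] T by simp
      moreover have "norm (\<i> * G (of_real R + \<i> * of_real t)) \<le> exp (- \<kappa> * R)" for t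
        using bound[of "of_real R + \<i> * of_real t"] that by (simp add: norm_mult)
      ultimately show ?thesis by (rule has_integral_norm_le[OF vert[of R]])
    qed
    also have "norm ?B \<le> 1 / \<kappa>" using hor that by blast
    also have "norm ?C \<le> 1 / \<kappa>" using hor that by blast
    finally show ?thesis by simp
  qed
  moreover have "((\<lambda>R. 2 / \<kappa> + 2 * T * exp (- \<kappa> * R)) \<longlongrightarrow> 2 / \<kappa> + 2 * T * 0) at_top"
  proof (intro tendsto_intros)
    show "((\<lambda>R. exp (- \<kappa> * R)) \<longlongrightarrow> 0) at_top"
      by (rule filterlim_compose[OF exp_at_bot filterlim_tendsto_neg_mult_at_bot[OF tendsto_const]])
        (use \<kappa> in \<open>auto intro: filterlim_ident\<close>)
  qed
  ultimately have "norm (integral {-T..T} (\<lambda>t. G (\<i> * of_real t))) \<le> 2 / \<kappa> + 2 * T * 0"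
    by (intro tendsto_lowerbound[where F = at_top]) (auto intro: eventually_mono[OF eventually_ge_at_top[of 0]])
  then show ?thesis by simp
qed

text \<open>All that the mean-square estimate needs to know about \<open>p\<close>, the restriction
  of a symbol to the imaginary axis: the exponentials are bounded, and positive frequencies have
  mean zero at a rate uniform in \<open>T\<close>. Since only \<open>K\<close> is visible, one
  estimate serves a whole family of symbols.\<close>

definition decaying_exponent :: "real \<Rightarrow> (real \<Rightarrow> complex) \<Rightarrow> bool" where
  "decaying_exponent K p \<longleftrightarrow> continuous_on UNIV p \<and> (\<forall>t. Re (p t) \<ge> 0) \<and>
     (\<forall>\<nu>>0. \<forall>T\<ge>0. norm (integral {-T..T} (\<lambda>t. exp (- (of_real \<nu> * p t)))) \<le> K / \<nu>)"

lemma norm_exp_decaying: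
  assumes "decaying_exponent K p" "x \<ge> 0"
  shows "norm (exp (- (of_real x * p t))) \<le> 1"
  using assms by (simp add: decaying_exponent_def)

lemma norm_add_sq: "(norm (a + b))\<^sup>2 = (norm a)\<^sup>2 + 2 * Re (cnj a * b) + (norm (b::complex))\<^sup>2"
  unfolding cmod_power2 by (simp add: power2_eq_square algebra_simps)

text \<open>
  Splitting off the smallest exponent \<open>b\<close> leaves \<open>a b + exp (- \<mu> p) * F\<close>. The two summands are
  nearly orthogonal, and the factor \<open>exp (- \<mu> p)\<close> is bounded by \<open>1\<close>.
\<close>

lemma mean_square_exponentials:
  fixes a :: "real \<Rightarrow> complex"
  assumes "finite F" "K \<ge> 0"
  shows "\<exists>E\<ge>0. \<forall>p y T. decaying_exponent K p \<longrightarrow> (\<forall>x\<in>F. y \<le> x) \<longrightarrow> T \<ge> 0 \<longrightarrow>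
    integral {-T..T} (\<lambda>t. (cmod (\<Sum>x\<in>F. a x * exp (- (of_real (x - y) * p t))))\<^sup>2)
      \<le> 2 * T * (\<Sum>x\<in>F. (cmod (a x))\<^sup>2) + E \<and>
    ((\<forall>t. Re (p t) = 0) \<longrightarrow>
    integral {-T..T} (\<lambda>t. (cmod (\<Sum>x\<in>F. a x * exp (- (of_real (x - y) * p t))))\<^sup>2)
      \<ge> 2 * T * (\<Sum>x\<in>F. (cmod (a x))\<^sup>2) - E)"
  using assms(1)
proof (induction F rule: finite_linorder_min_induct)
  case empty
  then show ?case by (intro exI[of _ 0]) auto
next
  case (insert b F)
  obtain E where E: "E \<ge> 0" and *: "\<And>p y T. decaying_exponent K p \<Longrightarrow> (\<forall>x\<in>F. y \<le> x) \<Longrightarrow> T \<ge> 0 \<Longrightarrow>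
    integral {-T..T} (\<lambda>t. (cmod (\<Sum>x\<in>F. a x * exp (- (of_real (x - y) * p t))))\<^sup>2)
      \<le> 2 * T * (\<Sum>x\<in>F. (cmod (a x))\<^sup>2) + E \<and>
    ((\<forall>t. Re (p t) = 0) \<longrightarrow>
    integral {-T..T} (\<lambda>t. (cmod (\<Sum>x\<in>F. a x * exp (- (of_real (x - y) * p t))))\<^sup>2)
      \<ge> 2 * T * (\<Sum>x\<in>F. (cmod (a x))\<^sup>2) - E)"
    using insert.IH by blast
  \<comment> \<open>Bounds the cross term between \<open>a b\<close> and the remainder: every
    frequency \<open>x - b\<close> is positive, so its integral is at most
    \<open>K / (x - b)\<close>.\<close>
  define E1 where "E1 = 2 * cmod (a b) * (\<Sum>x\<in>F. cmod (a x) * (K / (x - b)))"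
  have E1: "E1 \<ge> 0"
    unfolding E1_def
  proof (intro mult_nonneg_nonneg sum_nonneg)
    show "0 \<le> K / (x - b)" if "x \<in> F" for x
      using that insert.hyps assms(2) by (simp add: less_imp_le)
  qed auto
  show ?case
  proof (intro exI[of _ "E + E1"] conjI allI impI)
    show "0 \<le> E + E1" using E E1 by simp
    fix p y T assume p: "decaying_exponent K p" and y: "\<forall>x\<in>insert b F. y \<le> x" and T: "T \<ge> (0::real)"
    define R where "R = (\<lambda>t. \<Sum>x\<in>F. a x * exp (- (of_real (x - b) * p t)))"
    have cp: "continuous_on A p" for A
      using p continuous_on_subset unfolding decaying_exponent_def by blast
    have cR: "continuous_on A R" for A
      unfolding R_def by (intro continuous_intros cp)
    have eq: "(\<Sum>x\<in>insert b F. a x * exp (- (of_real (x - y) * p t))) = exp (- (of_real (b - y) * p t)) * (a b + R t)" for t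
      using insert.hyps unfolding R_def
      by (auto simp: ring_distribs sum_distrib_left mult.left_commute simp flip: exp_add)
    have cint: "(\<lambda>t. f t) integrable_on {-T..T}" if "continuous_on {-T..T} f" for f :: "real \<Rightarrow> 'z::banach"
      using that by (rule integrable_continuous_real)
    have sq: "integral {-T..T} (\<lambda>t. (cmod (a b + R t))\<^sup>2) =
       2 * T * (cmod (a b))\<^sup>2 + 2 * Re (cnj (a b) * integral {-T..T} R) + integral {-T..T} (\<lambda>t. (cmod (R t))\<^sup>2)"
    proof -
      have "integral {-T..T} (\<lambda>t. Re (cnj (a b) * R t)) = Re (integral {-T..T} (\<lambda>t. cnj (a b) * R t))"
      proof -
        have "continuous_on {-T..T} (\<lambda>t. cnj (a b) * R t)" by (intro continuous_intros cR)
        from integral_linear[OF cint[OF this] bounded_linear_Re] show ?thesis by (simp only: o_def)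
      qed
      moreover have "integral {-T..T} (\<lambda>t. (cmod (a b + R t))\<^sup>2) =
         integral {-T..T} (\<lambda>t. (cmod (a b))\<^sup>2 + 2 * Re (cnj (a b) * R t) + (cmod (R t))\<^sup>2)"
        by (simp add: norm_add_sq)
      moreover have "\<dots> = integral {-T..T} (\<lambda>t. (cmod (a b))\<^sup>2) + 2 * integral {-T..T} (\<lambda>t. Re (cnj (a b) * R t))
           + integral {-T..T} (\<lambda>t. (cmod (R t))\<^sup>2)"
        by (simp add: integral_add cint continuous_intros cR flip: integral_mult_right)
      ultimately show ?thesis using T by simp
    qed
    have "norm (integral {-T..T} R) \<le> (\<Sum>x\<in>F. cmod (a x) * (K / (x - b)))"
    proof -
      have "integral {-T..T} R = (\<Sum>x\<in>F. a x * integral {-T..T} (\<lambda>t. exp (- (of_real (x - b) * p t))))"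
        unfolding R_def using insert.hyps
        by (subst integral_sum) (auto intro!: cint continuous_intros cp)
      also have "norm \<dots> \<le> (\<Sum>x\<in>F. cmod (a x) * (K / (x - b)))"
      proof (intro sum_norm_le)
        fix x assume "x \<in> F"
        then have "norm (integral {-T..T} (\<lambda>t. exp (- (of_real (x - b) * p t)))) \<le> K / (x - b)"
          using insert.hyps p T unfolding decaying_exponent_def by (metis diff_gt_0_iff_gt)
        then show "norm (a x * integral {-T..T} (\<lambda>t. exp (- (of_real (x - b) * p t)))) \<le> cmod (a x) * (K / (x - b))"
          by (simp only: norm_mult mult_left_mono norm_ge_zero)
      qed
      finally show ?thesis .
    qed
    then have "\<bar>2 * Re (cnj (a b) * integral {-T..T} R)\<bar> \<le> E1"
    proof -
      assume *: "norm (integral {-T..T} R) \<le> (\<Sum>x\<in>F. cmod (a x) * (K / (x - b)))"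
      have "\<bar>2 * Re (cnj (a b) * integral {-T..T} R)\<bar> \<le> 2 * cmod (cnj (a b) * integral {-T..T} R)"
        using abs_Re_le_cmod[of "cnj (a b) * integral {-T..T} R"] by linarith
      also have "\<dots> \<le> E1"
        unfolding E1_def using mult_left_mono[OF *, of "2 * cmod (a b)"] by (simp only: norm_mult complex_mod_cnj) simp
      finally show ?thesis .
    qed
    note cross = this[unfolded abs_le_iff]
    \<comment> \<open>The shift is raised from \<open>y\<close> to \<open>b\<close>, because the
      remainder \<open>R\<close> carries the frequencies \<open>x - b\<close>; the induction
      hypothesis has to be general in \<open>y\<close>.\<close>
    have IH: "integral {-T..T} (\<lambda>t. (cmod (R t))\<^sup>2) \<le> 2 * T * (\<Sum>x\<in>F. (cmod (a x))\<^sup>2) + E"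
      "(\<forall>t. Re (p t) = 0) \<Longrightarrow> integral {-T..T} (\<lambda>t. (cmod (R t))\<^sup>2) \<ge> 2 * T * (\<Sum>x\<in>F. (cmod (a x))\<^sup>2) - E"
      using *[OF p _ T, of b] insert.hyps by (auto simp: R_def less_imp_le)
    have S: "(\<Sum>x\<in>insert b F. (cmod (a x))\<^sup>2) = (cmod (a b))\<^sup>2 + (\<Sum>x\<in>F. (cmod (a x))\<^sup>2)"
      using insert.hyps by (subst sum.insert) auto
    have "integral {-T..T} (\<lambda>t. (cmod (\<Sum>x\<in>insert b F. a x * exp (- (of_real (x - y) * p t))))\<^sup>2)
       \<le> integral {-T..T} (\<lambda>t. (cmod (a b + R t))\<^sup>2)"
      unfolding eq
    proof (intro integral_le cint continuous_intros cp cR power_mono)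
      fix t show "cmod (exp (- (of_real (b - y) * p t)) * (a b + R t)) \<le> cmod (a b + R t)"
        using norm_exp_decaying[OF p, of "b - y" t] y by (simp add: norm_mult mult_left_le_one_le del: of_real_diff norm_exp_eq_Re)
    qed auto
    also have "\<dots> \<le> 2 * T * (\<Sum>x\<in>insert b F. (cmod (a x))\<^sup>2) + (E + E1)"
      unfolding sq S using cross IH(1) by (simp add: ring_distribs)
    finally show "integral {-T..T} (\<lambda>t. (cmod (\<Sum>x\<in>insert b F. a x * exp (- (of_real (x - y) * p t))))\<^sup>2)
       \<le> 2 * T * (\<Sum>x\<in>insert b F. (cmod (a x))\<^sup>2) + (E + E1)" .
    assume Re0: "\<forall>t. Re (p t) = 0"
    \<comment> \<open>For purely imaginary \<open>p\<close> the extracted factor is unimodular, so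
      nothing is lost and the lower bound survives.\<close>
    have "integral {-T..T} (\<lambda>t. (cmod (\<Sum>x\<in>insert b F. a x * exp (- (of_real (x - y) * p t))))\<^sup>2)
       = integral {-T..T} (\<lambda>t. (cmod (a b + R t))\<^sup>2)"
      unfolding eq by (simp add: norm_mult Re0)
    also have "\<dots> \<ge> 2 * T * (\<Sum>x\<in>insert b F. (cmod (a x))\<^sup>2) - (E + E1)"
      unfolding sq S using cross IH(2) Re0 by (simp add: ring_distribs)
    finally show "2 * T * (\<Sum>x\<in>insert b F. (cmod (a x))\<^sup>2) - (E + E1) \<le>
      integral {-T..T} (\<lambda>t. (cmod (\<Sum>x\<in>insert b F. a x * exp (- (of_real (x - y) * p t))))\<^sup>2)" .
  qed
qed

lemma mean_square_dpoly:
  fixes a :: "nat \<Rightarrow> complex"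
  assumes F: "finite F" "0 \<notin> F" and K: "K \<ge> 0"
  shows "\<exists>E\<ge>0. \<forall>p y T. decaying_exponent K p \<longrightarrow> (\<forall>n\<in>F. y \<le> ln (real n)) \<longrightarrow> T \<ge> 0 \<longrightarrow>
    integral {-T..T} (\<lambda>t. (cmod (\<Sum>n\<in>F. a n * exp (- (of_real (ln (real n) - y) * p t))))\<^sup>2)
      \<le> 2 * T * (\<Sum>n\<in>F. (cmod (a n))\<^sup>2) + E \<and>
    ((\<forall>t. Re (p t) = 0) \<longrightarrow>
    integral {-T..T} (\<lambda>t. (cmod (\<Sum>n\<in>F. a n * exp (- (of_real (ln (real n) - y) * p t))))\<^sup>2)
      \<ge> 2 * T * (\<Sum>n\<in>F. (cmod (a n))\<^sup>2) - E)"
proof -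
  define l where "l = (\<lambda>n. ln (real n))"
  have inj: "inj_on l F"
    using F(2) by (auto simp: l_def inj_on_def) (metis exp_ln gr0I of_nat_0_less_iff of_nat_eq_iff)
  define a' where "a' = (\<lambda>x. a (inv_into F l x))"
  have a': "a' (l n) = a n" if "n \<in> F" for n
    using inj that by (simp add: a'_def)
  have "(\<Sum>x\<in>l ` F. a' x * f x) = (\<Sum>n\<in>F. a n * f (l n))" for f
    using inj by (simp add: sum.reindex a' cong: sum.cong)
  moreover have "(\<Sum>x\<in>l ` F. (cmod (a' x))\<^sup>2) = (\<Sum>n\<in>F. (cmod (a n))\<^sup>2)"
    using inj by (simp add: sum.reindex a' cong: sum.cong)
  ultimately show ?thesis
    using mean_square_exponentials[of "l ` F" K a'] F K by (simp add: l_def)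
qed

text \<open>The imaginary axis itself, on which the exponentials are unimodular: it provides the
  lower bound by which mean squares recover coefficients.\<close>

lemma decaying_exponent_imag: "decaying_exponent 2 (\<lambda>t. \<i> * of_real t)"
  unfolding decaying_exponent_def
proof (intro conjI allI impI)
  fix \<nu> T :: real assume *: "\<nu> > 0" "T \<ge> 0"
  have "norm (integral {-T..T} (\<lambda>t. exp (- (of_real \<nu> * (\<i> * of_real t))))) \<le> 2 / \<nu>"
    by (rule integral_vertical_decay_bound[of "\<lambda>s. exp (- (of_real \<nu> * s))" \<nu> T])
      (use * in \<open>auto intro!: holomorphic_intros\<close>)
  then show "norm (integral {-T..T} (\<lambda>t. exp (- (of_real \<nu> * (\<i> * of_real t))))) \<le> 2 / \<nu>" .
qed (auto intro!: continuous_intros)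

text \<open>Here \<open>c0 > 0\<close> enters: \<open>exp (- \<nu> * \<phi>)\<close> decays like
  \<open>exp (- c0 * \<nu> * Re s)\<close> into the half-plane, while the nonnegative real part of
  \<open>\<psi>\<close> bounds the other factor by 1.\<close>

lemma decaying_exponent_symbol:
  assumes \<psi>: "\<psi> holomorphic_on UNIV" and pos: "\<And>s. Re s \<ge> 0 \<Longrightarrow> Re (\<psi> s) \<ge> 0" and c0: "c0 > (0::nat)"
  shows "decaying_exponent (2 / real c0) (\<lambda>t. of_nat c0 * (\<i> * of_real t) + \<psi> (\<i> * of_real t))"
  unfolding decaying_exponent_def
proof (intro conjI allI impI)
  have "continuous_on UNIV \<psi>"
    using \<psi> by (rule holomorphic_on_imp_continuous_on)
  then show "continuous_on UNIV (\<lambda>t. of_nat c0 * (\<i> * of_real t) + \<psi> (\<i> * of_real t))"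
    by (intro continuous_intros continuous_on_compose2[where f = "\<lambda>t. \<i> * of_real t" and g = \<psi>]) auto
  fix \<nu> T :: real assume *: "\<nu> > 0" "T \<ge> 0"
  have "norm (integral {-T..T} (\<lambda>t. exp (- (of_real \<nu> * (of_nat c0 * (\<i> * of_real t) + \<psi> (\<i> * of_real t)))))) \<le> 2 / (real c0 * \<nu>)"
  proof (rule integral_vertical_decay_bound[of "\<lambda>s. exp (- (of_real \<nu> * (of_nat c0 * s + \<psi> s)))"])
    show "(\<lambda>s. exp (- (of_real \<nu> * (of_nat c0 * s + \<psi> s)))) holomorphic_on UNIV"
      by (intro holomorphic_intros \<psi>)
    fix s :: complex assume "Re s \<ge> 0"
    then show "norm (exp (- (of_real \<nu> * (of_nat c0 * s + \<psi> s)))) \<le> exp (- (real c0 * \<nu>) * Re s)"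
      using pos[of s] * by (simp add: algebra_simps)
  qed (use * c0 in auto)
  then show "norm (integral {-T..T} (\<lambda>t. exp (- (of_real \<nu> * (of_nat c0 * (\<i> * of_real t) + \<psi> (\<i> * of_real t)))))) \<le> 2 / real c0 / \<nu>"
    by simp
qed (use pos in auto)

text \<open>Bessel's inequality for the mean value. Absolute convergence makes a finite partial sum
  uniformly close to \<open>g\<close> on the imaginary axis; its mean square is known from below,
  and division by \<open>2 * T\<close> removes both \<open>E\<close> and \<open>E'\<close> in the
  limit.\<close>

lemma coeff_square_sum_le_mean:
  assumes b: "abs_dirichlet S b g" and S: "0 \<notin> S"
    and bound: "\<And>T. T > 0 \<Longrightarrow> integral {-T..T} (\<lambda>t. (cmod (g (\<i> * of_real t)))\<^sup>2) \<le> 2 * T * B + E"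
    and cont: "continuous_on UNIV g"
    and F: "finite F"
  shows "(\<Sum>n\<in>F. (cmod (b n))\<^sup>2) \<le> B"
proof (rule field_le_epsilon)
  fix \<epsilon> :: real assume "\<epsilon> > 0"
  have bs: "(\<lambda>n. norm (b n)) summable_on UNIV" using b by (simp add: abs_dirichlet_def)
  define M where "M = infsum (\<lambda>n. norm (b n)) UNIV"
  have M: "M \<ge> 0" by (simp add: M_def infsum_nonneg)
  \<comment> \<open>Chosen so that enlarging \<open>cmod g\<close>, which is at most
    \<open>M\<close>, by \<open>\<delta>\<close> raises its square by at most
    \<open>\<epsilon>\<close>.\<close>
  define \<delta> where "\<delta> = min 1 (\<epsilon> / (2 * M + 1))"
  have \<delta>: "\<delta> > 0" "\<delta> * (2 * M + \<delta>) \<le> \<epsilon>"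
  proof -
    show "\<delta> > 0" using \<open>\<epsilon> > 0\<close> M by (simp add: \<delta>_def)
    then have "\<delta> * (2 * M + \<delta>) \<le> (\<epsilon> / (2 * M + 1)) * (2 * M + 1)"
      using M by (intro mult_mono) (auto simp: \<delta>_def)
    then show "\<delta> * (2 * M + \<delta>) \<le> \<epsilon>" using M by simp
  qed
  obtain F1 where F1: "finite F1" "dist (\<Sum>n\<in>F1. norm (b n)) M \<le> \<delta>"
    using infsum_finite_approximation[OF bs \<delta>(1)] unfolding M_def by blast
  define F' where "F' = (F \<union> F1) - {0}"
  have F': "finite F'" "0 \<notin> F'" using F F1 by (auto simp: F'_def)
  have b0: "b 0 = 0" using b S by (auto simp: abs_dirichlet_def)
  define q where "q = (\<lambda>t. \<Sum>n\<in>F'. b n * dterm n (\<i> * of_real t))"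
  have tail: "infsum (\<lambda>n. norm (b n)) (UNIV - F') \<le> \<delta>"
  proof -
    have "(\<Sum>n\<in>F1. norm (b n)) \<le> (\<Sum>n\<in>F \<union> F1. norm (b n))"
      using F F1 by (intro sum_mono2) auto
    also have "\<dots> = (\<Sum>n\<in>F'. norm (b n))"
      unfolding F'_def using F F1 b0 by (intro sum.mono_neutral_right) auto
    finally have "(\<Sum>n\<in>F1. norm (b n)) \<le> (\<Sum>n\<in>F'. norm (b n))" .
    moreover have "infsum (\<lambda>n. norm (b n)) (UNIV - F') = M - (\<Sum>n\<in>F'. norm (b n))"
      unfolding M_def using infsum_Diff[OF bs, of F'] F' by (simp add: summable_on_finite)
    ultimately show ?thesis using F1 by (simp add: dist_real_def)
  qed
  have close: "norm (q t - g (\<i> * of_real t)) \<le> \<delta>" and gM: "norm (g (\<i> * of_real t)) \<le> M" for t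
  proof -
    have hs: "((\<lambda>n. b n * dterm n (\<i> * of_real t)) has_sum g (\<i> * of_real t)) UNIV"
      using b by (auto simp: abs_dirichlet_def)
    have nm: "norm (b n * dterm n (\<i> * of_real t)) = norm (b n)" for n
      by (simp add: norm_mult norm_dterm)
    have "((\<lambda>n. b n * dterm n (\<i> * of_real t)) has_sum g (\<i> * of_real t) - q t) (UNIV - F')"
      unfolding q_def by (intro has_sum_Diff hs) (use F' in auto)
    then have "norm (g (\<i> * of_real t) - q t) \<le> infsum (\<lambda>n. norm (b n)) (UNIV - F')"
      by (rule norm_infsum_le[OF _ has_sum_infsum])
        (auto simp: nm intro: summable_on_subset_banach[OF bs])
    then show "norm (q t - g (\<i> * of_real t)) \<le> \<delta>" using tail by (simp add: norm_minus_commute)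
    show "norm (g (\<i> * of_real t)) \<le> M" unfolding M_def
      by (rule norm_infsum_le[OF hs has_sum_infsum[OF bs]]) (auto simp: nm)
  qed
  obtain E' where E': "E' \<ge> 0"
    "\<And>T. T \<ge> 0 \<Longrightarrow> integral {-T..T} (\<lambda>t. (cmod (q t))\<^sup>2) \<ge> 2 * T * (\<Sum>n\<in>F'. (cmod (b n))\<^sup>2) - E'"
  proof -
    obtain E' where "E' \<ge> 0" and *: "\<And>p y T. decaying_exponent 2 p \<Longrightarrow> (\<forall>n\<in>F'. y \<le> ln (real n)) \<Longrightarrow> T \<ge> 0 \<Longrightarrow>
      (\<forall>t. Re (p t) = 0) \<Longrightarrow>
      integral {-T..T} (\<lambda>t. (cmod (\<Sum>n\<in>F'. b n * exp (- (of_real (ln (real n) - y) * p t))))\<^sup>2)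
        \<ge> 2 * T * (\<Sum>n\<in>F'. (cmod (b n))\<^sup>2) - E'"
      using mean_square_dpoly[OF F', of 2 b] by (simp (no_asm_use)) blast
    have "0 \<le> ln (real n)" if "n \<in> F'" for n using that F'(2) by (cases "n = 0") auto
    then show ?thesis
      using that[OF \<open>E' \<ge> 0\<close>] *[OF decaying_exponent_imag, of 0] by (simp add: q_def dterm_def)
  qed
  have cg: "continuous_on A (\<lambda>t. g (\<i> * of_real t))" for A
    by (rule continuous_on_compose2[OF cont]) (auto intro!: continuous_intros)
  have cq: "continuous_on A q" for A
    unfolding q_def dterm_def by (intro continuous_intros)
  have main: "(\<Sum>n\<in>F'. (cmod (b n))\<^sup>2) \<le> B + \<epsilon> + (E + E') / (2 * T)" if T: "T > 0" for T
  proof -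
    have "2 * T * (\<Sum>n\<in>F'. (cmod (b n))\<^sup>2) - E' \<le> integral {-T..T} (\<lambda>t. (cmod (q t))\<^sup>2)"
      using E' T by simp
    also have "\<dots> \<le> integral {-T..T} (\<lambda>t. (cmod (g (\<i> * of_real t)))\<^sup>2 + \<epsilon>)"
    proof (intro integral_le integrable_continuous_real continuous_intros cg cq)
      fix t :: real
      have "cmod (q t) \<le> cmod (g (\<i> * of_real t)) + \<delta>"
        using close[of t] norm_triangle_sub[of "q t" "g (\<i> * of_real t)"] by linarith
      then have "(cmod (q t))\<^sup>2 \<le> (cmod (g (\<i> * of_real t)) + \<delta>)\<^sup>2"
        by (intro power_mono) auto
      also have "\<dots> = (cmod (g (\<i> * of_real t)))\<^sup>2 + \<delta> * (2 * cmod (g (\<i> * of_real t)) + \<delta>)"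
        by (simp add: power2_eq_square algebra_simps)
      also have "\<delta> * (2 * cmod (g (\<i> * of_real t)) + \<delta>) \<le> \<epsilon>"
        using gM[of t] \<delta> by (meson add_mono mult_left_mono order_trans less_imp_le order_refl zero_le_numeral)
      finally show "(cmod (q t))\<^sup>2 \<le> (cmod (g (\<i> * of_real t)))\<^sup>2 + \<epsilon>" by simp
    qed
    also have "\<dots> = integral {-T..T} (\<lambda>t. (cmod (g (\<i> * of_real t)))\<^sup>2) + 2 * T * \<epsilon>"
      using T by (subst integral_add) (auto intro!: integrable_continuous_real continuous_intros cg)
    also have "\<dots> \<le> 2 * T * B + E + 2 * T * \<epsilon>" using bound[OF T] by simp
    finally show ?thesis using T by (simp add: field_simps)
  qed
  have "((\<lambda>T. B + \<epsilon> + (E + E') / (2 * T)) \<longlongrightarrow> B + \<epsilon> + 0) at_top"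
    by (intro tendsto_intros real_tendsto_divide_at_top[OF tendsto_const]
        filterlim_tendsto_pos_mult_at_top[OF tendsto_const] filterlim_ident) auto
  then have "(\<Sum>n\<in>F'. (cmod (b n))\<^sup>2) \<le> B + \<epsilon> + 0"
    by (rule tendsto_lowerbound) (auto intro: eventually_mono[OF eventually_gt_at_top[of 0]] main)
  moreover have "(\<Sum>n\<in>F. (cmod (b n))\<^sup>2) \<le> (\<Sum>n\<in>F'. (cmod (b n))\<^sup>2)"
  proof -
    have "(\<Sum>n\<in>F. (cmod (b n))\<^sup>2) \<le> (\<Sum>n\<in>F \<union> F1. (cmod (b n))\<^sup>2)"
      using F F1 by (intro sum_mono2) auto
    also have "\<dots> = (\<Sum>n\<in>F'. (cmod (b n))\<^sup>2)"
      unfolding F'_def using F F1 b0 by (intro sum.mono_neutral_right) auto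
    finally show ?thesis .
  qed
  ultimately show "(\<Sum>n\<in>F. (cmod (b n))\<^sup>2) \<le> B + \<epsilon>" by simp
qed

lemma mean_square_dpoly_le:
  fixes a :: "nat \<Rightarrow> complex"
  assumes "finite F" "0 \<notin> F" "K \<ge> 0"
  shows "\<exists>E. \<forall>p y T. decaying_exponent K p \<longrightarrow> (\<forall>n\<in>F. y \<le> ln (real n)) \<longrightarrow> T \<ge> 0 \<longrightarrow>
    integral {-T..T} (\<lambda>t. (cmod (\<Sum>n\<in>F. a n * exp (- (of_real (ln (real n) - y) * p t))))\<^sup>2)
      \<le> 2 * T * (\<Sum>n\<in>F. (cmod (a n))\<^sup>2) + E"
  using mean_square_dpoly[OF assms] by meson

section \<open>Functionals on the Hilbert space\<close>

text \<open>Bilinear and complex-valued, because the inner product on \<open>dirichlet_H\<close>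
  keeps only the real part of the hermitian one.\<close>

definition pair_H :: "dirichlet_H \<Rightarrow> (nat \<Rightarrow> complex) \<Rightarrow> complex" where
  "pair_H f w = (\<Sum>n. coeff_H f n * w n)"

definition l2norm :: "(nat \<Rightarrow> complex) \<Rightarrow> real" where
  "l2norm w = sqrt (\<Sum>n. (cmod (w n))\<^sup>2)"

lemma norm_H_eq_l2norm: "norm f = l2norm (coeff_H f)"
  by (simp add: norm_dirichlet_H l2norm_def)

lemma coeff_H_0 [simp]: "coeff_H f 0 = 0"
  using coeff_H[of f] by simp

lemma sum_norm_pair_le:
  assumes "summable (\<lambda>n. (cmod (w n))\<^sup>2)"
  shows "(\<Sum>n<N. norm (coeff_H f n * w n)) \<le> norm f * l2norm w"
proof -
  have "(\<Sum>n<N. norm (coeff_H f n * w n)) \<le>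
      L2_set (\<lambda>n. cmod (coeff_H f n)) {..<N} * L2_set (\<lambda>n. cmod (w n)) {..<N}"
    using L2_set_mult_ineq[of "\<lambda>n. cmod (coeff_H f n)" "\<lambda>n. cmod (w n)" "{..<N}"] by (simp add: norm_mult)
  also have "\<dots> \<le> norm f * l2norm w"
    unfolding L2_set_def norm_H_eq_l2norm l2norm_def
    by (intro mult_mono real_sqrt_le_mono sum_le_suminf summable_coeff_H assms) (auto intro: sum_nonneg suminf_nonneg assms summable_coeff_H)
  finally show ?thesis .
qed

lemma
  assumes "summable (\<lambda>n. (cmod (w n))\<^sup>2)"
  shows summable_pair_H: "summable (\<lambda>n. norm (coeff_H f n * w n))"
    and norm_pair_H_le: "norm (pair_H f w) \<le> norm f * l2norm w"
proof -
  show s: "summable (\<lambda>n. norm (coeff_H f n * w n))"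
    by (rule summableI_nonneg_bounded[OF _ sum_norm_pair_le[OF assms]]) auto
  have "norm (pair_H f w) \<le> (\<Sum>n. norm (coeff_H f n * w n))"
    unfolding pair_H_def by (rule summable_norm[OF s])
  also have "\<dots> \<le> norm f * l2norm w"
    by (rule suminf_le_const[OF s sum_norm_pair_le[OF assms]])
  finally show "norm (pair_H f w) \<le> norm f * l2norm w" .
qed

lemma pair_H_diff:
  assumes "summable (\<lambda>n. (cmod (w n))\<^sup>2)"
  shows "pair_H (f - g) w = pair_H f w - pair_H g w"
  unfolding pair_H_def minus_dirichlet_H.rep_eq
  using summable_norm_cancel[OF summable_pair_H[OF assms]] by (simp add: left_diff_distrib suminf_diff)

lemma pair_H_add:
  assumes "summable (\<lambda>n. (cmod (w n))\<^sup>2)"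
  shows "pair_H (f + g) w = pair_H f w + pair_H g w"
  unfolding pair_H_def plus_dirichlet_H.rep_eq
  using summable_norm_cancel[OF summable_pair_H[OF assms]] by (simp add: distrib_right suminf_add)

lemma pair_H_scaleR:
  assumes "summable (\<lambda>n. (cmod (w n))\<^sup>2)"
  shows "pair_H (r *\<^sub>R f) w = r *\<^sub>R pair_H f w"
  unfolding pair_H_def scaleR_dirichlet_H.rep_eq
  using summable_norm_cancel[OF summable_pair_H[OF assms]] by (simp add: suminf_scaleR_right)

lemma bounded_linear_pair_H:
  assumes "summable (\<lambda>n. (cmod (w n))\<^sup>2)"
  shows "bounded_linear (\<lambda>f. pair_H f w)"
  by (rule bounded_linear_intro[where K = "l2norm w"])
    (auto simp: pair_H_add pair_H_scaleR assms norm_pair_H_le)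

text \<open>The functional taking \<open>f\<close> to the value at \<open>s\<close> of its part
  supported on \<open>S\<close>. Over all positive integers it is bounded when
  \<open>Re s > 1/2\<close>, over finitely many primes already when \<open>Re s > 0\<close>.\<close>

definition point_eval :: "nat set \<Rightarrow> complex \<Rightarrow> nat \<Rightarrow> complex" where
  "point_eval S s n = (if n \<in> S then dterm n s else 0)"

lemma summable_point_eval_half:
  assumes "Re s > 1/2" "0 \<notin> S"
  shows "summable (\<lambda>n. (cmod (point_eval S s n))\<^sup>2)"
proof (rule summable_comparison_test')
  show "summable (\<lambda>n. real n powr (- 2 * Re s))"
    using assms by (simp add: summable_real_powr_iff)
  show "norm ((cmod (point_eval S s n))\<^sup>2) \<le> real n powr (- 2 * Re s)" for n
    using assms by (auto simp: point_eval_def norm_dterm powr_def algebra_simps simp flip: exp_of_nat_mult)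
qed

lemma eval_H_eq_pair: "eval_H f s = pair_H f (point_eval {0<..} s)"
  unfolding eval_H_def dirichlet_series_def pair_H_def
proof (rule suminf_cong)
  show "coeff_H f n * of_nat n powr - s = coeff_H f n * point_eval {0<..} s n" for n
    by (cases "n = 0") (auto simp: point_eval_def powr_eq_dterm)
qed

text \<open>Dominance of the first nonzero coefficient, at index \<open>m\<close>: after
  multiplication by \<open>m powr \<sigma>\<close> the later terms are of size
  \<open>(m / (m + 1)) powr \<sigma>\<close> and vanish as \<open>\<sigma>\<close> grows.\<close>

lemma eval_H_eq_0_imp:
  assumes "\<And>s. s \<in> halfplane (1/2) \<Longrightarrow> eval_H g s = 0"
  shows "g = 0"
proof (rule ccontr)
  assume "g \<noteq> 0"
  then have "\<exists>n. coeff_H g n \<noteq> 0"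
    by (auto simp: zero_dirichlet_H.rep_eq fun_eq_iff simp flip: coeff_H_inject)
  define m where "m = (LEAST n. coeff_H g n \<noteq> 0)"
  have m: "coeff_H g m \<noteq> 0" unfolding m_def by (rule LeastI_ex) fact
  have below: "coeff_H g n = 0" if "n < m" for n using not_less_Least that unfolding m_def by blast
  have m0: "m > 0" using m by (cases "m = 0") auto
  define u where "u = (\<lambda>\<sigma> n. coeff_H g n * point_eval {0<..} (of_real \<sigma>) n)"
  have us: "summable (\<lambda>n. norm (u \<sigma> n))" if "\<sigma> > 1/2" for \<sigma>
    unfolding u_def by (intro summable_pair_H summable_point_eval_half) (use that in auto)
  define C where "C = (\<Sum>n. norm (u 1 n))"
  have dt: "dterm n (of_real \<sigma>) = of_real (exp (- ln (real n) * \<sigma>))" for n \<sigma>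
    by (simp add: dterm_def flip: exp_of_real)
  have main: "norm (coeff_H g m) \<le> C * real m * (real m / real (Suc m)) powr \<sigma>" if \<sigma>: "\<sigma> > 0" for \<sigma>
  proof -
    \<comment> \<open>The shift by 1 leaves the terms at abscissa 1 as a summable majorant, since 1
      exceeds 1/2.\<close>
    have *: "u (\<sigma> + 1) sums 0"
      using assms[of "of_real (\<sigma> + 1)"] \<sigma> summable_sums[OF summable_norm_cancel[OF us[of "\<sigma> + 1"]]]
      by (simp add: eval_H_eq_pair pair_H_def u_def halfplane_def)
    have "(\<lambda>n. if n = m then u (\<sigma> + 1) m else 0) sums u (\<sigma> + 1) m" using sums_single[of m "\<lambda>_. u (\<sigma> + 1) m"] by simp
    from sums_diff[OF * this] have
      "(\<lambda>n. u (\<sigma> + 1) n - (if n = m then u (\<sigma> + 1) m else 0)) sums - u (\<sigma> + 1) m" by simp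
    moreover have "norm (u (\<sigma> + 1) n - (if n = m then u (\<sigma> + 1) m else 0)) \<le> norm (u 1 n) * real (Suc m) powr - \<sigma>" for n
    proof (cases "n \<le> m")
      case True
      then show ?thesis using below[of n] by (cases "n = m") (auto simp: u_def)
    next
      case False
      then have "ln (real n) \<ge> ln (real (Suc m))" by simp
      then have "exp (- ln (real n) * \<sigma>) \<le> real (Suc m) powr - \<sigma>"
        using \<sigma> by (simp add: powr_def)
      moreover have "norm (u (\<sigma> + 1) n) = norm (u 1 n) * exp (- ln (real n) * \<sigma>)"
        using False by (simp add: u_def point_eval_def norm_mult norm_dterm ring_distribs flip: exp_add)
      ultimately show ?thesis using False by (simp add: mult_left_mono)
    qed
    ultimately have "norm (- u (\<sigma> + 1) m) \<le> (\<Sum>n. norm (u 1 n) * real (Suc m) powr - \<sigma>)"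
      by (intro norm_sums_le[OF _ summable_sums]) (auto intro!: summable_mult2 us)
    also have "\<dots> = C * real (Suc m) powr - \<sigma>"
      unfolding C_def by (rule suminf_mult2[symmetric]) (auto intro: us)
    finally have le: "norm (u (\<sigma> + 1) m) \<le> C * real (Suc m) powr - \<sigma>" by simp
    have "norm (u (\<sigma> + 1) m) = norm (coeff_H g m) * real m powr - (\<sigma> + 1)"
      using m0 by (simp add: u_def point_eval_def norm_mult norm_dterm powr_def algebra_simps)
    with le have "norm (coeff_H g m) * real m powr - (\<sigma> + 1) * real m powr (\<sigma> + 1) \<le>
        C * real (Suc m) powr - \<sigma> * real m powr (\<sigma> + 1)"
      by (intro mult_right_mono) auto
    also have "\<dots> = C * real m * (real m / real (Suc m)) powr \<sigma>"
      using m0 by (simp add: powr_minus powr_add powr_divide field_simps)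
    finally show ?thesis using m0 by (simp add: mult.assoc powr_add[symmetric])
  qed
  have "((\<lambda>\<sigma>. C * real m * (real m / real (Suc m)) powr \<sigma>) \<longlongrightarrow> C * real m * 0) at_top"
  proof (intro tendsto_intros)
    have "ln (real m / real (Suc m)) < 0" using m0 by (intro ln_less_zero) auto
    then have "((\<lambda>\<sigma>. exp (ln (real m / real (Suc m)) * \<sigma>)) \<longlongrightarrow> 0) at_top"
      by (intro filterlim_compose[OF exp_at_bot filterlim_tendsto_neg_mult_at_bot[OF tendsto_const]] filterlim_ident)
    then show "((\<lambda>\<sigma>. (real m / real (Suc m)) powr \<sigma>) \<longlongrightarrow> 0) at_top"
      using m0 by (simp add: powr_def mult.commute)
  qed
  then have "norm (coeff_H g m) \<le> C * real m * 0"
    by (rule tendsto_lowerbound[OF _ eventually_mono[OF eventually_gt_at_top[of 0] main]]) auto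
  then show False using m by simp
qed

lemma eval_H_diff: "s \<in> halfplane (1/2) \<Longrightarrow> eval_H (f - g) s = eval_H f s - eval_H g s"
  by (simp add: eval_H_eq_pair pair_H_diff summable_point_eval_half halfplane_def)

lemma eval_H_add: "s \<in> halfplane (1/2) \<Longrightarrow> eval_H (f + g) s = eval_H f s + eval_H g s"
  by (simp add: eval_H_eq_pair pair_H_add summable_point_eval_half halfplane_def)

lemma eval_H_scaleR: "s \<in> halfplane (1/2) \<Longrightarrow> eval_H (r *\<^sub>R f) s = r *\<^sub>R eval_H f s"
  by (simp add: eval_H_eq_pair pair_H_scaleR summable_point_eval_half halfplane_def)

lemma eval_H_eqD:
  assumes "\<And>s. s \<in> halfplane (1/2) \<Longrightarrow> eval_H g s = eval_H h s"
  shows "g = h"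
  using eval_H_eq_0_imp[of "g - h"] assms by (simp add: eval_H_diff)

lemma tendsto_eval_H:
  assumes "s \<in> halfplane (1/2)" "X \<longlonglongrightarrow> f"
  shows "(\<lambda>k. eval_H (X k) s) \<longlonglongrightarrow> eval_H f s"
  unfolding eval_H_eq_pair
  by (rule bounded_linear.tendsto[OF bounded_linear_pair_H assms(2)])
    (use assms(1) in \<open>auto simp: halfplane_def intro: summable_point_eval_half\<close>)

lemma composition_op_eqI:
  assumes "\<And>s. s \<in> halfplane (1/2) \<Longrightarrow> eval_H g s = eval_H f (\<phi> s)"
  shows "composition_op \<phi> f = g"
  unfolding composition_op_def by (rule the_equality) (use assms eval_H_eqD in auto)

section \<open>Dirichlet polynomials\<close>

definition support_H :: "dirichlet_H \<Rightarrow> nat set" where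
  "support_H f = {n. coeff_H f n \<noteq> 0}"

lemma zero_notin_support_H: "0 \<notin> support_H f"
  by (simp add: support_H_def)

lemma mult_monoid_positive: "mult_monoid {0<..}"
  by (auto simp: mult_monoid_def)

lemma support_positive: "support_H f \<subseteq> {0<..}"
  using zero_notin_support_H[of f] by (auto intro!: gr0I)

definition poly_H :: "nat set \<Rightarrow> (nat \<Rightarrow> complex) \<Rightarrow> dirichlet_H" where
  "poly_H F a = Abs_dirichlet_H (\<lambda>n. if n \<in> F \<and> n \<noteq> 0 then a n else 0)"

lemma coeff_poly_H:
  assumes "finite F"
  shows "coeff_H (poly_H F a) n = (if n \<in> F \<and> n \<noteq> 0 then a n else 0)"
proof -
  have "summable (\<lambda>n. (cmod (if n \<in> F \<and> n \<noteq> 0 then a n else 0))\<^sup>2)"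
    by (rule summable_finite[OF assms]) auto
  then show ?thesis by (simp add: poly_H_def Abs_dirichlet_H_inverse)
qed

definition trunc_H :: "nat \<Rightarrow> dirichlet_H \<Rightarrow> dirichlet_H" where
  "trunc_H N f = poly_H {..<N} (coeff_H f)"

lemma coeff_trunc_H: "coeff_H (trunc_H N f) n = (if n < N then coeff_H f n else 0)"
  by (simp add: trunc_H_def coeff_poly_H)

lemma finite_support_trunc_H: "finite (support_H (trunc_H N f))"
  by (rule finite_subset[of _ "{..<N}"]) (auto simp: support_H_def coeff_trunc_H split: if_splits)

lemma trunc_H_tendsto: "(\<lambda>N. trunc_H N f) \<longlonglongrightarrow> f"
proof -
  have "(\<lambda>N. (\<Sum>n. (cmod (coeff_H f n))\<^sup>2) - (\<Sum>n<N. (cmod (coeff_H f n))\<^sup>2)) \<longlonglongrightarrow>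
     (\<Sum>n. (cmod (coeff_H f n))\<^sup>2) - (\<Sum>n. (cmod (coeff_H f n))\<^sup>2)"
    by (intro tendsto_intros summable_LIMSEQ summable_coeff_H)
  moreover have "(\<Sum>n. (cmod (coeff_H f n))\<^sup>2) - (\<Sum>n<N. (cmod (coeff_H f n))\<^sup>2) = (norm (trunc_H N f - f))\<^sup>2" for N
  proof -
    have "(norm (trunc_H N f - f))\<^sup>2 = (\<Sum>n. (cmod (coeff_H (trunc_H N f - f) n))\<^sup>2)"
      by (simp add: norm_dirichlet_H suminf_nonneg summable_coeff_H)
    also have "\<dots> = (\<Sum>n. (cmod (coeff_H f n))\<^sup>2 - (if n \<in> {..<N} then (cmod (coeff_H f n))\<^sup>2 else 0))"
      by (rule suminf_cong) (auto simp: minus_dirichlet_H.rep_eq coeff_trunc_H)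
    also have "\<dots> = (\<Sum>n. (cmod (coeff_H f n))\<^sup>2) - (\<Sum>n. if n \<in> {..<N} then (cmod (coeff_H f n))\<^sup>2 else 0)"
      by (intro suminf_diff[symmetric] summable_coeff_H summable_If_finite_set) auto
    also have "(\<Sum>n. if n \<in> {..<N} then (cmod (coeff_H f n))\<^sup>2 else 0) = (\<Sum>n<N. (cmod (coeff_H f n))\<^sup>2)"
      using sums_unique[OF sums_If_finite_set[of "{..<N}" "\<lambda>n. (cmod (coeff_H f n))\<^sup>2"]] by simp
    finally show ?thesis by simp
  qed
  ultimately have "(\<lambda>N. (norm (trunc_H N f - f))\<^sup>2) \<longlonglongrightarrow> 0" by simp
  then have "(\<lambda>N. norm (trunc_H N f - f)) \<longlonglongrightarrow> 0"
    using tendsto_real_sqrt[of "\<lambda>N. (norm (trunc_H N f - f))\<^sup>2" 0] by simp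
  then show ?thesis by (rule LIM_zero_cancel[OF tendsto_norm_zero_cancel])
qed

lemma norm_H_sq_finite_support:
  assumes "finite F" "support_H f \<subseteq> F"
  shows "(norm f)\<^sup>2 = (\<Sum>n\<in>F. (cmod (coeff_H f n))\<^sup>2)"
proof -
  have "(norm f)\<^sup>2 = (\<Sum>n. (cmod (coeff_H f n))\<^sup>2)"
    by (simp add: norm_dirichlet_H suminf_nonneg summable_coeff_H)
  also have "\<dots> = (\<Sum>n\<in>F. (cmod (coeff_H f n))\<^sup>2)"
    by (rule suminf_finite) (use assms in \<open>auto simp: support_H_def\<close>)
  finally show ?thesis .
qed

lemma eval_H_finite_support:
  assumes "finite F" "support_H f \<subseteq> F" "0 \<notin> F"
  shows "eval_H f s = dpoly F (coeff_H f) s"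
proof -
  have "eval_H f s = (\<Sum>n\<in>F. coeff_H f n * point_eval {0<..} s n)"
    unfolding eval_H_eq_pair pair_H_def by (rule suminf_finite) (use assms in \<open>auto simp: support_H_def\<close>)
  also have "\<dots> = dpoly F (coeff_H f) s"
    unfolding dpoly_def by (intro sum.cong refl) (use assms(3) in \<open>auto simp: point_eval_def intro!: gr0I\<close>)
  finally show ?thesis .
qed

text \<open>Eventually \<open>cmod (b n) < 1\<close>, so the squares are dominated by the absolutely
  summable sequence itself.\<close>

lemma abs_dirichlet_in_H:
  assumes "abs_dirichlet S b g" "0 \<notin> S"
  shows "\<exists>h. coeff_H h = b"
proof -
  have b: "summable (\<lambda>n. norm (b n))"
    using assms summable_on_UNIV_nonneg_real_iff[of "\<lambda>n. norm (b n)"] by (auto simp: abs_dirichlet_def)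
  then have "(\<lambda>n. norm (b n)) \<longlonglongrightarrow> 0" by (rule summable_LIMSEQ_zero)
  then have "\<forall>\<^sub>F n in sequentially. norm (b n) < 1" by (rule order_tendstoD) simp
  then have "\<forall>\<^sub>F n in sequentially. norm ((cmod (b n))\<^sup>2) \<le> norm (b n)"
    by eventually_elim (simp add: power2_eq_square mult_left_le_one_le less_imp_le)
  then have "summable (\<lambda>n. (cmod (b n))\<^sup>2)"
    by (rule summable_comparison_test_ev) (use b in simp)
  moreover have "b 0 = 0" using assms by (auto simp: abs_dirichlet_def)
  ultimately show ?thesis by (intro exI[of _ "Abs_dirichlet_H b"]) (simp add: Abs_dirichlet_H_inverse)
qed

lemma pair_H_abs_dirichlet:
  assumes "abs_dirichlet S (coeff_H h) g" "Re s \<ge> 0" "S \<subseteq> S'"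
  shows "pair_H h (point_eval S' s) = g s"
proof -
  have "(\<lambda>n. coeff_H h n * dterm n s) sums g s"
    using assms by (auto simp: abs_dirichlet_def intro: has_sum_imp_sums)
  moreover have "coeff_H h n * dterm n s = coeff_H h n * point_eval S' s n" for n
    using assms by (auto simp: abs_dirichlet_def point_eval_def)
  ultimately show ?thesis by (simp add: pair_H_def sums_iff)
qed

lemma norm_H_le_mean:
  assumes "abs_dirichlet S (coeff_H h) g" "0 \<notin> S"
    and "\<And>T. T > 0 \<Longrightarrow> integral {-T..T} (\<lambda>t. (cmod (g (\<i> * of_real t)))\<^sup>2) \<le> 2 * T * B + E"
    and "continuous_on UNIV g"
  shows "(norm h)\<^sup>2 \<le> B"
proof -
  have "(norm h)\<^sup>2 = (\<Sum>n. (cmod (coeff_H h n))\<^sup>2)"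
    by (simp add: norm_dirichlet_H suminf_nonneg summable_coeff_H)
  also have "\<dots> \<le> B"
    by (rule suminf_le_const[OF summable_coeff_H]) (rule coeff_square_sum_le_mean[OF assms], auto)
  finally show ?thesis .
qed

section \<open>Composition operators with polynomial symbols\<close>

text \<open>The entire function that agrees with the symbol on \<open>Re s > 1/2\<close> and gives
  it a meaning on the imaginary axis.\<close>

definition dsym :: "nat \<Rightarrow> nat set \<Rightarrow> (nat \<Rightarrow> complex) \<Rightarrow> complex \<Rightarrow> complex" where
  "dsym c0 A c s = of_nat c0 * s + dpoly A c s"

lemma holomorphic_dpoly [holomorphic_intros]: "dpoly A c holomorphic_on X"
  unfolding dpoly_def dterm_def by (intro holomorphic_intros)

lemma continuous_dpoly: "continuous_on X (dpoly A c)"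
  by (rule holomorphic_on_imp_continuous_on[OF holomorphic_dpoly])

lemma continuous_dsym: "continuous_on X (dsym c0 A c)"
  unfolding dsym_def by (intro continuous_intros continuous_dpoly)

locale polynomial_symbol =
  fixes \<phi> :: "complex \<Rightarrow> complex" and c0 :: nat and A :: "nat set" and c :: "nat \<Rightarrow> complex"
  assumes fin: "finite A" and zero_notin: "0 \<notin> A" and c0_pos: "c0 > 0"
    and symbol_eq: "s \<in> halfplane (1/2) \<Longrightarrow> \<phi> s = dsym c0 A c s"
    and pos: "Re s \<ge> 0 \<Longrightarrow> Re (dpoly A c s) \<ge> 0"
begin

lemma Re_dsym_ge: "Re s \<ge> 0 \<Longrightarrow> Re (dsym c0 A c s) \<ge> real c0 * Re s"
  using pos[of s] by (simp add: dsym_def)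

lemma Re_dsym_pos: "Re s > 0 \<Longrightarrow> Re (dsym c0 A c s) > 0"
  using Re_dsym_ge[of s] c0_pos mult_pos_pos[of "real c0" "Re s"] by linarith

lemma symbol_halfplane: "s \<in> halfplane (1/2) \<Longrightarrow> \<phi> s \<in> halfplane (1/2)"
proof -
  assume s: "s \<in> halfplane (1/2)"
  then have "1 * Re s \<le> real c0 * Re s" using c0_pos by (intro mult_right_mono) (auto simp: halfplane_def)
  then show ?thesis using s Re_dsym_ge[of s] by (simp only: symbol_eq halfplane_def mem_Collect_eq) linarith
qed

lemma decaying: "decaying_exponent (2 / real c0) (\<lambda>t. dsym c0 A c (\<i> * of_real t))"
  unfolding dsym_def by (rule decaying_exponent_symbol) (use pos c0_pos in \<open>auto intro: holomorphic_intros\<close>)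

lemma composition_op_poly:
  assumes "mult_monoid S" "A \<subseteq> S" "support_H f \<subseteq> S" "finite F" "support_H f \<subseteq> F" "F \<subseteq> S"
  shows "abs_dirichlet S (coeff_H (composition_op \<phi> f)) (\<lambda>s. dpoly F (coeff_H f) (dsym c0 A c s))"
    and "s \<in> halfplane (1/2) \<Longrightarrow> eval_H (composition_op \<phi> f) s = eval_H f (\<phi> s)"
proof -
  have S0: "0 \<notin> S" using assms by (simp add: mult_monoid_def)
  obtain b where b: "abs_dirichlet S b (\<lambda>s. dpoly F (coeff_H f) (dsym c0 A c s))"
    using abs_dirichlet_compose[OF assms(1) fin assms(2,4,6), of "coeff_H f" c0 c] by (auto simp: dsym_def)
  obtain g where g: "coeff_H g = b"
    using abs_dirichlet_in_H[OF b S0] by blast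
  have ev: "eval_H g s = eval_H f (\<phi> s)" if s: "s \<in> halfplane (1/2)" for s
  proof -
    have "S \<subseteq> {0<..}" "0 \<notin> F" using S0 assms(6) by (auto intro: gr0I)
    then show ?thesis
      using pair_H_abs_dirichlet[OF b[folded g], of s "{0<..}"] s assms(4,5)
      by (simp add: halfplane_def symbol_eq eval_H_finite_support[of F f] eval_H_eq_pair[of g])
  qed
  then have "composition_op \<phi> f = g" by (rule composition_op_eqI)
  then show "abs_dirichlet S (coeff_H (composition_op \<phi> f)) (\<lambda>s. dpoly F (coeff_H f) (dsym c0 A c s))"
    and "s \<in> halfplane (1/2) \<Longrightarrow> eval_H (composition_op \<phi> f) s = eval_H f (\<phi> s)"
    using b g ev by auto
qed

lemma A_positive: "A \<subseteq> {0<..}"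
  using zero_notin by (auto intro!: gr0I)

text \<open>The mean square along the imaginary axis is used twice: the coefficients of
  \<open>f\<close> bound it from above, through the symbol, and it bounds the coefficients of the
  image.\<close>

lemma norm_composition_op_poly:
  assumes "finite (support_H f)"
  shows "norm (composition_op \<phi> f) \<le> norm f"
proof -
  have K: "2 / real c0 \<ge> 0" by simp
  from mean_square_dpoly_le[OF assms zero_notin_support_H K, of "coeff_H f"]
  obtain E where E: "\<forall>p y T. decaying_exponent (2 / real c0) p \<longrightarrow> (\<forall>n\<in>support_H f. y \<le> ln (real n)) \<longrightarrow> T \<ge> 0 \<longrightarrow>
    integral {-T..T} (\<lambda>t. (cmod (\<Sum>n\<in>support_H f. coeff_H f n * exp (- (of_real (ln (real n) - y) * p t))))\<^sup>2)
      \<le> 2 * T * (\<Sum>n\<in>support_H f. (cmod (coeff_H f n))\<^sup>2) + E" ..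
  have ln: "\<forall>n\<in>support_H f. 0 \<le> ln (real n)"
    using support_positive[of f] by auto
  have "(norm (composition_op \<phi> f))\<^sup>2 \<le> (norm f)\<^sup>2"
  proof (rule norm_H_le_mean)
    show "abs_dirichlet {0<..} (coeff_H (composition_op \<phi> f)) (\<lambda>s. dpoly (support_H f) (coeff_H f) (dsym c0 A c s))"
      by (rule composition_op_poly(1)[OF mult_monoid_positive A_positive support_positive assms order_refl support_positive])
    show "continuous_on UNIV (\<lambda>s. dpoly (support_H f) (coeff_H f) (dsym c0 A c s))"
      by (rule continuous_on_compose2[OF continuous_dpoly[of UNIV] continuous_dsym]) auto
    show "integral {-T..T} (\<lambda>t. (cmod (dpoly (support_H f) (coeff_H f) (dsym c0 A c (\<i> * of_real t))))\<^sup>2)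
        \<le> 2 * T * (norm f)\<^sup>2 + E" if "T > 0" for T
      using E[rule_format, OF decaying, of 0 T] ln that
      by (simp add: norm_H_sq_finite_support[OF assms order_refl] dpoly_def dterm_def)
  qed auto
  then show ?thesis by (rule power2_le_imp_le) simp
qed

lemma support_H_diff: "support_H (f - g) \<subseteq> support_H f \<union> support_H g"
  by (auto simp: support_H_def minus_dirichlet_H.rep_eq)

text \<open>Contraction on polynomials makes the images of the truncations a Cauchy sequence;
  evaluations are continuous, so the limit represents \<open>f \<circ> \<phi>\<close>. Hence the
  definite description in \<open>composition_op\<close> denotes for every \<open>f\<close>.\<close>

lemma eval_composition_op: "s \<in> halfplane (1/2) \<Longrightarrow> eval_H (composition_op \<phi> f) s = eval_H f (\<phi> s)"
  and composition_op_trunc_tendsto: "(\<lambda>N. composition_op \<phi> (trunc_H N f)) \<longlonglongrightarrow> composition_op \<phi> f"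
proof -
  define X where "X = (\<lambda>N. composition_op \<phi> (trunc_H N f))"
  have evX: "eval_H (composition_op \<phi> h) s = eval_H h (\<phi> s)" if "finite (support_H h)" "s \<in> halfplane (1/2)" for h s
    by (rule composition_op_poly(2)[OF mult_monoid_positive A_positive support_positive that(1) order_refl support_positive that(2)])
  have XX: "X N - X M = composition_op \<phi> (trunc_H N f - trunc_H M f)" for N M
    by (rule composition_op_eqI[symmetric])
      (simp add: X_def eval_H_diff symbol_halfplane evX finite_support_trunc_H)
  have "Cauchy X"
  proof (rule metric_CauchyI)
    fix e :: real assume "e > 0"
    have "Cauchy (\<lambda>N. trunc_H N f)" using trunc_H_tendsto LIMSEQ_imp_Cauchy by blast
    then obtain M where M: "\<And>m n. m \<ge> M \<Longrightarrow> n \<ge> M \<Longrightarrow> dist (trunc_H m f) (trunc_H n f) < e"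
      using \<open>e > 0\<close> metric_CauchyD by blast
    have "dist (X m) (X n) \<le> dist (trunc_H m f) (trunc_H n f)" for m n
      unfolding dist_norm XX
      by (intro norm_composition_op_poly finite_subset[OF support_H_diff]) (auto simp: finite_support_trunc_H)
    then show "\<exists>M. \<forall>m\<ge>M. \<forall>n\<ge>M. dist (X m) (X n) < e" using M le_less_trans by blast
  qed
  then obtain g where g: "X \<longlonglongrightarrow> g" using Cauchy_convergent convergent_def by blast
  have ev: "eval_H g s = eval_H f (\<phi> s)" if s: "s \<in> halfplane (1/2)" for s
  proof (rule LIMSEQ_unique)
    show "(\<lambda>N. eval_H (X N) s) \<longlonglongrightarrow> eval_H g s" by (rule tendsto_eval_H[OF s g])
    show "(\<lambda>N. eval_H (X N) s) \<longlonglongrightarrow> eval_H f (\<phi> s)"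
      using tendsto_eval_H[OF symbol_halfplane[OF s] trunc_H_tendsto, of f]
      by (simp add: X_def evX s finite_support_trunc_H)
  qed
  then have "composition_op \<phi> f = g" by (rule composition_op_eqI)
  then show "s \<in> halfplane (1/2) \<Longrightarrow> eval_H (composition_op \<phi> f) s = eval_H f (\<phi> s)"
    and "(\<lambda>N. composition_op \<phi> (trunc_H N f)) \<longlonglongrightarrow> composition_op \<phi> f"
    using ev g by (auto simp: X_def)
qed

lemma bounded_linear_composition_op: "bounded_linear (composition_op \<phi>)"
proof (rule bounded_linear_intro[where K = 1])
  show "composition_op \<phi> (f + g) = composition_op \<phi> f + composition_op \<phi> g" for f g
    by (rule composition_op_eqI) (simp add: eval_H_add eval_composition_op symbol_halfplane)
  show "composition_op \<phi> (r *\<^sub>R f) = r *\<^sub>R composition_op \<phi> f" for r f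
    by (rule composition_op_eqI) (simp add: eval_H_scaleR eval_composition_op symbol_halfplane)
  show "norm (composition_op \<phi> f) \<le> norm f * 1" for f
    using tendsto_le[OF _ tendsto_norm[OF trunc_H_tendsto[of f]] tendsto_norm[OF composition_op_trunc_tendsto[of f]]]
    by (simp add: norm_composition_op_poly finite_support_trunc_H)
qed

end

lemma dirichlet_series_finite_support:
  assumes "finite (dirichlet_support c)"
  shows "dirichlet_series c s = dpoly (dirichlet_support c) c s"
proof -
  have "dirichlet_series c s = (\<Sum>n\<in>dirichlet_support c. c n * of_nat n powr (- s))"
    unfolding dirichlet_series_def
    by (rule suminf_finite) (use assms in \<open>auto simp: dirichlet_support_def intro!: gr0I\<close>)
  also have "\<dots> = dpoly (dirichlet_support c) c s"
    unfolding dpoly_def by (intro sum.cong refl) (auto simp: dirichlet_support_def powr_eq_dterm)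
  finally show ?thesis .
qed

lemma polynomial_symbol_of_dirichlet:
  assumes "dirichlet_polynomial_symbol \<phi> c0 c" "c0 \<ge> 1"
  shows "polynomial_symbol \<phi> c0 (dirichlet_support c) c"
proof
  have gh: "gordon_hedenmalm \<phi> c0 c" and fin: "finite (dirichlet_support c)"
    using assms by (auto simp: dirichlet_polynomial_symbol_def)
  show "finite (dirichlet_support c)" by fact
  show "0 \<notin> dirichlet_support c" by (simp add: dirichlet_support_def)
  show "0 < c0" using assms by simp
  show "\<phi> s = dsym c0 (dirichlet_support c) c s" if "s \<in> halfplane (1/2)" for s
    using gh that by (simp add: gordon_hedenmalm_def dsym_def dirichlet_series_finite_support[OF fin])
  let ?\<psi> = "dpoly (dirichlet_support c) c"
  \<comment> \<open>Both alternatives of the class, a constant with nonnegative real part or a map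
    into the open half-plane, give this on the open half-plane; continuity then reaches the
    boundary.\<close>
  have *: "Re (?\<psi> s) \<ge> 0" if "Re s > 0" for s
    using gh assms(2) that unfolding gordon_hedenmalm_def dirichlet_series_finite_support[OF fin]
    by (force simp: halfplane_def image_subset_iff)
  show "Re (?\<psi> s) \<ge> 0" if "Re s \<ge> 0" for s
  proof (rule tendsto_lowerbound)
    have "isCont (\<lambda>e. Re (?\<psi> (s + of_real e))) 0"
      unfolding dpoly_def dterm_def isCont_def by (intro tendsto_intros)
    then have "((\<lambda>e. Re (?\<psi> (s + of_real e))) \<longlongrightarrow> Re (?\<psi> (s + of_real 0))) (at_right 0)"
      unfolding isCont_def by (rule tendsto_mono[OF at_le, rotated]) auto
    then show "((\<lambda>e. Re (?\<psi> (s + of_real e))) \<longlongrightarrow> Re (?\<psi> s)) (at_right 0)" by simp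
    show "\<forall>\<^sub>F e in at_right 0. 0 \<le> Re (?\<psi> (s + of_real e))"
      using eventually_at_right_less[of "0::real"] by eventually_elim (rule *, use that in simp)
  qed auto
qed

section \<open>A criterion for compactness\<close>

text \<open>Tychonoff: a countable product of closed discs is compact and metrizable, hence
  sequentially compact.\<close>

lemma pointwise_convergent_subseq:
  fixes f :: "nat \<Rightarrow> nat \<Rightarrow> complex"
  assumes "\<And>k n. cmod (f k n) \<le> 1"
  obtains r l where "strict_mono (r :: nat \<Rightarrow> nat)" "\<And>n. (\<lambda>k. f (r k) n) \<longlonglongrightarrow> l n"
proof -
  have "compactin (product_topology (\<lambda>_::nat. euclidean) UNIV) (PiE UNIV (\<lambda>_. cball (0::complex) 1))"
    by (subst compactin_PiE) (auto simp: compactin_euclidean_iff)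
  then have "compact (PiE UNIV (\<lambda>_::nat. cball (0::complex) 1))"
    by (simp add: euclidean_product_topology compactin_euclidean_iff)
  moreover have "\<forall>k. f k \<in> PiE UNIV (\<lambda>_::nat. cball (0::complex) 1)"
    using assms by auto
  ultimately obtain l r where "strict_mono (r :: nat \<Rightarrow> nat)" and lim: "(f \<circ> r) \<longlonglongrightarrow> l"
    using compact_imp_seq_compact seq_compactE by metis
  moreover have "(\<lambda>k. f (r k) n) \<longlonglongrightarrow> l n" for n
    using continuous_on_tendsto_compose[OF continuous_on_product_coordinates[of n] lim] by simp
  ultimately show thesis using that by blast
qed

text \<open>A sequence in the unit ball has a subsequence converging coefficientwise to some
  \<open>h\<close> in the ball. Its low-frequency parts converge in norm and the tails are small
  after \<open>T\<close>, so the images converge to \<open>T h\<close>; the image of the ball is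
  itself compact.\<close>

lemma compact_operator_if_small_tails:
  fixes T :: "dirichlet_H \<Rightarrow> dirichlet_H"
  assumes T: "bounded_linear T"
    and tails: "\<And>\<epsilon>. \<epsilon> > 0 \<Longrightarrow> \<exists>N. \<forall>f. (\<forall>n<N. coeff_H f n = 0) \<longrightarrow> norm (T f) \<le> \<epsilon> * norm f"
  shows "compact_operator T"
proof -
  interpret T: bounded_linear T by fact
  have "seq_compact (T ` cball 0 1)"
  proof (rule seq_compactI)
    fix g :: "nat \<Rightarrow> dirichlet_H" assume "\<forall>k. g k \<in> T ` cball 0 1"
    then have "\<forall>k. \<exists>f. f \<in> cball 0 1 \<and> g k = T f" by blast
    then obtain f where "\<And>k. f k \<in> cball 0 1" and f2: "\<And>k. g k = T (f k)" by metis
    then have f: "norm (f k) \<le> 1" for k by simp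
    have "cmod (coeff_H (f k) n) \<le> 1" for k n
      using norm_coeff_H_le[of "f k" n] f[of k] by linarith
    then obtain r l where r: "strict_mono (r :: nat \<Rightarrow> nat)" and l: "\<And>n. (\<lambda>k. coeff_H (f (r k)) n) \<longlonglongrightarrow> l n"
      using pointwise_convergent_subseq[of "\<lambda>k. coeff_H (f k)"] by blast
    have partial: "(\<Sum>n<N. (cmod (l n))\<^sup>2) \<le> 1" for N
    proof (rule LIMSEQ_le_const2)
      show "(\<lambda>k. \<Sum>n<N. (cmod (coeff_H (f (r k)) n))\<^sup>2) \<longlonglongrightarrow> (\<Sum>n<N. (cmod (l n))\<^sup>2)"
        by (intro tendsto_intros l)
      have "(\<Sum>n<N. (cmod (coeff_H (f (r k)) n))\<^sup>2) \<le> 1" for k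
        using sum_coeff_H_le[of "f (r k)" N] f[of "r k"] by (smt (verit) norm_ge_zero power_le_one)
      then show "\<exists>M. \<forall>k\<ge>M. (\<Sum>n<N. (cmod (coeff_H (f (r k)) n))\<^sup>2) \<le> 1" by blast
    qed
    have sl: "summable (\<lambda>n. (cmod (l n))\<^sup>2)"
      by (rule summableI_nonneg_bounded[OF _ partial]) auto
    have "l 0 = 0" using LIMSEQ_unique[OF l[of 0]] by auto
    define h where "h = Abs_dirichlet_H l"
    have h: "coeff_H h = l" using sl \<open>l 0 = 0\<close> by (simp add: h_def Abs_dirichlet_H_inverse)
    have "(\<Sum>n. (cmod (l n))\<^sup>2) \<le> 1" by (rule suminf_le_const[OF sl partial])
    then have nh: "norm h \<le> 1" by (simp add: norm_dirichlet_H h)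
    have "(\<lambda>k. T (f (r k))) \<longlonglongrightarrow> T h"
    proof (rule metric_LIMSEQ_I)
      fix e :: real assume "e > 0"
      \<comment> \<open>The difference from \<open>h\<close> has norm at most 2, so the tail costs
        \<open>e / 4 * 2\<close> and leaves \<open>e / 2\<close> for the low frequencies.\<close>
      then obtain N where N: "\<And>f. (\<forall>n<N. coeff_H f n = 0) \<Longrightarrow> norm (T f) \<le> e / 4 * norm f"
        using tails[of "e / 4"] by auto
      obtain K where K: "K > 0" "\<And>f. norm (T f) \<le> norm f * K" using T.pos_bounded by blast
      have "(\<lambda>k. K * (\<Sum>n<N. cmod (coeff_H (f (r k)) n - l n))) \<longlonglongrightarrow> K * (\<Sum>n<N. cmod (l n - l n))"
        by (intro tendsto_intros l)
      then have "\<forall>\<^sub>F k in sequentially. K * (\<Sum>n<N. cmod (coeff_H (f (r k)) n - l n)) < e / 2"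
        by (rule order_tendstoD) (use \<open>e > 0\<close> in simp)
      then obtain M where M: "\<And>k. k \<ge> M \<Longrightarrow> K * (\<Sum>n<N. cmod (coeff_H (f (r k)) n - l n)) < e / 2"
        by (auto simp: eventually_sequentially)
      have "dist (T (f (r k))) (T h) < e" if "k \<ge> M" for k
      proof -
        define d where "d = f (r k) - h"
        have "norm d \<le> 2" unfolding d_def using norm_triangle_ineq4[of "f (r k)" h] f[of "r k"] nh by linarith
        have sup: "support_H (trunc_H N d) \<subseteq> {..<N}" by (auto simp: support_H_def coeff_trunc_H split: if_splits)
        have "(norm (trunc_H N d))\<^sup>2 = (\<Sum>n<N. (cmod (coeff_H d n))\<^sup>2)"
          by (simp add: norm_H_sq_finite_support[OF _ sup] coeff_trunc_H)
        also have "\<dots> = (L2_set (\<lambda>n. cmod (coeff_H d n)) {..<N})\<^sup>2"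
          by (simp add: L2_set_def sum_nonneg)
        finally have "norm (trunc_H N d) = L2_set (\<lambda>n. cmod (coeff_H d n)) {..<N}" by simp
        also have "\<dots> \<le> (\<Sum>n<N. cmod (coeff_H d n))" by (rule L2_set_le_sum) auto
        finally have 1: "norm (trunc_H N d) \<le> (\<Sum>n<N. cmod (coeff_H (f (r k)) n - l n))"
          by (simp add: d_def minus_dirichlet_H.rep_eq h)
        have "norm (d - trunc_H N d) \<le> norm d"
          unfolding norm_dirichlet_H
          by (intro real_sqrt_le_mono suminf_le summable_coeff_H) (auto simp: minus_dirichlet_H.rep_eq coeff_trunc_H)
        then have 2: "norm (T (d - trunc_H N d)) \<le> e / 4 * 2"
          using N[of "d - trunc_H N d"] \<open>norm d \<le> 2\<close> \<open>e > 0\<close>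
          by (intro order_trans[OF N mult_left_mono]) (auto simp: minus_dirichlet_H.rep_eq coeff_trunc_H)
        have "norm (T d) \<le> norm (T (trunc_H N d)) + norm (T (d - trunc_H N d))"
          using norm_triangle_ineq[of "T (trunc_H N d)" "T (d - trunc_H N d)"] by (simp add: T.diff)
        also have "\<dots> < e / 2 + e / 2"
        proof -
          have "norm (trunc_H N d) * K \<le> K * (\<Sum>n<N. cmod (coeff_H (f (r k)) n - l n))"
            using mult_left_mono[OF 1, of K] K(1) by (simp only: mult.commute[of _ K] less_imp_le)
          then show ?thesis using K(2)[of "trunc_H N d"] M[OF that] 2 by linarith
        qed
        finally show ?thesis by (simp add: dist_norm d_def T.diff)
      qed
      then show "\<exists>M. \<forall>k\<ge>M. dist (T (f (r k))) (T h) < e" by blast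
    qed
    moreover have "g \<circ> r = (\<lambda>k. T (f (r k)))" by (simp add: o_def f2)
    ultimately show "\<exists>l\<in>T ` cball 0 1. \<exists>r. strict_mono r \<and> (g \<circ> r) \<longlonglongrightarrow> l"
      using nh r by (intro bexI[of _ "T h"]) auto
  qed
  then have "compact (T ` cball 0 1)" by (simp add: compact_eq_seq_compact_metric)
  then show ?thesis using T by (simp add: compact_operator_def closure_closed compact_imp_closed)
qed

section \<open>Differences of composition operators on high frequencies\<close>

text \<open>Nonnegative variance: with \<open>I\<close> the mean of \<open>cmod G\<close>, expand
  the integral of \<open>(cmod G - I)\<^sup>2\<close>.\<close>

lemma square_integral_unit_le:
  fixes G :: "real \<Rightarrow> complex"
  assumes G: "continuous_on {0..1} G"
  shows "(cmod (integral {0..1} G))\<^sup>2 \<le> integral {0..1} (\<lambda>x. (cmod (G x))\<^sup>2)"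
proof -
  define I where "I = integral {0..1} (\<lambda>x. cmod (G x))"
  have int: "f integrable_on {0..1}" if "continuous_on {0..1} f" for f :: "real \<Rightarrow> real"
    using that by (rule integrable_continuous_real)
  have "cmod (integral {0..1} G) \<le> I"
    unfolding I_def by (intro integral_norm_bound_integral integrable_continuous_real continuous_intros G) auto
  then have "(cmod (integral {0..1} G))\<^sup>2 \<le> I\<^sup>2" by (intro power_mono) auto
  also have "0 \<le> integral {0..1} (\<lambda>x. (cmod (G x) - I)\<^sup>2)"
    by (intro integral_nonneg int continuous_intros G) auto
  then have "I\<^sup>2 \<le> integral {0..1} (\<lambda>x. (cmod (G x))\<^sup>2)"
  proof -
    have "integral {0..1} (\<lambda>x. (cmod (G x) - I)\<^sup>2) = integral {0..1} (\<lambda>x. ((cmod (G x))\<^sup>2 - 2 * I * cmod (G x)) + I\<^sup>2)"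
      by (simp add: power2_diff algebra_simps)
    also have "\<dots> = integral {0..1} (\<lambda>x. (cmod (G x))\<^sup>2 - 2 * I * cmod (G x)) + I\<^sup>2"
      by (subst integral_add) (auto intro!: int continuous_intros G)
    also have "integral {0..1} (\<lambda>x. (cmod (G x))\<^sup>2 - 2 * I * cmod (G x)) = integral {0..1} (\<lambda>x. (cmod (G x))\<^sup>2) - 2 * I * I"
      unfolding I_def by (subst integral_diff) (auto intro!: int continuous_intros G)
    finally show ?thesis using \<open>0 \<le> integral {0..1} (\<lambda>x. (cmod (G x) - I)\<^sup>2)\<close> by (simp add: power2_eq_square)
  qed
  finally show ?thesis .
qed

lemma cube_le_exp: "x \<ge> 0 \<Longrightarrow> x ^ 3 \<le> exp (2 * x :: real)"
proof -
  assume x: "x \<ge> 0"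
  have "(\<Sum>n<4. inverse (fact n) * (2 * x) ^ n) \<le> exp (2 * x)"
    unfolding exp_def using summable_exp[of "2 * x"] x
    by (simp only: scaleR_conv_of_real of_real_eq_id id_apply)
      (intro sum_le_suminf, auto simp: divide_inverse)
  moreover have "(\<Sum>n<4. inverse (fact n) * (2 * x) ^ n) = 1 + 2 * x + 2 * x ^ 2 + 4 / 3 * x ^ 3"
    by (simp add: eval_nat_numeral fact_numeral field_simps)
  moreover have "0 \<le> x ^ 2" "0 \<le> x ^ 3" using x by auto
  ultimately show ?thesis using x by linarith
qed

locale symbol_pair = p0: polynomial_symbol \<phi>0 c0 A a + p1: polynomial_symbol \<phi>1 c0 B b
  for \<phi>0 \<phi>1 c0 A a B b
begin

definition P0 :: "real \<Rightarrow> complex" where "P0 t = dsym c0 A a (\<i> * of_real t)"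
definition P1 :: "real \<Rightarrow> complex" where "P1 t = dsym c0 B b (\<i> * of_real t)"
definition Pmix :: "real \<Rightarrow> real \<Rightarrow> complex" where "Pmix \<tau> t = of_real (1 - \<tau>) * P0 t + of_real \<tau> * P1 t"

lemma continuous_P0 [continuous_intros]: "continuous_on X f \<Longrightarrow> continuous_on X (\<lambda>x. P0 (f x))"
  unfolding P0_def by (intro continuous_on_compose2[OF continuous_dsym[of UNIV]] continuous_intros) auto

lemma continuous_P1 [continuous_intros]: "continuous_on X f \<Longrightarrow> continuous_on X (\<lambda>x. P1 (f x))"
  unfolding P1_def by (intro continuous_on_compose2[OF continuous_dsym[of UNIV]] continuous_intros) auto

lemma Re_P0: "Re (P0 t) \<ge> 0" and Re_P1: "Re (P1 t) \<ge> 0"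
  using p0.Re_dsym_ge[of "\<i> * of_real t"] p1.Re_dsym_ge[of "\<i> * of_real t"] by (simp_all add: P0_def P1_def)

text \<open>Convexity: every point of the segment between the symbols is again \<open>c0 * s\<close>
  plus an entire function with nonnegative real part, so the constant is the same for all
  \<open>\<tau>\<close>.\<close>

lemma decaying_Pmix:
  assumes "0 \<le> \<tau>" "\<tau> \<le> 1"
  shows "decaying_exponent (2 / real c0) (Pmix \<tau>)"
proof -
  have "decaying_exponent (2 / real c0) (\<lambda>t. of_nat c0 * (\<i> * of_real t) +
      (\<lambda>s. of_real (1 - \<tau>) * dpoly A a s + of_real \<tau> * dpoly B b s) (\<i> * of_real t))"
    by (rule decaying_exponent_symbol)
      (use assms p0.pos p1.pos p0.c0_pos in \<open>auto intro!: holomorphic_intros add_nonneg_nonneg mult_nonneg_nonneg simp del: of_real_diff\<close>)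
  moreover have "of_nat c0 * (\<i> * of_real t) +
      (\<lambda>s. of_real (1 - \<tau>) * dpoly A a s + of_real \<tau> * dpoly B b s) (\<i> * of_real t) = Pmix \<tau> t" for t
    by (simp add: Pmix_def P0_def P1_def dsym_def algebra_simps)
  ultimately show ?thesis by simp
qed

lemma Re_Pmix_ge_min:
  assumes "0 \<le> \<tau>" "\<tau> \<le> 1"
  shows "min (Re (P0 t)) (Re (P1 t)) \<le> Re (Pmix \<tau> t)"
proof -
  let ?m = "min (Re (P0 t)) (Re (P1 t))"
  have "?m = (1 - \<tau>) * ?m + \<tau> * ?m" by (simp add: algebra_simps)
  also have "\<dots> \<le> (1 - \<tau>) * Re (P0 t) + \<tau> * Re (P1 t)"
    by (intro add_mono mult_left_mono) (use assms in auto)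
  finally show ?thesis by (simp add: Pmix_def)
qed

text \<open>The factor 16 is the square of the 4 in the top frequency \<open>4 * \<kappa>\<close>,
  which appears on differentiation. One \<open>E\<close> has to serve every \<open>\<tau>\<close>,
  which is why the mean-square estimate is uniform in the curve.\<close>

lemma block_difference_bound:
  assumes F: "finite F" "0 \<notin> F" and \<kappa>: "\<kappa> > 0"
    and freq: "\<And>n. n \<in> F \<Longrightarrow> \<kappa> \<le> ln (real n) \<and> ln (real n) \<le> 4 * \<kappa>"
    and C: "C \<ge> 0" and contact: "\<And>t. (cmod (P0 t - P1 t))\<^sup>2 \<le> C * (min (Re (P0 t)) (Re (P1 t))) ^ 3"
  shows "\<exists>E. \<forall>T\<ge>0. integral {-T..T} (\<lambda>t. (cmod (dpoly F f (P0 t) - dpoly F f (P1 t)))\<^sup>2)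
    \<le> 16 * C / \<kappa> * (2 * T * (\<Sum>n\<in>F. (cmod (f n))\<^sup>2)) + E"
proof -
  have K: "2 / real c0 \<ge> 0" by simp
  define f' where "f' = (\<lambda>n. of_real (ln (real n)) * f n)"
  obtain E where E: "\<forall>p y T. decaying_exponent (2 / real c0) p \<longrightarrow> (\<forall>n\<in>F. y \<le> ln (real n)) \<longrightarrow> T \<ge> 0 \<longrightarrow>
    integral {-T..T} (\<lambda>t. (cmod (\<Sum>n\<in>F. f' n * exp (- (of_real (ln (real n) - y) * p t))))\<^sup>2)
      \<le> 2 * T * (\<Sum>n\<in>F. (cmod (f' n))\<^sup>2) + E"
    using mean_square_dpoly_le[OF F K, of f'] ..
  define g where "g = (\<lambda>t \<tau>. (P0 t - P1 t) * (\<Sum>n\<in>F. f' n * exp (- (of_real (ln (real n)) * Pmix \<tau> t))))"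
  have cg: "continuous_on X (\<lambda>x. g (u x) (v x))" if "continuous_on X u" "continuous_on X v" for X :: "'z::topological_space set" and u v
    unfolding g_def Pmix_def by (intro continuous_intros that)
  have repr: "dpoly F f (P1 t) - dpoly F f (P0 t) = integral {0..1} (g t)" for t
  proof -
    have "((\<lambda>\<tau>. dpoly F f (Pmix \<tau> t)) has_vector_derivative g t \<tau>) (at \<tau> within {0..1})" for \<tau>
    proof -
      have Pd: "((\<lambda>\<tau>. Pmix \<tau> t) has_vector_derivative P1 t - P0 t) (at \<tau> within {0..1})"
        unfolding Pmix_def by (auto intro!: derivative_eq_intros simp: algebra_simps)
      have D: "(dpoly F f has_field_derivative (\<Sum>n\<in>F. f n * (- of_real (ln (real n)) * dterm n s))) (at s)" for s
        unfolding dpoly_def dterm_def by (auto intro!: derivative_eq_intros sum.cong)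
      have "((\<lambda>\<tau>. dpoly F f (Pmix \<tau> t)) has_vector_derivative
          (P1 t - P0 t) * (\<Sum>n\<in>F. f n * (- of_real (ln (real n)) * dterm n (Pmix \<tau> t)))) (at \<tau> within {0..1})"
        using field_vector_diff_chain_within[OF Pd has_field_derivative_at_within[OF D]] by (simp add: o_def)
      also have "(P1 t - P0 t) * (\<Sum>n\<in>F. f n * (- of_real (ln (real n)) * dterm n (Pmix \<tau> t))) = g t \<tau>"
        unfolding g_def f'_def dterm_def sum_distrib_left
        by (intro sum.cong refl) (simp add: algebra_simps)
      finally show ?thesis .
    qed
    then have "(g t has_integral dpoly F f (Pmix 1 t) - dpoly F f (Pmix 0 t)) {0..1}"
      by (intro fundamental_theorem_of_calculus) auto
    then show ?thesis by (simp add: Pmix_def integral_unique)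
  qed
  have slice: "integral {-T..T} (\<lambda>t. (cmod (g t \<tau>))\<^sup>2) \<le> 16 * C / \<kappa> * (2 * T * (\<Sum>n\<in>F. (cmod (f n))\<^sup>2)) + C / \<kappa> ^ 3 * E"
    if \<tau>: "0 \<le> \<tau>" "\<tau> \<le> 1" and T: "T \<ge> 0" for T \<tau>
  proof -
    \<comment> \<open>With \<open>exp (- \<kappa> * Pmix \<tau> t)\<close> taken out, the remaining
      frequencies are still nonnegative, and the mean-square estimate applies with
      \<open>y = \<kappa>\<close>.\<close>
    define q where "q = (\<lambda>t. \<Sum>n\<in>F. f' n * exp (- (of_real (ln (real n) - \<kappa>) * Pmix \<tau> t)))"
    have "(cmod (g t \<tau>))\<^sup>2 \<le> C / \<kappa> ^ 3 * (cmod (q t))\<^sup>2" for t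
    proof -
      define h where "h = Re (Pmix \<tau> t)"
      have mh: "min (Re (P0 t)) (Re (P1 t)) \<le> h" unfolding h_def by (rule Re_Pmix_ge_min[OF \<tau>])
      have m0: "0 \<le> min (Re (P0 t)) (Re (P1 t))" using Re_P0 Re_P1 by simp
      have h0: "h \<ge> 0" using m0 mh by linarith
      have "(\<Sum>n\<in>F. f' n * exp (- (of_real (ln (real n)) * Pmix \<tau> t))) = exp (- (of_real \<kappa> * Pmix \<tau> t)) * q t"
        unfolding q_def sum_distrib_left
        by (intro sum.cong refl) (simp add: algebra_simps flip: exp_add)
      then have "(cmod (g t \<tau>))\<^sup>2 = (cmod (P0 t - P1 t))\<^sup>2 * exp (- (\<kappa> * h)) ^ 2 * (cmod (q t))\<^sup>2"
        by (simp add: g_def norm_mult power_mult_distrib h_def)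
      also have "\<dots> \<le> (C / \<kappa> ^ 3) * (cmod (q t))\<^sup>2"
      proof (rule mult_right_mono)
        have "(cmod (P0 t - P1 t))\<^sup>2 \<le> C * h ^ 3"
          using contact[of t] mult_left_mono[OF power_mono[OF mh m0, of 3] C] by linarith
        then have "(cmod (P0 t - P1 t))\<^sup>2 * exp (- (\<kappa> * h)) ^ 2 \<le> C * h ^ 3 * exp (- (\<kappa> * h)) ^ 2"
          by (intro mult_right_mono) auto
        also have "\<dots> = C / \<kappa> ^ 3 * ((\<kappa> * h) ^ 3 * exp (- (2 * (\<kappa> * h))))"
          using \<kappa> by (simp add: power_mult_distrib power2_eq_square flip: exp_add)
        also have "\<dots> \<le> C / \<kappa> ^ 3 * 1"
        proof (intro mult_left_mono)
          have "(\<kappa> * h) ^ 3 \<le> exp (2 * (\<kappa> * h))" using \<kappa> h0 by (intro cube_le_exp) simp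
          then show "(\<kappa> * h) ^ 3 * exp (- (2 * (\<kappa> * h))) \<le> 1" by (simp add: exp_minus divide_simps)
        qed (use C \<kappa> in simp)
        finally show "(cmod (P0 t - P1 t))\<^sup>2 * exp (- (\<kappa> * h)) ^ 2 \<le> C / \<kappa> ^ 3" by simp
      qed simp
      finally show ?thesis .
    qed
    then have "integral {-T..T} (\<lambda>t. (cmod (g t \<tau>))\<^sup>2) \<le> integral {-T..T} (\<lambda>t. C / \<kappa> ^ 3 * (cmod (q t))\<^sup>2)"
      by (intro integral_le integrable_continuous_real continuous_intros cg) (auto simp: q_def Pmix_def intro!: continuous_intros)
    also have "\<dots> = C / \<kappa> ^ 3 * integral {-T..T} (\<lambda>t. (cmod (q t))\<^sup>2)" by simp
    also have "\<dots> \<le> C / \<kappa> ^ 3 * (2 * T * (\<Sum>n\<in>F. (cmod (f' n))\<^sup>2) + E)"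
      using E[rule_format, OF decaying_Pmix[OF \<tau>], of \<kappa> T] freq T C \<kappa>
      by (intro mult_left_mono) (auto simp: q_def)
    also have "\<dots> \<le> C / \<kappa> ^ 3 * (2 * T * (\<Sum>n\<in>F. (4 * \<kappa>)\<^sup>2 * (cmod (f n))\<^sup>2) + E)"
    proof (intro mult_left_mono add_right_mono sum_mono)
      fix n assume "n \<in> F"
      then have "(ln (real n))\<^sup>2 \<le> (4 * \<kappa>)\<^sup>2" using freq[of n] \<kappa> by (intro power_mono) auto
      then show "(cmod (f' n))\<^sup>2 \<le> (4 * \<kappa>)\<^sup>2 * (cmod (f n))\<^sup>2"
        by (simp add: f'_def norm_mult power_mult_distrib mult_right_mono)
    qed (use C \<kappa> T in auto)
    also have "\<dots> = 16 * C / \<kappa> * (2 * T * (\<Sum>n\<in>F. (cmod (f n))\<^sup>2)) + C / \<kappa> ^ 3 * E"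
    proof -
      have "(\<Sum>n\<in>F. (4 * \<kappa>)\<^sup>2 * (cmod (f n))\<^sup>2) = 16 * \<kappa>\<^sup>2 * (\<Sum>n\<in>F. (cmod (f n))\<^sup>2)"
        by (simp add: sum_distrib_left power_mult_distrib)
      then show ?thesis using \<kappa> by (simp only:) (simp add: field_simps power2_eq_square power3_eq_cube)
    qed
    finally show ?thesis .
  qed
  have "integral {-T..T} (\<lambda>t. (cmod (dpoly F f (P0 t) - dpoly F f (P1 t)))\<^sup>2)
      \<le> 16 * C / \<kappa> * (2 * T * (\<Sum>n\<in>F. (cmod (f n))\<^sup>2)) + C / \<kappa> ^ 3 * E" if T: "T \<ge> 0" for T
  proof -
    let ?G = "\<lambda>t \<tau>. (cmod (g t \<tau>))\<^sup>2"
    \<comment> \<open>Jensen on \<open>[0, 1]\<close> and an exchange of the two integrations reduce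
      the claim to slices of fixed \<open>\<tau>\<close>.\<close>
    have "integral {-T..T} (\<lambda>t. (cmod (dpoly F f (P0 t) - dpoly F f (P1 t)))\<^sup>2)
       \<le> integral {-T..T} (\<lambda>t. integral {0..1} (?G t))"
    proof (intro integral_le integrable_continuous_real)
      show "continuous_on {-T..T} (\<lambda>t. (cmod (dpoly F f (P0 t) - dpoly F f (P1 t)))\<^sup>2)"
        unfolding dpoly_def dterm_def by (intro continuous_intros)
      have "continuous_on ({-T..T} \<times> cbox 0 1) (\<lambda>(t, \<tau>). ?G t \<tau>)"
        unfolding split_beta by (intro continuous_intros cg)
      then show "continuous_on {-T..T} (\<lambda>t. integral {0..1} (?G t))"
        using integral_continuous_on_param[of "{-T..T}" 0 1 ?G] by simp
      show "(cmod (dpoly F f (P0 t) - dpoly F f (P1 t)))\<^sup>2 \<le> integral {0..1} (?G t)" for t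
        using square_integral_unit_le[of "g t"] cg[OF continuous_on_const continuous_on_id, of "{0..1}" t]
        by (simp add: repr[symmetric] norm_minus_commute)
    qed
    also have "\<dots> = integral {0..1} (\<lambda>\<tau>. integral {-T..T} (\<lambda>t. ?G t \<tau>))"
    proof -
      have "continuous_on (cbox (-T, 0) (T, 1)) (\<lambda>(t, \<tau>). ?G t \<tau>)"
        unfolding split_beta by (intro continuous_intros cg)
      from integral_swap_continuous[OF this] show ?thesis by simp
    qed
    also have "\<dots> \<le> integral {0..1} (\<lambda>\<tau>::real. 16 * C / \<kappa> * (2 * T * (\<Sum>n\<in>F. (cmod (f n))\<^sup>2)) + C / \<kappa> ^ 3 * E)"
    proof (intro integral_le integrable_continuous_real)
      have "continuous_on ({0..1} \<times> cbox (-T) T) (\<lambda>(\<tau>, t). ?G t \<tau>)"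
        unfolding split_beta by (intro continuous_intros cg)
      then show "continuous_on {0..1} (\<lambda>\<tau>. integral {-T..T} (\<lambda>t. ?G t \<tau>))"
        using integral_continuous_on_param[of "{0..1}" "-T" T "\<lambda>\<tau> t. ?G t \<tau>"] by simp
    qed (use slice T in auto)
    finally show ?thesis by simp
  qed
  then show ?thesis by blast
qed

text \<open>Frequencies are grouped into blocks from \<open>4 ^ j\<close> to
  \<open>4 * 4 ^ j\<close>. Cauchy-Schwarz with weights \<open>1 / 2 ^ j\<close> has total weight at
  most \<open>2 / 2 ^ K\<close>, and the price \<open>2 ^ j\<close> per block is covered by the gain
  \<open>1 / 4 ^ j\<close>.\<close>

lemma high_frequency_bound:
  assumes F: "finite F" "0 \<notin> F" and freq: "\<And>n. n \<in> F \<Longrightarrow> 4 ^ K \<le> ln (real n)"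
    and C: "C \<ge> 0" and contact: "\<And>t. (cmod (P0 t - P1 t))\<^sup>2 \<le> C * (min (Re (P0 t)) (Re (P1 t))) ^ 3"
  shows "\<exists>E. \<forall>T\<ge>0. integral {-T..T} (\<lambda>t. (cmod (dpoly F f (P0 t) - dpoly F f (P1 t)))\<^sup>2)
    \<le> 32 * C / 2 ^ K * (2 * T * (\<Sum>n\<in>F. (cmod (f n))\<^sup>2)) + E"
proof -
  have "\<exists>k. 4 ^ k \<le> ln (real n) \<and> ln (real n) \<le> 4 * 4 ^ k" if n: "n \<in> F" for n
  proof -
    have "(1::real) \<le> 4 ^ K" by simp
    then have x1: "ln (real n) \<ge> 1" using freq[OF n] by linarith
    define m where "m = nat \<lfloor>ln (real n)\<rfloor>"
    have m: "real m \<le> ln (real n)" "ln (real n) < real m + 1" "m \<ge> 1"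
      using x1 unfolding m_def by linarith+
    obtain k where k: "4 ^ k \<le> m" "m < 4 ^ (k + 1)"
      using ex_power_ivl1[of 4 m] m(3) by auto
    have "(4::real) ^ k \<le> real m"
      using k(1) by (metis of_nat_le_iff of_nat_numeral of_nat_power)
    moreover have "real m + 1 \<le> 4 * 4 ^ k"
    proof -
      have "real (m + 1) \<le> real (4 ^ (k + 1))" using k(2) by (intro of_nat_mono) simp
      then show ?thesis by simp
    qed
    ultimately show ?thesis using m by (intro exI[of _ k]) linarith
  qed
  then obtain k where k: "\<And>n. n \<in> F \<Longrightarrow> 4 ^ k n \<le> ln (real n) \<and> ln (real n) \<le> 4 * 4 ^ k n"
    by metis
  \<comment> \<open>Neighbouring blocks share an endpoint, so a frequency equal to
    \<open>4 ^ K\<close> may have been assigned to the block below \<open>K\<close>; the maximum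
    moves it up.\<close>
  define Fb where "Fb = (\<lambda>j. {n \<in> F. max K (k n) = j})"
  define J where "J = (\<lambda>n. max K (k n)) ` F"
  have J: "finite J" "\<And>j. j \<in> J \<Longrightarrow> K \<le> j" using F by (auto simp: J_def)
  have Fb: "finite (Fb j)" "0 \<notin> Fb j" for j using F by (auto simp: Fb_def)
  have freqb: "4 ^ j \<le> ln (real n) \<and> ln (real n) \<le> 4 * 4 ^ j" if "n \<in> Fb j" for n j
  proof (cases "K \<le> k n")
    case True
    then show ?thesis using that k[of n] by (simp add: Fb_def max_def split: if_splits)
  next
    case False
    then have "(4::real) ^ k n \<le> 4 ^ K" by (intro power_increasing) auto
    moreover have jK: "j = K" "n \<in> F" using that False by (auto simp: Fb_def)
    ultimately have "ln (real n) \<le> 4 * 4 ^ K" using k[OF jK(2)] by linarith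
    then show ?thesis using freq[OF jK(2)] jK(1) by simp
  qed
  have split: "(\<Sum>n\<in>F. h n) = (\<Sum>j\<in>J. \<Sum>n\<in>Fb j. h n)" for h :: "nat \<Rightarrow> 'z::comm_monoid_add"
    unfolding Fb_def J_def using F(1) by (rule sum.image_gen)
  have "\<forall>j. \<exists>E. \<forall>T\<ge>0. integral {-T..T} (\<lambda>t. (cmod (dpoly (Fb j) f (P0 t) - dpoly (Fb j) f (P1 t)))\<^sup>2)
    \<le> 16 * C / 4 ^ j * (2 * T * (\<Sum>n\<in>Fb j. (cmod (f n))\<^sup>2)) + E"
    using block_difference_bound[OF Fb _ freqb C contact] by simp
  then have "\<exists>E. \<forall>j. \<forall>T\<ge>0. integral {-T..T} (\<lambda>t. (cmod (dpoly (Fb j) f (P0 t) - dpoly (Fb j) f (P1 t)))\<^sup>2)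
    \<le> 16 * C / 4 ^ j * (2 * T * (\<Sum>n\<in>Fb j. (cmod (f n))\<^sup>2)) + E j"
    by (rule choice)
  then obtain E where E: "\<forall>j. \<forall>T\<ge>0. integral {-T..T} (\<lambda>t. (cmod (dpoly (Fb j) f (P0 t) - dpoly (Fb j) f (P1 t)))\<^sup>2)
    \<le> 16 * C / 4 ^ j * (2 * T * (\<Sum>n\<in>Fb j. (cmod (f n))\<^sup>2)) + E j" ..
  define D where "D = (\<lambda>j t. dpoly (Fb j) f (P0 t) - dpoly (Fb j) f (P1 t))"
  have cD: "continuous_on X (D j)" for X j
    unfolding D_def dpoly_def dterm_def by (intro continuous_intros)
  have weights: "(\<Sum>j\<in>J. 1 / 2 ^ j) \<le> 2 / (2 ^ K :: real)"
  proof -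
    obtain M where M: "J \<subseteq> {K..<M + K}"
      using J finite_nat_set_iff_bounded[of J] by (metis atLeastLessThan_iff subsetI trans_less_add1)
    have "(\<Sum>j\<in>J. 1 / 2 ^ j) \<le> (\<Sum>j\<in>{K..<M + K}. 1 / 2 ^ j :: real)"
      by (rule sum_mono2) (use M in auto)
    also have "\<dots> = 1 / 2 ^ K * (\<Sum>j<M. (1 / 2) ^ j)"
      unfolding sum_distrib_left
      by (rule sum.reindex_bij_witness[where i = "\<lambda>j. j + K" and j = "\<lambda>j. j - K"])
        (auto simp: power_add power_divide[symmetric] power_one_over field_simps simp flip: power_add)
    also have "(\<Sum>j<M. (1 / 2) ^ j) = (1 - (1 / 2) ^ M) / (1 - 1 / 2 :: real)"
      by (rule sum_gp_strict[THEN trans]) auto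
    also have "1 / 2 ^ K * \<dots> \<le> 2 / (2 ^ K :: real)"
      by (simp add: field_simps)
    finally show ?thesis .
  qed
  have CS: "(cmod (dpoly F f (P0 t) - dpoly F f (P1 t)))\<^sup>2 \<le> 2 / 2 ^ K * (\<Sum>j\<in>J. 2 ^ j * (cmod (D j t))\<^sup>2)" for t
  proof -
    have "dpoly F f (P0 t) - dpoly F f (P1 t) = (\<Sum>j\<in>J. D j t)"
      unfolding D_def dpoly_def by (simp add: split sum_subtractf)
    then have "cmod (dpoly F f (P0 t) - dpoly F f (P1 t)) \<le> (\<Sum>j\<in>J. cmod (D j t))"
      by (simp add: norm_sum)
    also have "\<dots> = (\<Sum>j\<in>J. sqrt (1 / 2 ^ j) * (sqrt (2 ^ j) * cmod (D j t)))"
      by (intro sum.cong refl) (simp add: real_sqrt_divide)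
    finally have "(cmod (dpoly F f (P0 t) - dpoly F f (P1 t)))\<^sup>2 \<le>
       (\<Sum>j\<in>J. sqrt (1 / 2 ^ j) * (sqrt (2 ^ j) * cmod (D j t)))\<^sup>2"
      by (intro power_mono) auto
    also have "\<dots> \<le> (\<Sum>j\<in>J. (sqrt (1 / 2 ^ j))\<^sup>2) * (\<Sum>j\<in>J. (sqrt (2 ^ j) * cmod (D j t))\<^sup>2)"
      by (rule Cauchy_Schwarz_ineq_sum)
    also have "\<dots> = (\<Sum>j\<in>J. 1 / 2 ^ j) * (\<Sum>j\<in>J. 2 ^ j * (cmod (D j t))\<^sup>2)"
      by (simp add: power_mult_distrib)
    also have "\<dots> \<le> 2 / 2 ^ K * (\<Sum>j\<in>J. 2 ^ j * (cmod (D j t))\<^sup>2)"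
      by (intro mult_right_mono weights sum_nonneg) auto
    finally show ?thesis .
  qed
  have "integral {-T..T} (\<lambda>t. (cmod (dpoly F f (P0 t) - dpoly F f (P1 t)))\<^sup>2)
    \<le> 32 * C / 2 ^ K * (2 * T * (\<Sum>n\<in>F. (cmod (f n))\<^sup>2)) + 2 / 2 ^ K * (\<Sum>j\<in>J. 2 ^ j * E j)" if T: "T \<ge> 0" for T
  proof -
    have "integral {-T..T} (\<lambda>t. (cmod (dpoly F f (P0 t) - dpoly F f (P1 t)))\<^sup>2)
      \<le> integral {-T..T} (\<lambda>t. 2 / 2 ^ K * (\<Sum>j\<in>J. 2 ^ j * (cmod (D j t))\<^sup>2))"
      by (intro integral_le integrable_continuous_real CS continuous_intros cD)
        (auto simp: dpoly_def dterm_def intro!: continuous_intros)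
    also have "\<dots> = 2 / 2 ^ K * (\<Sum>j\<in>J. 2 ^ j * integral {-T..T} (\<lambda>t. (cmod (D j t))\<^sup>2))"
      using J by (simp add: integral_sum integrable_continuous_real continuous_intros cD)
    also have "\<dots> \<le> 2 / 2 ^ K * (\<Sum>j\<in>J. 16 * C * (2 * T * (\<Sum>n\<in>Fb j. (cmod (f n))\<^sup>2)) + 2 ^ j * E j)"
    proof (intro mult_left_mono sum_mono)
      fix j
      have "2 ^ j * integral {-T..T} (\<lambda>t. (cmod (D j t))\<^sup>2) \<le>
         2 ^ j * (16 * C / 4 ^ j * (2 * T * (\<Sum>n\<in>Fb j. (cmod (f n))\<^sup>2)) + E j)"
        unfolding D_def by (intro mult_left_mono E[rule_format] T) auto
      also have "\<dots> = (1 / 2 ^ j) * (16 * C * (2 * T * (\<Sum>n\<in>Fb j. (cmod (f n))\<^sup>2))) + 2 ^ j * E j"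
      proof -
        have "(4::real) ^ j = 2 ^ j * 2 ^ j" by (simp flip: power_mult_distrib)
        then show ?thesis by (simp add: ring_distribs)
      qed
      also have "\<dots> \<le> 1 * (16 * C * (2 * T * (\<Sum>n\<in>Fb j. (cmod (f n))\<^sup>2))) + 2 ^ j * E j"
        using C T by (intro add_right_mono mult_right_mono mult_nonneg_nonneg sum_nonneg) (auto simp: divide_simps)
      finally show "2 ^ j * integral {-T..T} (\<lambda>t. (cmod (D j t))\<^sup>2)
         \<le> 16 * C * (2 * T * (\<Sum>n\<in>Fb j. (cmod (f n))\<^sup>2)) + 2 ^ j * E j" by simp
    qed simp
    also have "\<dots> = 32 * C / 2 ^ K * (2 * T * (\<Sum>n\<in>F. (cmod (f n))\<^sup>2)) + 2 / 2 ^ K * (\<Sum>j\<in>J. 2 ^ j * E j)"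
      by (simp add: split[of "\<lambda>n. (cmod (f n))\<^sup>2"] sum.distrib sum_distrib_left[symmetric] ring_distribs)
    finally show ?thesis .
  qed
  then show ?thesis by blast
qed

lemma compact_difference_if_contact:
  assumes C: "C \<ge> 0" and contact: "\<And>t. (cmod (P0 t - P1 t))\<^sup>2 \<le> C * (min (Re (P0 t)) (Re (P1 t))) ^ 3"
  shows "compact_operator (\<lambda>f. composition_op \<phi>0 f - composition_op \<phi>1 f)"
proof (rule compact_operator_if_small_tails)
  define T where "T = (\<lambda>f. composition_op \<phi>0 f - composition_op \<phi>1 f)"
  have bl: "bounded_linear T"
    unfolding T_def by (intro bounded_linear_sub p0.bounded_linear_composition_op p1.bounded_linear_composition_op)
  then show "bounded_linear (\<lambda>f. composition_op \<phi>0 f - composition_op \<phi>1 f)" by (simp add: T_def)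
  have poly: "(norm (T f))\<^sup>2 \<le> 32 * C / 2 ^ K * (norm f)\<^sup>2"
    if fin: "finite (support_H f)" and freq: "\<And>n. n \<in> support_H f \<Longrightarrow> 4 ^ K \<le> ln (real n)" for f K
  proof -
    let ?F = "support_H f"
    obtain E where E: "\<And>T. T \<ge> 0 \<Longrightarrow> integral {-T..T} (\<lambda>t. (cmod (dpoly ?F (coeff_H f) (P0 t) - dpoly ?F (coeff_H f) (P1 t)))\<^sup>2)
      \<le> 32 * C / 2 ^ K * (2 * T * (\<Sum>n\<in>?F. (cmod (coeff_H f n))\<^sup>2)) + E"
      using high_frequency_bound[OF fin zero_notin_support_H freq C contact, of "coeff_H f"] by blast
    show ?thesis
    proof (rule norm_H_le_mean)
      have "abs_dirichlet {0<..} (\<lambda>n. coeff_H (composition_op \<phi>0 f) n + - 1 * coeff_H (composition_op \<phi>1 f) n)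
        (\<lambda>s. dpoly ?F (coeff_H f) (dsym c0 A a s) + - 1 * dpoly ?F (coeff_H f) (dsym c0 B b s))"
        by (intro abs_dirichlet_add abs_dirichlet_cmult p0.composition_op_poly p1.composition_op_poly
            mult_monoid_positive support_positive p0.A_positive p1.A_positive fin order_refl)
      moreover have "coeff_H (T f) = (\<lambda>n. coeff_H (composition_op \<phi>0 f) n + - 1 * coeff_H (composition_op \<phi>1 f) n)"
        by (auto simp: T_def minus_dirichlet_H.rep_eq)
      ultimately show "abs_dirichlet {0<..} (coeff_H (T f))
        (\<lambda>s. dpoly ?F (coeff_H f) (dsym c0 A a s) - dpoly ?F (coeff_H f) (dsym c0 B b s))" by simp
      show "continuous_on UNIV (\<lambda>s. dpoly ?F (coeff_H f) (dsym c0 A a s) - dpoly ?F (coeff_H f) (dsym c0 B b s))"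
        unfolding dpoly_def dterm_def by (intro continuous_intros continuous_dsym)
      show "integral {-T..T} (\<lambda>t. (cmod (dpoly ?F (coeff_H f) (dsym c0 A a (\<i> * of_real t)) -
          dpoly ?F (coeff_H f) (dsym c0 B b (\<i> * of_real t))))\<^sup>2) \<le> 2 * T * (32 * C / 2 ^ K * (norm f)\<^sup>2) + E"
        if "T > 0" for T
        using E[of T] that by (simp add: P0_def P1_def norm_H_sq_finite_support[OF fin order_refl] mult_ac)
    qed auto
  qed
  fix \<epsilon> :: real assume "\<epsilon> > 0"
  obtain K where K: "32 * C / \<epsilon>\<^sup>2 < 2 ^ K"
    using real_arch_pow[of 2 "32 * C / \<epsilon>\<^sup>2"] by auto
  then have K': "32 * C / 2 ^ K \<le> \<epsilon>\<^sup>2" using \<open>\<epsilon> > 0\<close> by (simp add: field_simps)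
  \<comment> \<open>An index from \<open>N\<close> on has logarithm at least \<open>4 ^ K\<close>,
    so vanishing of the coefficients below \<open>N\<close> leaves only high frequencies.\<close>
  obtain N where N: "exp (4 ^ K) \<le> real N" using real_arch_simple by blast
  show "\<exists>N. \<forall>f. (\<forall>n<N. coeff_H f n = 0) \<longrightarrow> norm (composition_op \<phi>0 f - composition_op \<phi>1 f) \<le> \<epsilon> * norm f"
  proof (intro exI[of _ N] allI impI)
    fix f assume f: "\<forall>n<N. coeff_H f n = 0"
    have tr: "norm (T (trunc_H M f)) \<le> \<epsilon> * norm (trunc_H M f)" for M
    proof -
      have "4 ^ K \<le> ln (real n)" if "n \<in> support_H (trunc_H M f)" for n
      proof -
        have "N \<le> n" using f that by (auto simp: support_H_def coeff_trunc_H split: if_splits intro: leI)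
        then have "exp (4 ^ K) \<le> real n" using N by (meson of_nat_le_iff order_trans)
        then show ?thesis by (metis exp_gt_zero ln_exp ln_mono)
      qed
      from poly[OF finite_support_trunc_H this] have "(norm (T (trunc_H M f)))\<^sup>2 \<le> 32 * C / 2 ^ K * (norm (trunc_H M f))\<^sup>2" .
      also have "\<dots> \<le> \<epsilon>\<^sup>2 * (norm (trunc_H M f))\<^sup>2" by (intro mult_right_mono K') auto
      finally have "(norm (T (trunc_H M f)))\<^sup>2 \<le> (\<epsilon> * norm (trunc_H M f))\<^sup>2" by (simp add: power_mult_distrib)
      then show ?thesis by (rule power2_le_imp_le) (use \<open>\<epsilon> > 0\<close> in simp)
    qed
    have "(\<lambda>M. norm (T (trunc_H M f))) \<longlonglongrightarrow> norm (T f)"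
      by (intro tendsto_norm bounded_linear.tendsto[OF bl] trunc_H_tendsto)
    moreover have "(\<lambda>M. \<epsilon> * norm (trunc_H M f)) \<longlonglongrightarrow> \<epsilon> * norm f"
      by (intro tendsto_intros trunc_H_tendsto)
    ultimately have "norm (T f) \<le> \<epsilon> * norm f" by (rule LIMSEQ_le) (use tr in blast)
    then show "norm (composition_op \<phi>0 f - composition_op \<phi>1 f) \<le> \<epsilon> * norm f" by (simp add: T_def)
  qed
qed

end

section \<open>Smooth numbers and Bohr lifts\<close>

lemma nth_prime_prime: "prime (nth_prime j)"
  using enumerate_in_set[OF primes_infinite, of j] by (simp add: nth_prime_def)

lemma nth_prime_pos [simp]: "nth_prime j > 0"
  using nth_prime_prime prime_gt_0_nat by blast

lemma nth_prime_gt_1: "nth_prime j > 1"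
  using nth_prime_prime prime_gt_1_nat by blast

lemma nth_prime_inj: "nth_prime i = nth_prime j \<longleftrightarrow> i = j"
  using inj_enumerate[OF primes_infinite] by (auto simp: nth_prime_def inj_def)

lemma nth_prime_surj:
  assumes "prime p" obtains j where "j \<le> p" "p = nth_prime j"
proof -
  obtain j where j: "enumerate {p. prime p} j = p"
    using enumerate_Ex[of "{p::nat. prime p}" p] assms primes_infinite by auto
  moreover have "j \<le> p" using le_enumerate[OF primes_infinite, of j] j by simp
  ultimately show thesis using that[of j] j[symmetric] unfolding nth_prime_def by blast
qed

text \<open>The multiplicative monoid generated by the first \<open>D\<close> primes; it carries
  both the symbols and the kernels.\<close>

definition smooth :: "nat \<Rightarrow> nat set" where
  "smooth D = {n. n > 0 \<and> (\<forall>p. prime p \<longrightarrow> p dvd n \<longrightarrow> (\<exists>j<D. p = nth_prime j))}"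

lemma mult_monoid_smooth: "mult_monoid (smooth D)"
  by (auto simp: mult_monoid_def smooth_def prime_dvd_mult_iff)

lemma smooth_mono: "D \<le> D' \<Longrightarrow> smooth D \<subseteq> smooth D'"
  unfolding smooth_def using order_less_le_trans by blast

lemma smooth_pos: "n \<in> smooth D \<Longrightarrow> n > 0"
  by (simp add: smooth_def)

lemma smooth_multiplicity_eq_0: "n \<in> smooth D \<Longrightarrow> j \<ge> D \<Longrightarrow> multiplicity (nth_prime j) n = 0"
  using nth_prime_prime[of j] by (auto simp: smooth_def nth_prime_inj intro!: not_dvd_imp_multiplicity_0)

lemma smooth_factorization:
  assumes "n \<in> smooth D"
  shows "n = (\<Prod>j<D. nth_prime j ^ multiplicity (nth_prime j) n)"
proof -
  have n: "n > 0" using assms by (rule smooth_pos)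
  have "n = (\<Prod>p\<in>prime_factors n. p ^ multiplicity p n)"
    using prod_prime_factors[of n] n by simp
  also have "\<dots> = (\<Prod>p\<in>nth_prime ` {..<D}. p ^ multiplicity p n)"
  proof (rule prod.mono_neutral_left)
    show "prime_factors n \<subseteq> nth_prime ` {..<D}"
      using assms by (auto simp: smooth_def in_prime_factors_iff)
    show "\<forall>p\<in>nth_prime ` {..<D} - prime_factors n. p ^ multiplicity p n = 1"
      using n by (auto simp: in_prime_factors_iff nth_prime_prime not_dvd_imp_multiplicity_0)
  qed auto
  also have "\<dots> = (\<Prod>j<D. nth_prime j ^ multiplicity (nth_prime j) n)"
    by (subst prod.reindex) (auto simp: inj_on_def nth_prime_inj)
  finally show ?thesis .
qed

lemma prod_nth_prime_smooth: "(\<Prod>j<D. nth_prime j ^ \<alpha> j) \<in> smooth D"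
  by (auto simp: smooth_def prime_dvd_prod_iff prime_dvd_power_iff intro!: prod_pos)
    (metis lessThan_iff nth_prime_prime prime_dvd_power primes_dvd_imp_eq)

lemma smooth_iff: "n \<in> smooth D \<longleftrightarrow> (\<exists>\<alpha> :: nat \<Rightarrow> nat. n = (\<Prod>j<D. nth_prime j ^ \<alpha> j))"
  using smooth_factorization prod_nth_prime_smooth by metis

lemma in_smooth_Suc:
  assumes "n > 0"
  shows "n \<in> smooth (Suc n)"
  unfolding smooth_def
proof (intro CollectI conjI allI impI assms)
  fix p assume p: "prime p" "p dvd n"
  obtain j where "j \<le> p" "p = nth_prime j" using nth_prime_surj[OF p(1)] .
  then show "\<exists>j<Suc n. p = nth_prime j"
    using dvd_imp_le[OF p(2) assms] by (intro exI[of _ j]) simp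
qed

text \<open>The minimum in \<open>bohr_dim\<close> is over a nonempty set: if every index is at most
  \<open>N\<close>, the first \<open>N + 1\<close> primes suffice, because the prime of index
  \<open>j\<close> is at least \<open>j\<close>.\<close>

lemma support_smooth:
  assumes "finite (dirichlet_support c)"
  shows "dirichlet_support c \<subseteq> smooth (bohr_dim c)"
proof -
  define P where "P = (\<lambda>d::nat. d \<ge> 1 \<and> (\<forall>n\<in>dirichlet_support c. \<exists>\<alpha> :: nat \<Rightarrow> nat. n = (\<Prod>j<d. nth_prime j ^ \<alpha> j)))"
  have "\<exists>N. \<forall>n\<in>dirichlet_support c. n \<le> N" using assms finite_nat_set_iff_bounded_le by blast
  then obtain N where N: "\<And>n. n \<in> dirichlet_support c \<Longrightarrow> n \<le> N" by blast
  have "n \<in> smooth (Suc N)" if "n \<in> dirichlet_support c" for n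
    using in_smooth_Suc[of n] smooth_mono[of "Suc n" "Suc N"] N[OF that] that by (auto simp: dirichlet_support_def)
  then have "P (Suc N)" by (simp add: P_def smooth_iff)
  then have "P (bohr_dim c)" unfolding bohr_dim_def P_def[symmetric] by (rule LeastI)
  then show "dirichlet_support c \<subseteq> smooth (bohr_dim c)" by (auto simp: P_def smooth_iff)
qed

text \<open>The number of variables is a parameter, so that two symbols of different
  \<open>bohr_dim\<close> can be compared in a common polydisc.\<close>

definition monom_at :: "nat \<Rightarrow> (nat \<Rightarrow> complex) \<Rightarrow> nat \<Rightarrow> complex" where
  "monom_at D z n = (\<Prod>j<D. z j ^ multiplicity (nth_prime j) n)"

lemma bohr_lift_eq: "bohr_lift c z = (\<Sum>n\<in>dirichlet_support c. c n * monom_at (bohr_dim c) z n)"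
  by (simp add: bohr_lift_def monom_at_def)

lemma monom_at_mono:
  assumes "n \<in> smooth D" "D \<le> D'"
  shows "monom_at D' z n = monom_at D z n"
  unfolding monom_at_def
  by (rule prod.mono_neutral_right) (use assms smooth_multiplicity_eq_0[OF assms(1)] in auto)

lemma bohr_lift_eq_ge:
  assumes "finite (dirichlet_support c)" "bohr_dim c \<le> D"
  shows "bohr_lift c z = (\<Sum>n\<in>dirichlet_support c. c n * monom_at D z n)"
  unfolding bohr_lift_eq
  by (intro sum.cong refl) (use support_smooth[OF assms(1)] monom_at_mono[OF _ assms(2)] in auto)

lemma monom_at_mult: "monom_at D (\<lambda>j. z j * w j) n = monom_at D z n * monom_at D w n"
  by (simp add: monom_at_def power_mult_distrib prod.distrib)

lemma monom_at_cong: "(\<And>j. j < D \<Longrightarrow> z j = w j) \<Longrightarrow> monom_at D z n = monom_at D w n"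
  by (simp add: monom_at_def)

lemma dterm_prod:
  assumes "finite I" "\<And>j. j \<in> I \<Longrightarrow> g j > 0"
  shows "dterm (\<Prod>j\<in>I. g j) s = (\<Prod>j\<in>I. dterm (g j) s)"
  using assms by (induction I) (auto simp: dterm_mult prod_pos)

lemma monom_at_dterm:
  assumes "n \<in> smooth D"
  shows "monom_at D (\<lambda>j. dterm (nth_prime j) s) n = dterm n s"
proof -
  have "dterm n s = dterm (\<Prod>j<D. nth_prime j ^ multiplicity (nth_prime j) n) s"
    using smooth_factorization[OF assms] by (rule arg_cong)
  also have "\<dots> = monom_at D (\<lambda>j. dterm (nth_prime j) s) n"
    by (simp add: dterm_prod dterm_power monom_at_def)
  finally show ?thesis by simp
qed

lemma monom_at_cis: "monom_at D (\<lambda>j. cis (\<theta> j)) n = cis (\<Sum>j<D. \<theta> j * real (multiplicity (nth_prime j) n))"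
proof -
  have "(\<Prod>j<D. cis (f j)) = cis (\<Sum>j<D. f j)" for f :: "nat \<Rightarrow> real"
    by (induction D) (auto simp: cis_mult)
  then show ?thesis by (simp add: monom_at_def Complex.DeMoivre mult.commute)
qed

lemma bohr_lift_vertical:
  assumes "finite (dirichlet_support c)"
  shows "bohr_lift c (\<lambda>j. dterm (nth_prime j) s) = dpoly (dirichlet_support c) c s"
  unfolding bohr_lift_eq dpoly_def
  by (intro sum.cong refl) (use support_smooth[OF assms] in \<open>auto simp: monom_at_dterm\<close>)

lemma bohr_lift_cong: "(\<And>j. j < bohr_dim c \<Longrightarrow> z j = w j) \<Longrightarrow> bohr_lift c z = bohr_lift c w"
  unfolding bohr_lift_eq by (intro sum.cong refl) (auto cong: monom_at_cong)

lemma tendsto_monom_at: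
  assumes "\<And>j. j < D \<Longrightarrow> ((\<lambda>k. z k j) \<longlongrightarrow> w j) F"
  shows "((\<lambda>k. monom_at D (z k) n) \<longlongrightarrow> monom_at D w n) F"
  unfolding monom_at_def by (intro tendsto_intros assms) auto

lemma tendsto_bohr_lift:
  assumes "\<And>j. j < bohr_dim c \<Longrightarrow> ((\<lambda>k. z k j) \<longlongrightarrow> w j) F"
  shows "((\<lambda>k. bohr_lift c (z k)) \<longlongrightarrow> bohr_lift c w) F"
  unfolding bohr_lift_eq by (intro tendsto_intros tendsto_monom_at assms)

section \<open>Second-order contact gives compactness\<close>

text \<open>The difference of the lifts at \<open>z j * cis (\<delta> j)\<close> is a trigonometric
  polynomial in the displacement \<open>\<delta>\<close>; these are its coefficients.\<close>

definition gap :: "nat \<Rightarrow> (nat \<Rightarrow> complex) \<Rightarrow> (nat \<Rightarrow> complex) \<Rightarrow> (nat \<Rightarrow> complex) \<Rightarrow> nat \<Rightarrow> complex" where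
  "gap D a b z n = (a n - b n) * monom_at D z n"

definition joint_support :: "(nat \<Rightarrow> complex) \<Rightarrow> (nat \<Rightarrow> complex) \<Rightarrow> nat set" where
  "joint_support a b = dirichlet_support a \<union> dirichlet_support b"

text \<open>
  In logarithmic coordinates the derivatives up to order two of the difference of the lifts at \<open>z\<close>
  are the moments of the coefficients \<open>gap D a b z n\<close> against the exponents of \<open>n\<close>.
\<close>

definition moments_vanish :: "nat \<Rightarrow> (nat \<Rightarrow> complex) \<Rightarrow> (nat \<Rightarrow> complex) \<Rightarrow> (nat \<Rightarrow> complex) \<Rightarrow> bool" where
  "moments_vanish D a b z \<longleftrightarrow>
     (\<Sum>n\<in>joint_support a b. gap D a b z n) = 0 \<and>
     (\<forall>j<D. (\<Sum>n\<in>joint_support a b. gap D a b z n * of_nat (multiplicity (nth_prime j) n)) = 0) \<and>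
     (\<forall>j<D. \<forall>k<D. (\<Sum>n\<in>joint_support a b. gap D a b z n *
        (of_nat (multiplicity (nth_prime j) n) * of_nat (multiplicity (nth_prime k) n))) = 0)"

lemma joint_support_commute: "joint_support a b = joint_support b a"
  by (auto simp: joint_support_def)

lemma gap_commute: "gap D b a z n = - gap D a b z n"
  by (simp add: gap_def algebra_simps)

lemma moments_vanish_commute: "moments_vanish D a b z \<Longrightarrow> moments_vanish D b a z"
  unfolding moments_vanish_def joint_support_commute[of b a] gap_commute[of D b a]
  by (auto simp: sum_negf)

lemma sum_over_joint_support:
  fixes a b :: "nat \<Rightarrow> complex"
  assumes "finite (dirichlet_support a)" "finite (dirichlet_support b)"
  shows "(\<Sum>n\<in>dirichlet_support a. a n * h n) - (\<Sum>n\<in>dirichlet_support b. b n * h n) =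
    (\<Sum>n\<in>joint_support a b. (a n - b n) * h n)"
proof -
  have "(\<Sum>n\<in>dirichlet_support a. a n * h n) = (\<Sum>n\<in>joint_support a b. a n * h n)"
    "(\<Sum>n\<in>dirichlet_support b. b n * h n) = (\<Sum>n\<in>joint_support a b. b n * h n)"
    using assms by (auto intro!: sum.mono_neutral_left simp: joint_support_def dirichlet_support_def)
  then show ?thesis by (simp add: left_diff_distrib sum_subtractf)
qed

lemma bohr_lift_diff:
  assumes "finite (dirichlet_support a)" "finite (dirichlet_support b)" "bohr_dim a \<le> D" "bohr_dim b \<le> D"
  shows "bohr_lift a z - bohr_lift b z = (\<Sum>n\<in>joint_support a b. gap D a b z n)"
  using sum_over_joint_support[OF assms(1,2), of "monom_at D z"] assms
  by (simp add: bohr_lift_eq_ge gap_def)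

lemma norm_cis_Taylor2: "norm (cis A - (1 + \<i> * of_real A - of_real (A\<^sup>2 / 2))) \<le> \<bar>A\<bar> ^ 3"
proof -
  have "(\<Sum>k\<le>2. w ^ k / fact k) = 1 + w + w\<^sup>2 / 2" for w :: complex
    by (simp add: eval_nat_numeral fact_numeral)
  from this[of "\<i> * of_real A"]
  have eq: "(\<Sum>k\<le>2. (\<i> * of_real A) ^ k / fact k) = 1 + \<i> * of_real A - of_real (A\<^sup>2 / 2)"
    by (rule trans) (simp add: power_mult_distrib)
  have "norm (cis A - (1 + \<i> * of_real A - of_real (A\<^sup>2 / 2))) \<le> \<bar>A\<bar> ^ 3 / 2"
    using Taylor_exp[of "\<i> * of_real A" 2] unfolding eq
    by (simp add: cis_conv_exp norm_mult)
  also have "\<dots> \<le> \<bar>A\<bar> ^ 3" by simp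
  finally show ?thesis .
qed

text \<open>Contact recentred at \<open>z\<close>: only the displacement remains, and the choice of
  arguments drops out.\<close>

lemma dirichlet_contact_nearby:
  assumes contact: "dirichlet_contact c 1 z"
  obtains C r where "C > 0" "r > 0"
    "\<And>\<delta>. L2_set \<delta> {..<bohr_dim c} < r \<Longrightarrow>
        C * (\<Sum>j<bohr_dim c. (\<delta> j)\<^sup>2) \<le> Re (bohr_lift c (\<lambda>j. z j * cis (\<delta> j)))"
proof -
  obtain \<theta>0 C r where th: "\<And>j. j < bohr_dim c \<Longrightarrow> z j = cis (\<theta>0 j)" and "C > 0" "r > 0" and
    *: "\<And>\<theta>. L2_set (\<lambda>j. \<theta> j - \<theta>0 j) {..<bohr_dim c} < r \<Longrightarrow>
           J_fun c \<theta> \<ge> C * (\<Sum>j<bohr_dim c. (\<theta> j - \<theta>0 j)\<^sup>2) ^ 1"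
    using contact unfolding dirichlet_contact_def by blast
  have "C * (\<Sum>j<bohr_dim c. (\<delta> j)\<^sup>2) \<le> Re (bohr_lift c (\<lambda>j. z j * cis (\<delta> j)))"
    if "L2_set \<delta> {..<bohr_dim c} < r" for \<delta>
  proof -
    have "J_fun c (\<lambda>j. \<theta>0 j + \<delta> j) = Re (bohr_lift c (\<lambda>j. z j * cis (\<delta> j)))"
      unfolding J_fun_def by (intro arg_cong[where f = Re] bohr_lift_cong) (simp add: th cis_mult)
    then show ?thesis using *[of "\<lambda>j. \<theta>0 j + \<delta> j"] that by simp
  qed
  then show thesis using that \<open>C > 0\<close> \<open>r > 0\<close> by blast
qed

text \<open>In the sum over \<open>n\<close> the vanishing moments cancel the Taylor terms of order
  0, 1 and 2 of \<open>cis (A n)\<close>, where \<open>A n\<close> is linear in the displacement;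
  Cauchy-Schwarz bounds \<open>A n\<close> by the length of the displacement.\<close>

lemma lift_difference_cubic:
  assumes fin: "finite (dirichlet_support a)" "finite (dirichlet_support b)" "bohr_dim a \<le> D" "bohr_dim b \<le> D"
    and mom: "moments_vanish D a b z"
  obtains M where "M \<ge> 0" "\<And>\<delta>. norm (bohr_lift a (\<lambda>j. z j * cis (\<delta> j)) - bohr_lift b (\<lambda>j. z j * cis (\<delta> j)))
     \<le> M * (L2_set \<delta> {..<D}) ^ 3"
proof
  define U where "U = joint_support a b"
  define g where "g = gap D a b z"
  define m where "m = (\<lambda>n j. real (multiplicity (nth_prime j) n))"
  define N where "N = (\<lambda>n. L2_set (m n) {..<D})"
  define M where "M = (\<Sum>n\<in>U. norm (g n) * N n ^ 3)"
  show "M \<ge> 0" unfolding M_def N_def by (intro sum_nonneg) (simp add: L2_set_nonneg)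
  fix \<delta> :: "nat \<Rightarrow> real"
  define A where "A = (\<lambda>n. \<Sum>j<D. \<delta> j * m n j)"
  have gU: "(\<Sum>n\<in>U. g n) = 0" "\<And>j. j < D \<Longrightarrow> (\<Sum>n\<in>U. g n * of_real (m n j)) = 0"
    "\<And>j k. j < D \<Longrightarrow> k < D \<Longrightarrow> (\<Sum>n\<in>U. g n * of_real (m n j * m n k)) = 0"
    using mom by (auto simp: moments_vanish_def U_def g_def m_def)
  have "(\<Sum>n\<in>U. g n * of_real (A n)) = (\<Sum>j<D. of_real (\<delta> j) * (\<Sum>n\<in>U. g n * of_real (m n j)))"
    unfolding A_def of_real_sum sum_distrib_left by (subst sum.swap) (simp add: mult_ac)
  also have "\<dots> = 0" by (simp add: gU)
  finally have g1: "(\<Sum>n\<in>U. g n * of_real (A n)) = 0" .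
  have "(\<Sum>n\<in>U. g n * of_real ((A n)\<^sup>2)) =
      (\<Sum>j<D. \<Sum>k<D. of_real (\<delta> j * \<delta> k) * (\<Sum>n\<in>U. g n * of_real (m n j * m n k)))"
  proof -
    have "g n * of_real ((A n)\<^sup>2) = (\<Sum>j<D. \<Sum>k<D. of_real (\<delta> j * \<delta> k) * (g n * of_real (m n j * m n k)))" for n
    proof -
      have "(A n)\<^sup>2 = (\<Sum>j<D. \<Sum>k<D. (\<delta> j * m n j) * (\<delta> k * m n k))"
        by (simp add: A_def power2_eq_square sum_product)
      then show ?thesis by (simp add: sum_distrib_left mult_ac)
    qed
    then have "(\<Sum>n\<in>U. g n * of_real ((A n)\<^sup>2)) =
        (\<Sum>n\<in>U. \<Sum>j<D. \<Sum>k<D. of_real (\<delta> j * \<delta> k) * (g n * of_real (m n j * m n k)))" by simp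
    also have "\<dots> = (\<Sum>j<D. \<Sum>n\<in>U. \<Sum>k<D. of_real (\<delta> j * \<delta> k) * (g n * of_real (m n j * m n k)))"
      by (rule sum.swap)
    also have "\<dots> = (\<Sum>j<D. \<Sum>k<D. \<Sum>n\<in>U. of_real (\<delta> j * \<delta> k) * (g n * of_real (m n j * m n k)))"
      by (intro sum.cong refl sum.swap)
    finally show ?thesis by (simp only: sum_distrib_left)
  qed
  also have "\<dots> = 0" by (simp add: gU(3) del: of_real_mult)
  finally have g2: "(\<Sum>n\<in>U. g n * of_real ((A n)\<^sup>2)) = 0" .
  have "bohr_lift a (\<lambda>j. z j * cis (\<delta> j)) - bohr_lift b (\<lambda>j. z j * cis (\<delta> j)) = (\<Sum>n\<in>U. g n * cis (A n))"
    unfolding bohr_lift_diff[OF fin] U_def g_def gap_def monom_at_mult monom_at_cis A_def m_def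
    by (simp add: mult.assoc)
  also have "\<dots> = (\<Sum>n\<in>U. g n * (cis (A n) - (1 + \<i> * of_real (A n) - of_real ((A n)\<^sup>2 / 2))))"
  proof -
    have "(\<Sum>n\<in>U. g n * (cis (A n) - (1 + \<i> * of_real (A n) - of_real ((A n)\<^sup>2 / 2)))) =
      (\<Sum>n\<in>U. g n * cis (A n)) - (\<Sum>n\<in>U. g n) - \<i> * (\<Sum>n\<in>U. g n * of_real (A n)) + (\<Sum>n\<in>U. g n * of_real ((A n)\<^sup>2)) / 2"
      by (simp add: algebra_simps sum.distrib sum_subtractf sum_distrib_left sum_divide_distrib)
    then show ?thesis by (simp only: g1 g2 gU(1)) simp
  qed
  also have "norm \<dots> \<le> (\<Sum>n\<in>U. norm (g n) * (N n ^ 3 * (L2_set \<delta> {..<D}) ^ 3))"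
  proof (rule sum_norm_le)
    fix n
    have "\<bar>A n\<bar> \<le> (\<Sum>j<D. \<bar>\<delta> j\<bar> * \<bar>m n j\<bar>)"
      unfolding A_def by (rule order_trans[OF sum_abs]) (simp add: abs_mult)
    also have "\<dots> \<le> L2_set \<delta> {..<D} * N n" unfolding N_def by (rule L2_set_mult_ineq)
    finally have "\<bar>A n\<bar> ^ 3 \<le> (L2_set \<delta> {..<D} * N n) ^ 3" by (intro power_mono) auto
    then have "norm (cis (A n) - (1 + \<i> * of_real (A n) - of_real ((A n)\<^sup>2 / 2))) \<le> N n ^ 3 * (L2_set \<delta> {..<D}) ^ 3"
      using norm_cis_Taylor2[of "A n"] by (simp add: power_mult_distrib mult.commute)
    then show "norm (g n * (cis (A n) - (1 + \<i> * of_real (A n) - of_real ((A n)\<^sup>2 / 2)))) \<le> norm (g n) * (N n ^ 3 * (L2_set \<delta> {..<D}) ^ 3)"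
      unfolding norm_mult by (rule mult_left_mono) simp
  qed
  also have "\<dots> = M * (L2_set \<delta> {..<D}) ^ 3"
    by (simp add: M_def sum_distrib_right mult.assoc)
  finally show "norm (bohr_lift a (\<lambda>j. z j * cis (\<delta> j)) - bohr_lift b (\<lambda>j. z j * cis (\<delta> j))) \<le> M * (L2_set \<delta> {..<D}) ^ 3" .
qed

lemma norm_bohr_lift_le:
  assumes "\<And>j. norm (z j) \<le> 1"
  shows "norm (bohr_lift c z) \<le> (\<Sum>n\<in>dirichlet_support c. norm (c n))"
proof -
  have "norm (monom_at D z n) \<le> 1" for D n
    unfolding monom_at_def prod_norm[symmetric]
    by (intro prod_le_1) (auto simp: norm_power assms power_le_one)
  then show ?thesis unfolding bohr_lift_eq
    by (intro sum_norm_le) (simp add: norm_mult mult_left_le)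
qed

text \<open>By contradiction and compactness. Along violating points the real part tends to 0, since
  the difference is bounded, so they accumulate at a zero of the real part on the torus. There the
  real part is at least \<open>C * \<sigma>\<^sup>2\<close> and the difference at most
  \<open>N * \<sigma> ^ 3\<close>; the exponents match because both
  \<open>(\<sigma> ^ 3)\<^sup>2\<close> and \<open>(\<sigma>\<^sup>2) ^ 3\<close> are
  \<open>\<sigma> ^ 6\<close>. An empty zero set is covered by the same argument.\<close>

lemma contact_inequality:
  assumes fin: "finite (dirichlet_support a)" "finite (dirichlet_support b)"
    and pos: "\<And>t. Re (dpoly (dirichlet_support a) a (\<i> * of_real t)) \<ge> 0"
    and G: "\<And>z. z \<in> Gamma_set a \<Longrightarrow> dirichlet_contact a 1 z \<and> bohr_dim b \<le> bohr_dim a \<and> moments_vanish (bohr_dim a) a b z"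
  shows "\<exists>C\<ge>0. \<forall>t. (cmod (dpoly (dirichlet_support a) a (\<i> * of_real t) - dpoly (dirichlet_support b) b (\<i> * of_real t)))\<^sup>2
      \<le> C * (Re (dpoly (dirichlet_support a) a (\<i> * of_real t))) ^ 3"
proof (rule ccontr)
  define d where "d = bohr_dim a"
  define h where "h = (\<lambda>t. Re (dpoly (dirichlet_support a) a (\<i> * of_real t)))"
  define \<Delta> where "\<Delta> = (\<lambda>t. dpoly (dirichlet_support a) a (\<i> * of_real t) - dpoly (dirichlet_support b) b (\<i> * of_real t))"
  assume "\<not> ?thesis"
  then have "\<forall>k::nat. \<exists>t. (cmod (\<Delta> t))\<^sup>2 > real k * h t ^ 3"
    unfolding h_def \<Delta>_def by (metis not_le of_nat_0_le_iff)
  then obtain t where t: "\<And>k. (cmod (\<Delta> (t k)))\<^sup>2 > real k * h (t k) ^ 3" by metis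
  have h0: "h s \<ge> 0" for s using pos by (simp add: h_def)
  define zs where "zs = (\<lambda>k j. dterm (nth_prime j) (\<i> * of_real (t k)))"
  have nzs: "norm (zs k j) = 1" for k j by (simp add: zs_def norm_dterm)
  obtain r z' where r: "strict_mono (r :: nat \<Rightarrow> nat)" and z': "\<And>j. (\<lambda>k. zs (r k) j) \<longlonglongrightarrow> z' j"
    using pointwise_convergent_subseq[of zs] nzs by (metis order_refl)
  have nz': "norm (z' j) = 1" for j
    using LIMSEQ_unique[OF tendsto_norm[OF z'[of j]]] nzs by simp
  \<comment> \<open>The limit is cut to the first \<open>d\<close> coordinates and padded by 0, the
    convention of \<open>torus\<close>.\<close>
  define z where "z = (\<lambda>j. if j < d then z' j else 0)"
  have zt: "z \<in> torus d" by (simp add: torus_def z_def nz')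
  have la: "bohr_lift a (zs k) = dpoly (dirichlet_support a) a (\<i> * of_real (t k))"
    and lb: "bohr_lift b (zs k) = dpoly (dirichlet_support b) b (\<i> * of_real (t k))" for k
    unfolding zs_def using bohr_lift_vertical fin by blast+
  have limh: "(\<lambda>k. h (t (r k))) \<longlonglongrightarrow> Re (bohr_lift a z)"
    unfolding h_def la[symmetric]
    by (intro tendsto_Re tendsto_bohr_lift) (use z' in \<open>auto simp: z_def d_def\<close>)
  define M where "M = ((\<Sum>n\<in>dirichlet_support a. norm (a n)) + (\<Sum>n\<in>dirichlet_support b. norm (b n)))\<^sup>2"
  have DM: "(cmod (\<Delta> (t k)))\<^sup>2 \<le> M" for k
  proof -
    have "cmod (\<Delta> (t k)) \<le> (\<Sum>n\<in>dirichlet_support a. norm (a n)) + (\<Sum>n\<in>dirichlet_support b. norm (b n))"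
      unfolding \<Delta>_def la[symmetric] lb[symmetric]
      by (intro norm_triangle_le_diff add_mono norm_bohr_lift_le) (simp_all add: nzs)
    then show ?thesis unfolding M_def by (intro power_mono) auto
  qed
  have "(\<lambda>k. h (t (r k)) ^ 3) \<longlonglongrightarrow> 0"
  proof (rule tendsto_sandwich)
    show "\<forall>\<^sub>F k in sequentially. 0 \<le> h (t (r k)) ^ 3" by (simp add: h0)
    have "h (t (r k)) ^ 3 \<le> M / real k" if "k > 0" for k
    proof -
      have "real k * h (t (r k)) ^ 3 \<le> real (r k) * h (t (r k)) ^ 3"
        using seq_suble[OF r, of k] h0 by (intro mult_right_mono) auto
      then have "real k * h (t (r k)) ^ 3 \<le> M" using t[of "r k"] DM[of "r k"] by linarith
      then show ?thesis using that by (simp add: field_simps)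
    qed
    then show "\<forall>\<^sub>F k in sequentially. h (t (r k)) ^ 3 \<le> M / real k"
      by (intro eventually_mono[OF eventually_gt_at_top[of 0]])
    show "(\<lambda>k. M / real k) \<longlonglongrightarrow> 0" by (rule lim_const_over_n)
  qed auto
  moreover have "(\<lambda>k. h (t (r k)) ^ 3) \<longlonglongrightarrow> Re (bohr_lift a z) ^ 3"
    by (intro tendsto_power limh)
  ultimately have "Re (bohr_lift a z) ^ 3 = 0" using LIMSEQ_unique by blast
  then have zG: "z \<in> Gamma_set a" using zt by (simp add: Gamma_set_def d_def)
  have contact: "dirichlet_contact a 1 z" and db: "bohr_dim b \<le> d" and mom: "moments_vanish d a b z"
    using G[OF zG] by (auto simp: d_def)
  obtain C \<rho> where C: "C > 0" "\<rho> > 0" and near: "\<And>\<delta>. L2_set \<delta> {..<d} < \<rho> \<Longrightarrow>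
        C * (\<Sum>j<d. (\<delta> j)\<^sup>2) \<le> Re (bohr_lift a (\<lambda>j. z j * cis (\<delta> j)))"
    using dirichlet_contact_nearby[OF contact] unfolding d_def by metis
  obtain N where N: "N \<ge> 0" and cubic: "\<And>\<delta>. norm (bohr_lift a (\<lambda>j. z j * cis (\<delta> j)) - bohr_lift b (\<lambda>j. z j * cis (\<delta> j)))
     \<le> N * (L2_set \<delta> {..<d}) ^ 3"
    using lift_difference_cubic[OF fin _ db mom] unfolding d_def by blast
  \<comment> \<open>The angular displacement from the limit point; it tends to 0 because
    \<open>Arg\<close> is continuous at 1.\<close>
  define \<delta> where "\<delta> = (\<lambda>k j. Arg (zs (r k) j / z' j))"
  have cis\<delta>: "z' j * cis (\<delta> k j) = zs (r k) j" for k j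
  proof -
    have "norm (zs (r k) j / z' j) = 1" by (simp add: norm_divide nzs nz')
    then have "cis (\<delta> k j) = zs (r k) j / z' j"
      by (simp add: \<delta>_def complex_norm_eq_1_exp_eq cis_conv_exp)
    then show ?thesis using nz'[of j] by auto
  qed
  have lim\<delta>: "(\<lambda>k. \<delta> k j) \<longlonglongrightarrow> 0" for j
  proof -
    have "z' j \<noteq> 0" using nz'[of j] by auto
    then have "(\<lambda>k. zs (r k) j / z' j) \<longlonglongrightarrow> 1"
      using tendsto_divide[OF z'[of j] tendsto_const, of "z' j"] by simp
    moreover have "isCont Arg 1" by (rule continuous_at_Arg) simp
    ultimately show ?thesis unfolding \<delta>_def using isCont_tendsto_compose[of 1 Arg] by fastforce
  qed
  have "(\<lambda>k. L2_set (\<delta> k) {..<d}) \<longlonglongrightarrow> sqrt (\<Sum>j<d. 0\<^sup>2)"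
    unfolding L2_set_def by (intro tendsto_intros lim\<delta>)
  then have "\<forall>\<^sub>F k in sequentially. L2_set (\<delta> k) {..<d} < \<rho>"
    by (rule order_tendstoD) (use C in simp)
  moreover have "\<forall>\<^sub>F k in sequentially. N\<^sup>2 / C ^ 3 \<le> real k"
    using eventually_ge_at_top[of "nat \<lceil>N\<^sup>2 / C ^ 3\<rceil>"] by eventually_elim linarith
  ultimately have "\<forall>\<^sub>F k in sequentially. L2_set (\<delta> k) {..<d} < \<rho> \<and> N\<^sup>2 / C ^ 3 \<le> real k"
    by (rule eventually_conj)
  then obtain k where k: "L2_set (\<delta> k) {..<d} < \<rho>" "N\<^sup>2 / C ^ 3 \<le> real k"
    using eventually_happens trivial_limit_sequentially by blast
  define \<sigma> where "\<sigma> = L2_set (\<delta> k) {..<d}"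
  have \<sigma>: "\<sigma> \<ge> 0" "\<sigma>\<^sup>2 = (\<Sum>j<d. (\<delta> k j)\<^sup>2)"
    by (auto simp: \<sigma>_def L2_set_def sum_nonneg)
  have eqa: "bohr_lift a (\<lambda>j. z j * cis (\<delta> k j)) = bohr_lift a (zs (r k))"
    by (rule bohr_lift_cong) (simp add: z_def d_def cis\<delta>)
  have eqb: "bohr_lift b (\<lambda>j. z j * cis (\<delta> k j)) = bohr_lift b (zs (r k))"
    by (rule bohr_lift_cong) (use db in \<open>simp add: z_def d_def cis\<delta>\<close>)
  have 1: "C * \<sigma>\<^sup>2 \<le> h (t (r k))"
    using near[OF k(1)] unfolding eqa la h_def \<sigma>(2) by simp
  have 2: "cmod (\<Delta> (t (r k))) \<le> N * \<sigma> ^ 3"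
    using cubic[of "\<delta> k"] unfolding eqa eqb la lb \<Delta>_def \<sigma>_def .
  have "(cmod (\<Delta> (t (r k))))\<^sup>2 \<le> (N * \<sigma> ^ 3)\<^sup>2" using 2 by (intro power_mono) auto
  also have "\<dots> = N\<^sup>2 / C ^ 3 * (C * \<sigma>\<^sup>2) ^ 3"
    using C by (simp add: power_mult_distrib power_mult[symmetric] mult.commute)
  also have "\<dots> \<le> N\<^sup>2 / C ^ 3 * h (t (r k)) ^ 3"
    using C 1 by (intro mult_left_mono power_mono) auto
  also have "\<dots> \<le> real (r k) * h (t (r k)) ^ 3"
    using k(2) seq_suble[OF r, of k] h0 by (intro mult_right_mono) (auto intro: order_trans)
  finally show False using t[of "r k"] by simp
qed

text \<open>The padding by 0 reveals the dimension, as unimodular coordinates never vanish.\<close>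

lemma torus_dim_unique: "z \<in> torus d \<Longrightarrow> z \<in> torus d' \<Longrightarrow> d = d'"
  by (rule linorder_cases[of d d']) (force simp: torus_def)+

lemma compact_if_moments_vanish:
  assumes s0: "dirichlet_polynomial_symbol \<phi>0 c0 a" and s1: "dirichlet_polynomial_symbol \<phi>1 c0 b" and c0: "c0 \<ge> 1"
    and contact: "\<forall>z\<in>Gamma_set a. dirichlet_contact a 1 z" "\<forall>z\<in>Gamma_set b. dirichlet_contact b 1 z"
    and eq: "Gamma_set a = Gamma_set b"
    and mom: "\<forall>z\<in>Gamma_set a. moments_vanish (bohr_dim a) a b z"
  shows "compact_operator (\<lambda>f. composition_op \<phi>0 f - composition_op \<phi>1 f)"
proof -
  interpret symbol_pair \<phi>0 \<phi>1 c0 "dirichlet_support a" a "dirichlet_support b" b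
    using polynomial_symbol_of_dirichlet[OF s0 c0] polynomial_symbol_of_dirichlet[OF s1 c0]
    by (rule symbol_pair.intro)
  have fin: "finite (dirichlet_support a)" "finite (dirichlet_support b)"
    using p0.fin p1.fin by auto
  have dims: "bohr_dim a = bohr_dim b" if "z \<in> Gamma_set a" for z
    using that eq torus_dim_unique by (auto simp: Gamma_set_def)
  let ?h0 = "\<lambda>t. Re (dpoly (dirichlet_support a) a (\<i> * of_real t))"
  let ?h1 = "\<lambda>t. Re (dpoly (dirichlet_support b) b (\<i> * of_real t))"
  have eqs: "P0 t - P1 t = dpoly (dirichlet_support a) a (\<i> * of_real t) - dpoly (dirichlet_support b) b (\<i> * of_real t)"
    "Re (P0 t) = ?h0 t" "Re (P1 t) = ?h1 t" for t
    by (simp_all add: P0_def P1_def dsym_def)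
  have "\<exists>C\<ge>0. \<forall>t. (cmod (P0 t - P1 t))\<^sup>2 \<le> C * (Re (P0 t)) ^ 3"
    unfolding eqs
  proof (rule contact_inequality[OF fin])
    show "0 \<le> ?h0 t" for t by (rule p0.pos) simp
    show "dirichlet_contact a 1 z \<and> bohr_dim b \<le> bohr_dim a \<and> moments_vanish (bohr_dim a) a b z"
      if "z \<in> Gamma_set a" for z using that contact(1) mom dims by auto
  qed
  then obtain Ca where Ca: "Ca \<ge> 0" "\<And>t. (cmod (P0 t - P1 t))\<^sup>2 \<le> Ca * (Re (P0 t)) ^ 3" by blast
  have "\<exists>C\<ge>0. \<forall>t. (cmod (dpoly (dirichlet_support b) b (\<i> * of_real t) - dpoly (dirichlet_support a) a (\<i> * of_real t)))\<^sup>2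
      \<le> C * (?h1 t) ^ 3"
  proof (rule contact_inequality[OF fin(2,1)])
    show "0 \<le> ?h1 t" for t by (rule p1.pos) simp
    show "dirichlet_contact b 1 z \<and> bohr_dim a \<le> bohr_dim b \<and> moments_vanish (bohr_dim b) b a z"
      if "z \<in> Gamma_set b" for z
      using that contact(2) mom dims[of z] eq moments_vanish_commute[of "bohr_dim a" a b z] by auto
  qed
  then obtain Cb where Cb: "Cb \<ge> 0" "\<And>t. (cmod (P0 t - P1 t))\<^sup>2 \<le> Cb * (Re (P1 t)) ^ 3"
    unfolding eqs by (metis norm_minus_commute)
  show ?thesis
  proof (rule compact_difference_if_contact[of "max Ca Cb"])
    show "0 \<le> max Ca Cb" using Ca by simp
    fix t
    show "(cmod (P0 t - P1 t))\<^sup>2 \<le> max Ca Cb * min (Re (P0 t)) (Re (P1 t)) ^ 3"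
    proof (cases "Re (P0 t) \<le> Re (P1 t)")
      case True
      have "Ca * Re (P0 t) ^ 3 \<le> max Ca Cb * Re (P0 t) ^ 3"
        by (intro mult_right_mono) (simp_all add: Re_P0)
      then show ?thesis using Ca(2)[of t] True by (simp add: min_def)
    next
      case False
      have "Cb * Re (P1 t) ^ 3 \<le> max Ca Cb * Re (P1 t) ^ 3"
        by (intro mult_right_mono) (simp_all add: Re_P1)
      then show ?thesis using Cb(2)[of t] False by (simp add: min_def)
    qed
  qed
qed

section \<open>Mixed partial derivatives of Bohr lifts\<close>

text \<open>Exponents are kept apart from the index \<open>n\<close>: differentiation lowers them
  but leaves the index set fixed, so the class is closed under it.\<close>

definition multi_poly :: "nat \<Rightarrow> 'i set \<Rightarrow> ('i \<Rightarrow> complex) \<Rightarrow> ('i \<Rightarrow> nat \<Rightarrow> nat) \<Rightarrow> (nat \<Rightarrow> complex) \<Rightarrow> complex" where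
  "multi_poly D U c e z = (\<Sum>n\<in>U. c n * (\<Prod>j<D. z j ^ e n j))"

text \<open>The falling factorial. With truncated subtraction it is 0 as soon as
  \<open>k > m\<close>, which kills the terms whose exponent cannot be lowered that far.\<close>

definition falling :: "nat \<Rightarrow> nat \<Rightarrow> complex" where
  "falling m k = of_nat (\<Prod>l<k. m - l)"

lemma falling_simps [simp]: "falling m 0 = 1" "falling m (Suc k) = falling m k * of_nat (m - k)"
  by (simp_all add: falling_def)

lemma falling_eq_0: "m < k \<Longrightarrow> falling m k = 0"
  by (auto simp: falling_def intro!: bexI[of _ m])

lemma partial_deriv_multi_poly:
  assumes i: "i < D"
  shows "partial_deriv i (multi_poly D U c e) = multi_poly D U (\<lambda>n. c n * of_nat (e n i)) (\<lambda>n. (e n)(i := e n i - 1))"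
proof
  fix z
  have split: "(\<Prod>j<D. f j) = f i * (\<Prod>j\<in>{..<D} - {i}. f j)" for f :: "nat \<Rightarrow> complex"
    using i by (intro prod.remove) auto
  have eq: "multi_poly D U c e (z(i := w)) = (\<Sum>n\<in>U. c n * (w ^ e n i * (\<Prod>j\<in>{..<D} - {i}. z j ^ e n j)))" for w
    unfolding multi_poly_def split by (intro sum.cong refl arg_cong2[where f = "(*)"] prod.cong) auto
  have "((\<lambda>w. multi_poly D U c e (z(i := w))) has_field_derivative
      (\<Sum>n\<in>U. c n * (of_nat (e n i) * z i ^ (e n i - 1) * (\<Prod>j\<in>{..<D} - {i}. z j ^ e n j)))) (at (z i))"
    unfolding eq by (auto intro!: derivative_eq_intros sum.cong)
  then have "partial_deriv i (multi_poly D U c e) z =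
      (\<Sum>n\<in>U. c n * (of_nat (e n i) * z i ^ (e n i - 1) * (\<Prod>j\<in>{..<D} - {i}. z j ^ e n j)))"
    unfolding partial_deriv_def by (rule DERIV_imp_deriv)
  also have "\<dots> = multi_poly D U (\<lambda>n. c n * of_nat (e n i)) (\<lambda>n. (e n)(i := e n i - 1)) z"
    unfolding multi_poly_def split by (intro sum.cong refl) simp
  finally show "partial_deriv i (multi_poly D U c e) z =
     multi_poly D U (\<lambda>n. c n * of_nat (e n i)) (\<lambda>n. (e n)(i := e n i - 1)) z" .
qed

lemma iterated_partial_deriv_multi_poly:
  assumes i: "i < D"
  shows "(partial_deriv i ^^ k) (multi_poly D U c e) =
    multi_poly D U (\<lambda>n. c n * falling (e n i) k) (\<lambda>n. (e n)(i := e n i - k))"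
proof (induction k)
  case 0
  then show ?case by simp
next
  case (Suc k)
  show ?case
    unfolding funpow.simps o_apply Suc partial_deriv_multi_poly[OF i]
    by (intro arg_cong2[where f = "multi_poly D U"] ext) (auto simp: mult.assoc)
qed

lemma foldr_partial_deriv_multi_poly:
  assumes "distinct js" "set js \<subseteq> {..<D}"
  shows "foldr (\<lambda>j. partial_deriv j ^^ \<alpha> j) js (multi_poly D U c e) =
    multi_poly D U (\<lambda>n. c n * (\<Prod>j\<in>set js. falling (e n j) (\<alpha> j))) (\<lambda>n j. if j \<in> set js then e n j - \<alpha> j else e n j)"
  using assms
proof (induction js)
  case Nil
  then show ?case by simp
next
  case (Cons i js)
  then have i: "i < D" "i \<notin> set js" by auto
  have IH: "foldr (\<lambda>j. partial_deriv j ^^ \<alpha> j) js (multi_poly D U c e) =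
    multi_poly D U (\<lambda>n. c n * (\<Prod>j\<in>set js. falling (e n j) (\<alpha> j))) (\<lambda>n j. if j \<in> set js then e n j - \<alpha> j else e n j)"
    using Cons by simp
  show ?case
    unfolding foldr.simps o_apply IH iterated_partial_deriv_multi_poly[OF i(1)]
    using i by (intro arg_cong2[where f = "multi_poly D U"] ext) (auto simp: mult_ac)
qed

text \<open>Where no coordinate is 0, each lowered power is the original one divided by
  \<open>z j ^ \<alpha> j\<close>, so a derivative is a common nonzero factor times a
  falling-factorial moment of the terms.\<close>

lemma mixed_partial_multi_poly:
  assumes z: "\<And>j. j < D \<Longrightarrow> z j \<noteq> 0"
  shows "mixed_partial D \<alpha> (multi_poly D U c e) z =
    (\<Sum>n\<in>U. c n * (\<Prod>j<D. z j ^ e n j) * (\<Prod>j<D. falling (e n j) (\<alpha> j))) / (\<Prod>j<D. z j ^ \<alpha> j)"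
proof -
  have "mixed_partial D \<alpha> (multi_poly D U c e) z =
     (\<Sum>n\<in>U. c n * ((\<Prod>j<D. falling (e n j) (\<alpha> j)) * (\<Prod>j<D. z j ^ (e n j - \<alpha> j))))"
    unfolding mixed_partial_def
    by (subst foldr_partial_deriv_multi_poly)
      (auto simp: multi_poly_def atLeast0LessThan mult.assoc intro!: sum.cong prod.cong)
  also have "\<dots> = (\<Sum>n\<in>U. c n * (\<Prod>j<D. falling (e n j) (\<alpha> j) * z j ^ e n j / z j ^ \<alpha> j))"
  proof (intro sum.cong refl arg_cong2[where f = "(*)"])
    fix n
    have "falling (e n j) (\<alpha> j) * z j ^ (e n j - \<alpha> j) = falling (e n j) (\<alpha> j) * z j ^ e n j / z j ^ \<alpha> j" if "j < D" for j
      using z[OF that] falling_eq_0[of "e n j" "\<alpha> j"] by (cases "\<alpha> j \<le> e n j") (auto simp: power_diff)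
    then show "(\<Prod>j<D. falling (e n j) (\<alpha> j)) * (\<Prod>j<D. z j ^ (e n j - \<alpha> j)) =
        (\<Prod>j<D. falling (e n j) (\<alpha> j) * z j ^ e n j / z j ^ \<alpha> j)"
      unfolding prod.distrib[symmetric] by (intro prod.cong) auto
  qed
  also have "\<dots> = (\<Sum>n\<in>U. c n * (\<Prod>j<D. z j ^ e n j) * (\<Prod>j<D. falling (e n j) (\<alpha> j))) / (\<Prod>j<D. z j ^ \<alpha> j)"
    by (simp add: prod_dividef prod.distrib sum_divide_distrib mult_ac)
  finally show ?thesis .
qed

lemma bohr_lift_multi_poly:
  "bohr_lift c = multi_poly (bohr_dim c) (dirichlet_support c) c (\<lambda>n j. multiplicity (nth_prime j) n)"
  by (simp add: fun_eq_iff bohr_lift_def multi_poly_def)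

lemma mixed_partial_eq_iff:
  assumes fin: "finite (dirichlet_support a)" "finite (dirichlet_support b)" and dim: "bohr_dim b = bohr_dim a"
    and z: "z \<in> torus (bohr_dim a)"
  shows "mixed_partial (bohr_dim a) \<alpha> (bohr_lift a) z = mixed_partial (bohr_dim a) \<alpha> (bohr_lift b) z \<longleftrightarrow>
    (\<Sum>n\<in>joint_support a b. gap (bohr_dim a) a b z n * (\<Prod>j<bohr_dim a. falling (multiplicity (nth_prime j) n) (\<alpha> j))) = 0"
proof -
  define D where "D = bohr_dim a"
  define q where "q = (\<lambda>n. monom_at D z n * (\<Prod>j<D. falling (multiplicity (nth_prime j) n) (\<alpha> j)))"
  have z0: "z j \<noteq> 0" if "j < D" for j using z that by (auto simp: torus_def D_def)
  have "(\<Prod>j<D. z j ^ \<alpha> j) \<noteq> 0" using z0 by auto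
  moreover have "mixed_partial D \<alpha> (bohr_lift a) z = (\<Sum>n\<in>dirichlet_support a. a n * q n) / (\<Prod>j<D. z j ^ \<alpha> j)"
    unfolding bohr_lift_multi_poly D_def[symmetric]
    by (subst mixed_partial_multi_poly[OF z0]) (auto simp: q_def monom_at_def mult.assoc)
  moreover have "mixed_partial D \<alpha> (bohr_lift b) z = (\<Sum>n\<in>dirichlet_support b. b n * q n) / (\<Prod>j<D. z j ^ \<alpha> j)"
    unfolding bohr_lift_multi_poly dim D_def[symmetric]
    by (subst mixed_partial_multi_poly[OF z0]) (auto simp: q_def monom_at_def mult.assoc)
  ultimately have "mixed_partial D \<alpha> (bohr_lift a) z = mixed_partial D \<alpha> (bohr_lift b) z \<longleftrightarrow>
     (\<Sum>n\<in>dirichlet_support a. a n * q n) - (\<Sum>n\<in>dirichlet_support b. b n * q n) = 0"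
    by (simp only: divide_cancel_right right_minus_eq) simp
  also have "\<dots> \<longleftrightarrow> (\<Sum>n\<in>joint_support a b. (a n - b n) * q n) = 0"
    by (simp only: sum_over_joint_support[OF fin])
  finally show ?thesis by (simp add: D_def q_def gap_def mult.assoc)
qed

section \<open>Multi-indices of order at most two\<close>

lemma nat_sum_le_1_cases:
  fixes \<alpha> :: "nat \<Rightarrow> nat"
  assumes "(\<Sum>j<D. \<alpha> j) \<le> 1"
  shows "(\<forall>i<D. \<alpha> i = 0) \<or> (\<exists>j<D. \<forall>i<D. \<alpha> i = (if i = j then 1 else 0))"
proof (cases "\<forall>i<D. \<alpha> i = 0")
  case False
  then obtain j where j: "j < D" "\<alpha> j > 0" by auto
  have "(\<Sum>i<D. \<alpha> i) = \<alpha> j + (\<Sum>i\<in>{..<D} - {j}. \<alpha> i)" using j by (intro sum.remove) auto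
  then have "\<alpha> j = 1" "(\<Sum>i\<in>{..<D} - {j}. \<alpha> i) = 0" using j assms by linarith+
  then have "\<alpha> j = 1" "\<forall>i\<in>{..<D} - {j}. \<alpha> i = 0" by simp_all
  then show ?thesis using j by (intro disjI2 exI[of _ j]) auto
qed auto

lemma nat_sum_le_2_cases:
  fixes \<alpha> :: "nat \<Rightarrow> nat"
  assumes "(\<Sum>j<D. \<alpha> j) \<le> 2"
  obtains "\<forall>i<D. \<alpha> i = 0"
    | j where "j < D" "\<forall>i<D. \<alpha> i = (if i = j then 1 else 0)"
    | j k where "j < D" "k < D" "\<forall>i<D. \<alpha> i = (if i = j then 1 else 0) + (if i = k then 1 else 0)"
proof (cases "\<forall>i<D. \<alpha> i = 0")
  case False
  then obtain j where j: "j < D" "\<alpha> j > 0" by auto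
  \<comment> \<open>Lowering a positive entry by 1 reduces to order at most 1; \<open>j = k\<close>
    in the third case covers a repeated index.\<close>
  define \<beta> where "\<beta> = \<alpha>(j := \<alpha> j - 1)"
  have "(\<Sum>i<D. \<alpha> i) = \<alpha> j + (\<Sum>i\<in>{..<D} - {j}. \<alpha> i)" using j by (intro sum.remove) auto
  moreover have "(\<Sum>i<D. \<beta> i) = \<beta> j + (\<Sum>i\<in>{..<D} - {j}. \<beta> i)" using j by (intro sum.remove) auto
  moreover have "(\<Sum>i\<in>{..<D} - {j}. \<beta> i) = (\<Sum>i\<in>{..<D} - {j}. \<alpha> i)" by (intro sum.cong) (auto simp: \<beta>_def)
  ultimately have "(\<Sum>i<D. \<beta> i) \<le> 1" using j assms by (simp add: \<beta>_def)
  then consider "\<forall>i<D. \<beta> i = 0" | k where "k < D" "\<forall>i<D. \<beta> i = (if i = k then 1 else 0)"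
    using nat_sum_le_1_cases by blast
  then show thesis
  proof cases
    case 1
    then have "\<forall>i<D. \<alpha> i = (if i = j then 1 else 0)"
      using j by (auto simp: \<beta>_def split: if_splits)
    then show thesis using that(2) j(1) by blast
  next
    case (2 k)
    have "\<alpha> i = (if i = j then 1 else 0) + (if i = k then 1 else 0)" if "i < D" for i
      using 2(2)[rule_format, OF that] j by (auto simp: \<beta>_def split: if_splits)
    then show thesis using that(3) j(1) 2(1) by blast
  qed
qed (use that in blast)

lemma prod_single:
  fixes j D :: nat
  shows "j < D \<Longrightarrow> (\<Prod>i<D. if i = j then f i else 1) = (f j :: complex)"
  by (subst prod.remove[of "{..<D}" j]) (auto intro!: prod.neutral)

lemma prod_falling_1:
  fixes j D :: nat
  assumes "j < D" "\<forall>i<D. \<alpha> i = (if i = j then 1 else 0)"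
  shows "(\<Prod>i<D. falling (m i) (\<alpha> i)) = of_nat (m j)"
proof -
  have "(\<Prod>i<D. falling (m i) (\<alpha> i)) = (\<Prod>i<D. if i = j then of_nat (m i) else 1)"
    using assms(2) by (intro prod.cong) auto
  then show ?thesis by (simp only: prod_single[OF assms(1)])
qed

lemma prod_falling_2:
  fixes j D :: nat
  assumes "j < D" "k < D" "\<forall>i<D. \<alpha> i = (if i = j then 1 else 0) + (if i = k then 1 else 0)"
  shows "(\<Prod>i<D. falling (m i) (\<alpha> i)) = of_nat (m j) * of_nat (m k) - (if j = k then of_nat (m j) else 0)"
proof (cases "j = k")
  case True
  have "(\<Prod>i<D. falling (m i) (\<alpha> i)) = (\<Prod>i<D. if i = j then of_nat (m i) * of_nat (m i - 1) else 1)"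
    using assms(3) True by (intro prod.cong) (auto simp: numeral_2_eq_2)
  also have "\<dots> = of_nat (m j) * of_nat (m j - 1)" by (rule prod_single[OF assms(1)])
  also have "\<dots> = of_nat (m j) * of_nat (m j) - of_nat (m j)"
    by (cases "m j") (auto simp: algebra_simps)
  finally show ?thesis using True by simp
next
  case False
  have "(\<Prod>i<D. falling (m i) (\<alpha> i)) = (\<Prod>i<D. (if i = j then of_nat (m i) else 1) * (if i = k then of_nat (m i) else 1))"
    using assms(3) False by (intro prod.cong) auto
  then show ?thesis using False by (simp add: prod.distrib prod_single[OF assms(1)] prod_single[OF assms(2)])
qed

text \<open>Falling factorials of order two differ from products of exponents only by a first moment
  on the diagonal, \<open>m * (m - 1) = m * m - m\<close>, so the two systems of conditions are
  equivalent.\<close>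

lemma moments_vanish_iff_partials:
  assumes fin: "finite (dirichlet_support a)" "finite (dirichlet_support b)" and dim: "bohr_dim b = bohr_dim a"
    and z: "z \<in> torus (bohr_dim a)"
  shows "moments_vanish (bohr_dim a) a b z \<longleftrightarrow>
    bohr_lift a z = bohr_lift b z \<and>
    (\<forall>\<alpha> :: nat \<Rightarrow> nat. (\<Sum>j<bohr_dim a. \<alpha> j) \<le> 2 \<longrightarrow>
       mixed_partial (bohr_dim a) \<alpha> (bohr_lift a) z = mixed_partial (bohr_dim a) \<alpha> (bohr_lift b) z)"
proof -
  define D where "D = bohr_dim a"
  define g where "g = gap D a b z"
  define U where "U = joint_support a b"
  define m where "m = (\<lambda>n j. multiplicity (nth_prime j) n)"
  have "bohr_lift a z = bohr_lift b z \<longleftrightarrow> bohr_lift a z - bohr_lift b z = 0" by simp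
  also have "\<dots> \<longleftrightarrow> (\<Sum>n\<in>U. g n) = 0"
    by (subst bohr_lift_diff[OF fin, of D]) (auto simp: D_def dim U_def g_def)
  finally have val: "bohr_lift a z = bohr_lift b z \<longleftrightarrow> (\<Sum>n\<in>U. g n) = 0" .
  have part: "mixed_partial (bohr_dim a) \<alpha> (bohr_lift a) z = mixed_partial (bohr_dim a) \<alpha> (bohr_lift b) z \<longleftrightarrow>
     (\<Sum>n\<in>U. g n * (\<Prod>j<D. falling (m n j) (\<alpha> j))) = 0" for \<alpha>
    unfolding mixed_partial_eq_iff[OF assms] by (simp add: D_def U_def g_def m_def)
  have mom: "moments_vanish (bohr_dim a) a b z \<longleftrightarrow> (\<Sum>n\<in>U. g n) = 0 \<and>
     (\<forall>j<D. (\<Sum>n\<in>U. g n * of_nat (m n j)) = 0) \<and>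
     (\<forall>j<D. \<forall>k<D. (\<Sum>n\<in>U. g n * (of_nat (m n j) * of_nat (m n k))) = 0)"
    by (simp add: moments_vanish_def D_def U_def g_def m_def)
  have to_partials: "(\<Sum>n\<in>U. g n * (\<Prod>j<D. falling (m n j) (\<alpha> j))) = 0"
    if 0: "(\<Sum>n\<in>U. g n) = 0" and 1: "\<forall>j<D. (\<Sum>n\<in>U. g n * of_nat (m n j)) = 0"
      and 2: "\<forall>j<D. \<forall>k<D. (\<Sum>n\<in>U. g n * (of_nat (m n j) * of_nat (m n k))) = 0"
      and s: "(\<Sum>j<D. \<alpha> j) \<le> 2" for \<alpha> :: "nat \<Rightarrow> nat"
  proof -
    from s show "(\<Sum>n\<in>U. g n * (\<Prod>j<D. falling (m n j) (\<alpha> j))) = 0"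
    proof (cases rule: nat_sum_le_2_cases)
      case 1
      then show ?thesis using 0 by simp
    next
      case (2 j)
      then show ?thesis using 1 by (simp add: prod_falling_1)
    next
      case (3 j k)
      have "(\<Sum>n\<in>U. g n * (\<Prod>j<D. falling (m n j) (\<alpha> j))) =
        (\<Sum>n\<in>U. g n * (of_nat (m n j) * of_nat (m n k))) - (if j = k then \<Sum>n\<in>U. g n * of_nat (m n j) else 0)"
        by (simp add: prod_falling_2[OF 3] right_diff_distrib sum_subtractf)
      then show ?thesis using 1 2 3 by simp
    qed
  qed
  have from_partials: "(\<forall>j<D. (\<Sum>n\<in>U. g n * of_nat (m n j)) = 0) \<and>
      (\<forall>j<D. \<forall>k<D. (\<Sum>n\<in>U. g n * (of_nat (m n j) * of_nat (m n k))) = 0)"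
    if all: "\<forall>\<alpha>. (\<Sum>j<D. \<alpha> j) \<le> 2 \<longrightarrow> (\<Sum>n\<in>U. g n * (\<Prod>j<D. falling (m n j) (\<alpha> j))) = 0"
  proof (intro conjI allI impI)
    have one: "(\<Sum>n\<in>U. g n * of_nat (m n j)) = 0" if j: "j < D" for j
    proof -
      define \<alpha> :: "nat \<Rightarrow> nat" where "\<alpha> = (\<lambda>i. if i = j then 1 else 0)"
      have "(\<Sum>i<D. \<alpha> i) \<le> 2" using j by (simp add: \<alpha>_def)
      moreover have "(\<Prod>i<D. falling (m n i) (\<alpha> i)) = of_nat (m n j)" for n
        by (rule prod_falling_1[OF j]) (simp add: \<alpha>_def)
      ultimately show ?thesis using all by fastforce
    qed
    then show "(\<Sum>n\<in>U. g n * of_nat (m n j)) = 0" if "j < D" for j using that .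
    fix j k assume jk: "j < D" "k < D"
    define \<alpha> :: "nat \<Rightarrow> nat" where "\<alpha> = (\<lambda>i. (if i = j then 1 else 0) + (if i = k then 1 else 0))"
    have "(\<Sum>i<D. \<alpha> i) \<le> 2" using jk by (simp add: \<alpha>_def sum.distrib)
    then have "(\<Sum>n\<in>U. g n * (\<Prod>j<D. falling (m n j) (\<alpha> j))) = 0" using all by blast
    moreover have "(\<Prod>i<D. falling (m n i) (\<alpha> i)) = of_nat (m n j) * of_nat (m n k) - (if j = k then of_nat (m n j) else 0)" for n
      by (rule prod_falling_2[OF jk]) (simp add: \<alpha>_def)
    ultimately have "(\<Sum>n\<in>U. g n * (of_nat (m n j) * of_nat (m n k))) - (if j = k then \<Sum>n\<in>U. g n * of_nat (m n j) else 0) = 0"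
      by (simp add: right_diff_distrib sum_subtractf split: if_splits)
    then show "(\<Sum>n\<in>U. g n * (of_nat (m n j) * of_nat (m n k))) = 0" using one[OF jk(1)] by (simp split: if_splits)
  qed
  show ?thesis
    unfolding D_def[symmetric] mom[folded D_def] val part[folded D_def] using to_partials from_partials by blast
qed

section \<open>Reproducing kernels over smooth numbers\<close>

lemma cnj_dterm: "cnj (dterm n w) = dterm n (cnj w)"
  by (simp add: dterm_def exp_cnj)

lemma smooth_0: "smooth 0 = {1}"
  using prime_factor_nat by (fastforce simp: smooth_def)

lemma nth_prime_in_smooth: "nth_prime D \<in> smooth (Suc D)"
  using nth_prime_prime[of D] by (auto simp: smooth_def dest: primes_dvd_imp_eq)

text \<open>Splits off the exact power of the next prime; this is the induction step of the Euler
  product.\<close>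

lemma bij_betw_smooth_Suc:
  "bij_betw (\<lambda>(k, n). nth_prime D ^ k * n) (UNIV \<times> smooth D) (smooth (Suc D))"
proof -
  define p where "p = nth_prime D"
  have p: "prime p" by (simp add: p_def nth_prime_prime)
  have mult: "multiplicity p (p ^ k * n) = k" if "n \<in> smooth D" for k n
    using smooth_multiplicity_eq_0[OF that, of D] smooth_pos[OF that] p
    by (simp add: p_def prime_elem_multiplicity_mult_distrib prime_elem_multiplicity_power_distrib)
  have "inj_on (\<lambda>(k, n). p ^ k * n) (UNIV \<times> smooth D)"
  proof (rule inj_onI, clarify)
    fix k n k' n' assume *: "n \<in> smooth D" "n' \<in> smooth D" "p ^ k * n = p ^ k' * n'"
    then have "k = k'" using mult by metis
    then show "k = k' \<and> n = n'" using * p by (auto simp: prime_gt_0_nat)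
  qed
  moreover have "(\<lambda>(k, n). p ^ k * n) ` (UNIV \<times> smooth D) = smooth (Suc D)"
  proof (intro equalityI subsetI)
    fix x assume "x \<in> (\<lambda>(k, n). p ^ k * n) ` (UNIV \<times> smooth D)"
    then obtain k n where "x = p ^ k * n" "n \<in> smooth D" by auto
    moreover have "p ^ k \<in> smooth (Suc D)" unfolding p_def
      by (intro mult_monoid_power[OF mult_monoid_smooth] nth_prime_in_smooth)
    moreover have "smooth D \<subseteq> smooth (Suc D)" by (rule smooth_mono) simp
    ultimately show "x \<in> smooth (Suc D)" using mult_monoid_smooth by (auto simp: mult_monoid_def)
  next
    fix x assume "x \<in> smooth (Suc D)"
    from smooth_factorization[OF this]
    have "x = p ^ multiplicity p x * (\<Prod>j<D. nth_prime j ^ multiplicity (nth_prime j) x)"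
      by (simp add: p_def mult.commute)
    then have "x = (\<lambda>(k, n). p ^ k * n) (multiplicity p x, \<Prod>j<D. nth_prime j ^ multiplicity (nth_prime j) x)" by simp
    then show "x \<in> (\<lambda>(k, n). p ^ k * n) ` (UNIV \<times> smooth D)"
      by (rule image_eqI) (simp add: prod_nth_prime_smooth)
  qed
  ultimately show ?thesis by (simp add: bij_betw_def p_def)
qed

text \<open>The value field is general because the product serves both the complex terms
  \<open>dterm n u\<close> and real exponentials such as their squared moduli.\<close>

lemma euler_product:
  fixes h :: "nat \<Rightarrow> 'a::{banach, real_normed_field}"
  assumes one: "h 1 = 1" and mult: "\<And>m n. m > 0 \<Longrightarrow> n > 0 \<Longrightarrow> h (m * n) = h m * h n"
    and small: "\<And>j. j < D \<Longrightarrow> norm (h (nth_prime j)) < 1"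
  shows "(h has_sum (\<Prod>j<D. 1 / (1 - h (nth_prime j)))) (smooth D) \<and> (\<lambda>n. norm (h n)) summable_on smooth D"
  using small
proof (induction D)
  case 0
  then show ?case using one by (auto simp: smooth_0 intro!: has_sum_finiteI)
next
  case (Suc D)
  define w where "w = h (nth_prime D)"
  have w: "norm w < 1" using Suc.prems by (simp add: w_def)
  have pow: "h (nth_prime D ^ k) = w ^ k" for k
    by (induction k) (use one in \<open>auto simp: mult w_def\<close>)
  have geo: "((\<lambda>k. w ^ k) has_sum 1 / (1 - w)) UNIV"
    using w by (intro norm_summable_imp_has_sum geometric_sums) (auto simp: norm_power summable_geometric)
  have geo': "(\<lambda>k. norm (w ^ k)) summable_on UNIV"
    using w by (intro norm_summable_imp_summable_on) (simp add: norm_power summable_geometric)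
  have IH: "(h has_sum (\<Prod>j<D. 1 / (1 - h (nth_prime j)))) (smooth D)" "(\<lambda>n. norm (h n)) summable_on smooth D"
    using Suc by auto
  have val: "h (nth_prime D ^ k * n) = w ^ k * h n" if "n \<in> smooth D" for k n
    using smooth_pos[OF that] by (simp add: mult pow)
  have "((\<lambda>(k, n). w ^ k * h n) has_sum (1 / (1 - w) * (\<Prod>j<D. 1 / (1 - h (nth_prime j))))) (UNIV \<times> smooth D)"
    by (rule has_sum_product[OF geo' IH(2) geo IH(1)])
  then have "((\<lambda>x. h (case x of (k, n) \<Rightarrow> nth_prime D ^ k * n)) has_sum (1 / (1 - w) * (\<Prod>j<D. 1 / (1 - h (nth_prime j))))) (UNIV \<times> smooth D)"
    by (rule has_sum_cong[THEN iffD1, rotated]) (auto simp: val)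
  then have "(h has_sum (1 / (1 - w) * (\<Prod>j<D. 1 / (1 - h (nth_prime j))))) (smooth (Suc D))"
    by (subst (asm) has_sum_reindex_bij_betw[OF bij_betw_smooth_Suc])
  then have 1: "(h has_sum (\<Prod>j<Suc D. 1 / (1 - h (nth_prime j)))) (smooth (Suc D))"
    by (simp add: w_def mult.commute)
  have "((\<lambda>(k, n). norm (w ^ k) * norm (h n)) has_sum (infsum (\<lambda>k. norm (w ^ k)) UNIV * infsum (\<lambda>n. norm (h n)) (smooth D))) (UNIV \<times> smooth D)"
    by (rule has_sum_product) (use geo' IH(2) in auto)
  then have "((\<lambda>x. norm (h (case x of (k, n) \<Rightarrow> nth_prime D ^ k * n))) has_sum (infsum (\<lambda>k. norm (w ^ k)) UNIV * infsum (\<lambda>n. norm (h n)) (smooth D))) (UNIV \<times> smooth D)"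
    by (rule has_sum_cong[THEN iffD1, rotated]) (auto simp: val norm_mult)
  then have "(\<lambda>n. norm (h n)) summable_on smooth (Suc D)"
    using has_sum_reindex_bij_betw[OF bij_betw_smooth_Suc, where f = "\<lambda>n. norm (h n)"] has_sum_imp_summable by blast
  with 1 show ?case by blast
qed

text \<open>The Euler product of the Riemann zeta function over the first \<open>D\<close> primes.
  Its real counterpart \<open>rzeta D (2 * Re w)\<close> is the squared norm of the kernel at
  \<open>w\<close>.\<close>

definition smooth_zeta :: "nat \<Rightarrow> complex \<Rightarrow> complex" where
  "smooth_zeta D u = (\<Prod>j<D. 1 / (1 - dterm (nth_prime j) u))"

definition rzeta :: "nat \<Rightarrow> real \<Rightarrow> real" where
  "rzeta D x = (\<Prod>j<D. 1 / (1 - exp (- (ln (real (nth_prime j)) * x))))"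

lemma ln_nth_prime_pos: "ln (real (nth_prime j)) > 0"
  using nth_prime_gt_1[of j] by simp

lemma has_sum_smooth_zeta:
  assumes "Re u > 0"
  shows "((\<lambda>n. dterm n u) has_sum smooth_zeta D u) (smooth D)"
  using euler_product[of "\<lambda>n. dterm n u" D] assms ln_nth_prime_pos
  by (simp add: dterm_mult norm_dterm smooth_zeta_def)

lemma has_sum_rzeta:
  assumes "x > 0"
  shows "((\<lambda>n. exp (- (ln (real n) * x))) has_sum rzeta D x) (smooth D)"
  using euler_product[of "\<lambda>n. exp (- (ln (real n) * x))" D] assms ln_nth_prime_pos
  by (simp add: rzeta_def ln_mult ring_distribs flip: exp_add)

lemma sums_point_eval_sq:
  assumes "Re s > 0"
  shows "(\<lambda>n. (cmod (point_eval (smooth D) s n))\<^sup>2) sums rzeta D (2 * Re s)"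
proof -
  have "((\<lambda>n. exp (- (ln (real n) * (2 * Re s)))) has_sum rzeta D (2 * Re s)) (smooth D)"
    using assms by (intro has_sum_rzeta) simp
  then have "((\<lambda>n. (cmod (point_eval (smooth D) s n))\<^sup>2) has_sum rzeta D (2 * Re s)) UNIV"
    by (rule has_sum_cong_neutral[THEN iffD1, rotated -1])
      (auto simp: point_eval_def norm_dterm mult.left_commute simp flip: exp_of_nat_mult)
  then show ?thesis by (rule has_sum_imp_sums)
qed

lemma summable_point_eval:
  "Re s > 0 \<Longrightarrow> summable (\<lambda>n. (cmod (point_eval (smooth D) s n))\<^sup>2)"
  using sums_point_eval_sq sums_summable by blast

lemma l2norm_point_eval: "Re s > 0 \<Longrightarrow> l2norm (point_eval (smooth D) s) = sqrt (rzeta D (2 * Re s))"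
  using sums_unique[OF sums_point_eval_sq[of s D]] by (simp add: l2norm_def)

text \<open>The reproducing kernel at \<open>w\<close> of the subspace supported on
  \<open>smooth D\<close>; conjugation turns the bilinear functional into a hermitian inner
  product.\<close>

definition kernel :: "nat \<Rightarrow> complex \<Rightarrow> dirichlet_H" where
  "kernel D w = Abs_dirichlet_H (\<lambda>n. cnj (point_eval (smooth D) w n))"

lemma coeff_kernel:
  assumes "Re w > 0"
  shows "coeff_H (kernel D w) n = cnj (point_eval (smooth D) w n)"
proof -
  have "point_eval (smooth D) w 0 = 0" by (simp add: point_eval_def smooth_def)
  then show ?thesis
    using summable_point_eval[OF assms, of D] by (simp add: kernel_def Abs_dirichlet_H_inverse)
qed

lemma inner_kernel:
  assumes "Re w > 0"
  shows "inner f (kernel D w) = Re (pair_H f (point_eval (smooth D) w))"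
proof -
  have "summable (\<lambda>n. coeff_H f n * point_eval (smooth D) w n)"
    using summable_norm_cancel[OF summable_pair_H[OF summable_point_eval[OF assms]]] .
  from bounded_linear.suminf[OF bounded_linear_Re this] show ?thesis
    by (simp add: inner_dirichlet_H_def pair_H_def coeff_kernel[OF assms] inner_complex_def)
qed

lemma norm_kernel_sq: "Re w > 0 \<Longrightarrow> (norm (kernel D w))\<^sup>2 = rzeta D (2 * Re w)"
  using sums_unique[OF sums_point_eval_sq[of w D]]
  by (simp add: norm_H_eq_l2norm l2norm_def coeff_kernel suminf_nonneg summable_point_eval)

lemma pair_kernel:
  assumes "Re w > 0" "Re v > 0"
  shows "pair_H (kernel D w) (point_eval (smooth D) v) = smooth_zeta D (cnj w + v)"
proof -
  have "((\<lambda>n. dterm n (cnj w + v)) has_sum smooth_zeta D (cnj w + v)) (smooth D)"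
    using assms by (intro has_sum_smooth_zeta) simp
  then have "((\<lambda>n. coeff_H (kernel D w) n * point_eval (smooth D) v n) has_sum smooth_zeta D (cnj w + v)) UNIV"
    by (rule has_sum_cong_neutral[THEN iffD1, rotated -1])
      (auto simp: coeff_kernel assms point_eval_def dterm_add cnj_dterm)
  then show ?thesis unfolding pair_H_def using has_sum_imp_sums sums_unique by metis
qed

text \<open>In quotient form: \<open>1 - \<rho>\<^sup>2\<close> equals
  \<open>(1 - (cmod u)\<^sup>2) * (1 - (cmod v)\<^sup>2)\<close> over
  \<open>(cmod (1 - cnj u * v))\<^sup>2\<close>, where \<open>\<rho>\<close> is the pseudohyperbolic
  distance in the disc.\<close>

lemma pseudohyperbolic_identity:
  "(cmod (1 - cnj u * v))\<^sup>2 - (1 - (cmod u)\<^sup>2) * (1 - (cmod v)\<^sup>2) = (cmod (u - v))\<^sup>2"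
  unfolding cmod_power2 by (simp add: power2_eq_square algebra_simps)

lemma rzeta_pos: "x > 0 \<Longrightarrow> rzeta D x > 0"
  unfolding rzeta_def using ln_nth_prime_pos by (intro prod_pos) auto

text \<open>
  The kernels factor over the primes, and by the Cauchy-Schwarz inequality each factor of
  \<open>\<bar>\<langle>K\<^sub>w, K\<^sub>v\<rangle>\<bar>\<^sup>2 / (\<parallel>K\<^sub>w\<parallel>\<^sup>2 \<parallel>K\<^sub>v\<parallel>\<^sup>2)\<close> is at most \<open>1\<close>. Hence the distance of the kernels controls the
  pseudohyperbolic distance at every single prime.
\<close>

lemma kernel_distance:
  assumes w: "Re w > 0" and v: "Re v > 0" and i: "i < D"
  shows "(norm (kernel D w))\<^sup>2 * (cmod (dterm (nth_prime i) w - dterm (nth_prime i) v))\<^sup>2 \<le>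
    (norm (kernel D w - kernel D v))\<^sup>2 * (cmod (1 - cnj (dterm (nth_prime i) w) * dterm (nth_prime i) v))\<^sup>2"
proof -
  define U where "U = (\<lambda>j. dterm (nth_prime j) w)"
  define V where "V = (\<lambda>j. dterm (nth_prime j) v)"
  have nU: "cmod (U j) < 1" and nV: "cmod (V j) < 1" for j
    using w v ln_nth_prime_pos[of j] by (auto simp: U_def V_def norm_dterm)
  have U2: "1 - (cmod (U j))\<^sup>2 > 0" and V2: "1 - (cmod (V j))\<^sup>2 > 0" for j
    using nU[of j] nV[of j] by (auto simp: power_less_one_iff abs_square_less_1)
  define Q where "Q = (\<lambda>j. (cmod (1 - cnj (U j) * V j))\<^sup>2)"
  define N where "N = (\<lambda>j. (1 - (cmod (U j))\<^sup>2) * (1 - (cmod (V j))\<^sup>2))"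
  have QN: "Q j = N j + (cmod (U j - V j))\<^sup>2" for j
    using pseudohyperbolic_identity[of "U j" "V j"] by (simp add: Q_def N_def)
  have N0: "N j > 0" for j using U2 V2 by (simp add: N_def)
  then have Q0: "Q j > 0" for j unfolding QN by (simp add: add_pos_nonneg)
  \<comment> \<open>\<open>1 - R\<close> is the squared pseudohyperbolic distance at the prime of
    index \<open>i\<close>; the other primes contribute factors at most 1.\<close>
  define R where "R = N i / Q i"
  have R: "0 < R" "R \<le> 1" using N0[of i] Q0[of i] QN[of i] by (auto simp: R_def)
  define z0 where "z0 = rzeta D (2 * Re w)"
  define z1 where "z1 = rzeta D (2 * Re v)"
  have z0: "z0 > 0" and z1: "z1 > 0" using w v by (auto simp: z0_def z1_def rzeta_pos)
  have z0_prod: "z0 = (\<Prod>j<D. 1 / (1 - (cmod (U j))\<^sup>2))" and z1_prod: "z1 = (\<Prod>j<D. 1 / (1 - (cmod (V j))\<^sup>2))"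
    unfolding z0_def z1_def rzeta_def U_def V_def norm_dterm
    by (auto simp: mult.left_commute simp flip: exp_of_nat_mult)
  have "(cmod (smooth_zeta D (cnj w + v)))\<^sup>2 = (\<Prod>j<D. 1 / Q j)"
    unfolding smooth_zeta_def prod_norm[symmetric] prod_power_distrib Q_def
    by (intro prod.cong refl) (simp add: norm_divide power_divide dterm_add U_def V_def cnj_dterm)
  also have "\<dots> \<le> R * (\<Prod>j<D. 1 / N j)"
  proof -
    have split: "(\<Prod>j<D. f j) = f i * (\<Prod>j\<in>{..<D} - {i}. f j)" for f :: "nat \<Rightarrow> real"
      using i by (intro prod.remove) auto
    have "(\<Prod>j\<in>{..<D} - {i}. 1 / Q j) \<le> (\<Prod>j\<in>{..<D} - {i}. 1 / N j)"
    proof (intro prod_mono conjI)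
      show "1 / Q j \<le> 1 / N j" for j
        using N0[of j] QN[of j] by (intro divide_left_mono) (auto simp: add_pos_nonneg)
      show "0 \<le> 1 / Q j" for j using Q0[of j] by simp
    qed
    then have "1 / Q i * (\<Prod>j\<in>{..<D} - {i}. 1 / Q j) \<le> 1 / Q i * (\<Prod>j\<in>{..<D} - {i}. 1 / N j)"
      using Q0[of i] by (intro mult_left_mono) auto
    also have "\<dots> = R * (1 / N i * (\<Prod>j\<in>{..<D} - {i}. 1 / N j))"
      using N0[of i] by (simp add: R_def)
    finally show ?thesis unfolding split[of "\<lambda>j. 1 / Q j"] split[of "\<lambda>j. 1 / N j"] .
  qed
  also have "(\<Prod>j<D. 1 / N j) = z0 * z1"
    unfolding z0_prod z1_prod prod.distrib[symmetric] by (simp add: N_def)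
  finally have Z: "(cmod (smooth_zeta D (cnj w + v)))\<^sup>2 \<le> R * (z0 * z1)" .
  define P where "P = inner (kernel D w) (kernel D v)"
  have "P \<le> cmod (smooth_zeta D (cnj w + v))"
    unfolding P_def inner_kernel[OF v] pair_kernel[OF w v] by (rule complex_Re_le_cmod)
  also have "\<dots> \<le> sqrt (R * z0) * sqrt z1"
    using real_le_rsqrt[OF Z] by (simp add: real_sqrt_mult mult.assoc)
  finally have P: "P \<le> sqrt (R * z0) * sqrt z1" .
  have zs: "z0 = inner (kernel D w) (kernel D w)" "z1 = inner (kernel D v) (kernel D v)"
    unfolding z0_def z1_def norm_kernel_sq[OF w, symmetric] norm_kernel_sq[OF v, symmetric]
    by (rule power2_norm_eq_inner)+
  have "(norm (kernel D w - kernel D v))\<^sup>2 = z0 - 2 * P + z1"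
    unfolding power2_norm_eq_inner inner_diff_left inner_diff_right zs P_def inner_commute[of "kernel D v" "kernel D w"]
    by linarith
  \<comment> \<open>The arithmetic-geometric mean inequality eliminates \<open>z1\<close> and leaves
    \<open>z0 * (1 - R)\<close> as a lower bound for the squared distance.\<close>
  moreover have "0 \<le> (sqrt z1 - sqrt (R * z0))\<^sup>2" by simp
  then have "2 * (sqrt (R * z0) * sqrt z1) \<le> z1 + R * z0"
    using z1 z0 R by (simp add: power2_diff mult_ac)
  ultimately have "z0 * (1 - R) \<le> (norm (kernel D w - kernel D v))\<^sup>2"
    using P by (simp add: algebra_simps)
  then have "z0 * (1 - R) * Q i \<le> (norm (kernel D w - kernel D v))\<^sup>2 * Q i"
    using Q0[of i] by (intro mult_right_mono) auto
  moreover have "(1 - R) * Q i = (cmod (U i - V i))\<^sup>2"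
    using Q0[of i] QN[of i] by (simp add: R_def field_simps)
  ultimately show ?thesis
    by (simp add: norm_kernel_sq[OF w] z0_def Q_def U_def V_def mult.assoc)
qed

text \<open>Factor by factor, Bernoulli's inequality gives
  \<open>1 - q ^ V \<le> V * (1 - q)\<close>. This trades the kernel norm at \<open>s\<close> for
  the one at the image of \<open>s\<close>, whose real part is at most
  \<open>V * Re s\<close>.\<close>

lemma rzeta_compare:
  assumes x: "0 < x" and y: "0 < y" "y \<le> real V * x"
  shows "rzeta D x \<le> real V ^ D * rzeta D y"
proof -
  have factor: "1 / (1 - exp (- (l * x))) \<le> real V * (1 / (1 - exp (- (l * y))))" if l: "l > 0" for l :: real
  proof -
    define q where "q = exp (- (l * x))"
    have q: "0 < q" "q < 1" using l x by (auto simp: q_def)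
    have "1 + real V * (q - 1) \<le> (1 + (q - 1)) ^ V" by (rule Bernoulli_inequality) (use q in auto)
    then have "1 - q ^ V \<le> real V * (1 - q)" by (simp add: algebra_simps)
    moreover have "q ^ V \<le> exp (- (l * y))"
    proof -
      have "l * y \<le> real V * (l * x)" using mult_left_mono[OF y(2), of l] l by (simp add: mult_ac)
      then show ?thesis by (simp add: q_def flip: exp_of_nat_mult)
    qed
    ultimately have "1 - exp (- (l * y)) \<le> real V * (1 - q)" by linarith
    moreover have "1 - exp (- (l * y)) > 0" using l y by simp
    ultimately show ?thesis using q unfolding q_def[symmetric] by (simp add: field_simps)
  qed
  have "rzeta D x \<le> (\<Prod>j<D. real V * (1 / (1 - exp (- (ln (real (nth_prime j)) * y)))))"
    unfolding rzeta_def
  proof (intro prod_mono conjI factor ln_nth_prime_pos)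
    show "0 \<le> 1 / (1 - exp (- (ln (real (nth_prime j)) * x)))" for j
      using ln_nth_prime_pos[of j] x by simp
  qed
  then show ?thesis by (simp only: rzeta_def prod.distrib prod_constant card_lessThan)
qed

text \<open>Only the factor of the first prime is kept; it already makes the kernel norms blow up at
  the boundary.\<close>

lemma rzeta_ge:
  assumes "D \<ge> 1" "x > 0"
  shows "rzeta D x \<ge> 1 / (ln (real (nth_prime 0)) * x)"
proof -
  define l where "l = ln (real (nth_prime 0))"
  have l: "l > 0" by (simp add: l_def ln_nth_prime_pos)
  have ge1: "1 / (1 - exp (- (ln (real (nth_prime j)) * x))) \<ge> 1" for j
    using ln_nth_prime_pos[of j] assms(2) by (simp add: divide_simps)
  have "1 / (l * x) \<le> 1 / (1 - exp (- (l * x)))"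
  proof (rule divide_left_mono)
    show "1 - exp (- (l * x)) \<le> l * x" using exp_ge_add_one_self[of "- (l * x)"] by linarith
    show "0 < (l * x) * (1 - exp (- (l * x)))" using l assms(2) by (simp add: mult_pos_pos)
  qed simp
  also have "\<dots> \<le> 1 / (1 - exp (- (l * x))) * (\<Prod>j\<in>{..<D} - {0}. 1 / (1 - exp (- (ln (real (nth_prime j)) * x))))"
    using prod_ge_1[of "{..<D} - {0}", OF ge1] l assms(2) by (simp add: divide_simps mult_le_cancel_left1)
  also have "\<dots> = rzeta D x"
    unfolding rzeta_def l_def using assms(1) by (intro prod.remove[symmetric]) auto
  finally show ?thesis by (simp add: l_def)
qed

section \<open>Necessity: the kernel test\<close>

text \<open>Equicontinuity upgrades pointwise to uniform convergence on a compact set, through a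
  finite \<open>e / 2\<close>-net.\<close>

lemma eventually_uniformly_small_on_compact:
  fixes l :: "nat \<Rightarrow> 'a::real_normed_vector \<Rightarrow> complex"
  assumes K: "compact K" and e: "e > 0"
    and lip: "\<And>k g h. norm (l k g - l k h) \<le> norm (g - h)" and null: "\<And>g. (\<lambda>k. l k g) \<longlonglongrightarrow> 0"
  shows "\<forall>\<^sub>F k in sequentially. \<forall>g\<in>K. norm (l k g) \<le> e"
proof -
  have "\<exists>X. finite X \<and> K \<subseteq> (\<Union>x\<in>X. ball x (e / 2))"
    using K e unfolding compact_eq_totally_bounded by auto
  then obtain X where X: "finite X" "K \<subseteq> (\<Union>x\<in>X. ball x (e / 2))" by blast
  have "\<forall>\<^sub>F k in sequentially. norm (l k x) < e / 2" for x
    using order_tendstoD(2)[OF tendsto_norm[OF null[of x]], of "e / 2"] e by simp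
  then have "\<forall>\<^sub>F k in sequentially. \<forall>x\<in>X. norm (l k x) < e / 2"
    using X(1) by (intro eventually_ball_finite) auto
  then show ?thesis
  proof eventually_elim
    case (elim k)
    show ?case
    proof
      fix g assume "g \<in> K"
      then obtain x where x: "x \<in> X" "dist x g < e / 2" using X(2) by auto
      have "norm (l k g) \<le> norm (l k x) + norm (l k g - l k x)" by (rule norm_triangle_sub)
      then show "norm (l k g) \<le> e" using lip[of k g x] elim x by (fastforce simp: dist_norm norm_minus_commute)
    qed
  qed
qed

text \<open>Normalized kernels tend weakly to 0: on a Dirichlet polynomial the evaluations stay
  bounded while the normalization blows up, and uniform boundedness of the functionals extends this
  by density.\<close>

lemma normalized_evaluation_tendsto_0:
  assumes D: "D \<ge> 1" and s: "\<And>k. Re (s k) > 0" "(\<lambda>k. Re (s k)) \<longlonglongrightarrow> 0"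
  shows "(\<lambda>k. pair_H g (point_eval (smooth D) (s k)) / of_real (sqrt (rzeta D (2 * Re (s k))))) \<longlonglongrightarrow> 0"
proof -
  define l where "l = (\<lambda>k g. pair_H g (point_eval (smooth D) (s k)) / of_real (sqrt (rzeta D (2 * Re (s k)))))"
  have z: "rzeta D (2 * Re (s k)) > 0" for k using s(1)[of k] by (simp add: rzeta_pos)
  have bound: "norm (l k g) \<le> norm g" for k g
    using norm_pair_H_le[OF summable_point_eval[OF s(1)[of k], of D], of g] z[of k]
    by (simp add: l_def norm_divide l2norm_point_eval[OF s(1)] divide_le_eq)
  have diff: "l k (g - h) = l k g - l k h" for k g h
    unfolding l_def by (simp add: pair_H_diff[OF summable_point_eval[OF s(1)]] diff_divide_distrib)
  have poly: "(\<lambda>k. l k (trunc_H N g)) \<longlonglongrightarrow> 0" for N g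
  proof -
    define M where "M = (\<Sum>n<N. cmod (coeff_H g n))"
    define c where "c = ln (real (nth_prime 0))"
    have "norm (l k (trunc_H N g)) \<le> M * sqrt (c * (2 * Re (s k)))" for k
    proof -
      have "pair_H (trunc_H N g) (point_eval (smooth D) (s k)) = (\<Sum>n<N. coeff_H g n * point_eval (smooth D) (s k) n)"
        unfolding pair_H_def by (subst suminf_finite[of "{..<N}"]) (auto simp: coeff_trunc_H)
      also have "norm \<dots> \<le> M"
        unfolding M_def using norm_dterm_le[of "s k"] s(1)[of k]
        by (intro sum_norm_le) (auto simp: norm_mult point_eval_def intro!: mult_left_le)
      finally have M: "norm (pair_H (trunc_H N g) (point_eval (smooth D) (s k))) \<le> M" .
      have "1 / (c * (2 * Re (s k))) \<le> rzeta D (2 * Re (s k))"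
        unfolding c_def by (rule rzeta_ge[OF D]) (use s(1) in simp)
      then have "1 / rzeta D (2 * Re (s k)) \<le> c * (2 * Re (s k))"
        using z[of k] s(1)[of k] ln_nth_prime_pos[of 0] by (simp add: c_def field_simps)
      then have "1 / sqrt (rzeta D (2 * Re (s k))) \<le> sqrt (c * (2 * Re (s k)))"
        by (metis real_sqrt_divide real_sqrt_le_mono real_sqrt_one)
      then have "norm (pair_H (trunc_H N g) (point_eval (smooth D) (s k))) * (1 / sqrt (rzeta D (2 * Re (s k))))
          \<le> M * sqrt (c * (2 * Re (s k)))"
        using M z[of k] by (intro mult_mono) (auto intro: order_trans[OF norm_ge_zero M])
      then show ?thesis using z[of k] by (simp add: l_def norm_divide)
    qed
    note le = this
    have "(\<lambda>k. M * sqrt (c * (2 * Re (s k)))) \<longlonglongrightarrow> M * sqrt (c * (2 * 0))"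
      by (intro tendsto_intros s(2))
    then have lim: "(\<lambda>k. M * sqrt (c * (2 * Re (s k)))) \<longlonglongrightarrow> 0" by simp
    show ?thesis by (rule Lim_null_comparison[OF always_eventually lim]) (use le in blast)
  qed
  have "(\<lambda>k. l k g) \<longlonglongrightarrow> 0"
  proof (rule LIMSEQ_I)
    fix e :: real assume e: "e > 0"
    obtain N where N: "norm (trunc_H N g - g) < e / 2"
      using LIMSEQ_D[OF trunc_H_tendsto[of g], of "e / 2"] e by auto
    obtain M where M: "\<And>k. k \<ge> M \<Longrightarrow> norm (l k (trunc_H N g) - 0) < e / 2"
      using LIMSEQ_D[OF poly[of N g], of "e / 2"] e by auto
    have "norm (l k g - 0) < e" if "k \<ge> M" for k
    proof -
      have "l k g = l k (trunc_H N g) - l k (trunc_H N g - g)" by (simp add: diff)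
      then have "norm (l k g) \<le> norm (l k (trunc_H N g)) + norm (l k (trunc_H N g - g))"
        by (metis norm_triangle_ineq4)
      then show ?thesis using bound[of k "trunc_H N g - g"] N M[OF that] by simp
    qed
    then show "\<exists>M. \<forall>k\<ge>M. norm (l k g - 0) < e" by blast
  qed
  then show ?thesis by (simp add: l_def)
qed

text \<open>Carries the composition formula from \<open>Re s > 1/2\<close> to
  \<open>Re s > 0\<close> for \<open>f\<close> supported on \<open>smooth D\<close>. In terms of
  adjoints: the kernel at \<open>s\<close> goes to the kernel at the image of
  \<open>s\<close>.\<close>

lemma (in polynomial_symbol) pair_composition_op:
  assumes "A \<subseteq> smooth D" "support_H f \<subseteq> smooth D" and s: "Re s > 0"
  shows "pair_H (composition_op \<phi> f) (point_eval (smooth D) s) = pair_H f (point_eval (smooth D) (dsym c0 A c s))"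
proof -
  have w: "Re (dsym c0 A c s) > 0"
    using s by (rule Re_dsym_pos)
  have eq: "pair_H (composition_op \<phi> (trunc_H N f)) (point_eval (smooth D) s) =
      pair_H (trunc_H N f) (point_eval (smooth D) (dsym c0 A c s))" for N
  proof -
    let ?F = "support_H (trunc_H N f)"
    have sub: "?F \<subseteq> smooth D" using assms(2) by (auto simp: support_H_def coeff_trunc_H split: if_splits)
    have "pair_H (composition_op \<phi> (trunc_H N f)) (point_eval (smooth D) s) = dpoly ?F (coeff_H (trunc_H N f)) (dsym c0 A c s)"
      using s by (intro pair_H_abs_dirichlet[OF composition_op_poly(1)[OF mult_monoid_smooth assms(1) sub finite_support_trunc_H order_refl sub]]) auto
    also have "\<dots> = pair_H (trunc_H N f) (point_eval (smooth D) (dsym c0 A c s))"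
      unfolding pair_H_def dpoly_def
      by (subst suminf_finite[OF finite_support_trunc_H]) (use sub in \<open>auto simp: support_H_def point_eval_def intro!: sum.cong\<close>)
    finally show ?thesis .
  qed
  have "(\<lambda>N. pair_H (composition_op \<phi> (trunc_H N f)) (point_eval (smooth D) s)) \<longlonglongrightarrow>
      pair_H (composition_op \<phi> f) (point_eval (smooth D) s)"
    by (intro bounded_linear.tendsto[OF bounded_linear_pair_H] summable_point_eval s composition_op_trunc_tendsto)
  moreover have "(\<lambda>N. pair_H (trunc_H N f) (point_eval (smooth D) (dsym c0 A c s))) \<longlonglongrightarrow>
      pair_H f (point_eval (smooth D) (dsym c0 A c s))"
    by (intro bounded_linear.tendsto[OF bounded_linear_pair_H] summable_point_eval w trunc_H_tendsto)
  ultimately show ?thesis unfolding eq by (rule LIMSEQ_unique)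
qed

context symbol_pair
begin

text \<open>For \<open>f\<close> the difference of the two kernels, \<open>(norm f)\<^sup>2\<close>
  is the real part of the evaluation at \<open>s k\<close> of the image of \<open>f\<close>.
  Normalized evaluations are uniformly small on the compact closure of the image of the unit ball,
  so one factor \<open>norm f\<close> cancels.\<close>

lemma kernel_images_close:
  assumes T: "compact_operator (\<lambda>f. composition_op \<phi>0 f - composition_op \<phi>1 f)"
    and D: "D \<ge> 1" "A \<subseteq> smooth D" "B \<subseteq> smooth D"
    and s: "\<And>k. Re (s k) > 0" "(\<lambda>k. Re (s k)) \<longlonglongrightarrow> 0" and e: "e > 0"
  shows "\<forall>\<^sub>F k in sequentially. norm (kernel D (dsym c0 A a (s k)) - kernel D (dsym c0 B b (s k)))
    \<le> e * sqrt (rzeta D (2 * Re (s k)))"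
proof -
  define Top where "Top = (\<lambda>f. composition_op \<phi>0 f - composition_op \<phi>1 f)"
  define l where "l = (\<lambda>k g. pair_H g (point_eval (smooth D) (s k)) / of_real (sqrt (rzeta D (2 * Re (s k)))))"
  interpret Top: bounded_linear Top using T by (simp add: Top_def compact_operator_def)
  have z: "rzeta D (2 * Re (s k)) > 0" for k using s(1)[of k] by (simp add: rzeta_pos)
  have "norm (l k g - l k h) \<le> norm (g - h)" for k g h
  proof -
    have "l k g - l k h = pair_H (g - h) (point_eval (smooth D) (s k)) / of_real (sqrt (rzeta D (2 * Re (s k))))"
      unfolding l_def by (simp add: pair_H_diff[OF summable_point_eval[OF s(1)]] diff_divide_distrib)
    then show ?thesis
      using norm_pair_H_le[OF summable_point_eval[OF s(1)[of k], of D], of "g - h"] z[of k]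
      by (simp add: norm_divide l2norm_point_eval[OF s(1)] divide_le_eq)
  qed
  moreover have "(\<lambda>k. l k g) \<longlonglongrightarrow> 0" for g
    unfolding l_def by (rule normalized_evaluation_tendsto_0[OF D(1) s])
  moreover have "compact (closure (Top ` cball 0 1))"
    using T by (simp add: Top_def compact_operator_def)
  ultimately have "\<forall>\<^sub>F k in sequentially. \<forall>g\<in>closure (Top ` cball 0 1). norm (l k g) \<le> e"
    using e by (intro eventually_uniformly_small_on_compact)
  then show ?thesis
  proof eventually_elim
    case (elim k)
    define w0 where "w0 = dsym c0 A a (s k)"
    define w1 where "w1 = dsym c0 B b (s k)"
    have w: "Re w0 > 0" "Re w1 > 0"
      unfolding w0_def w1_def using p0.Re_dsym_pos p1.Re_dsym_pos s(1) by blast+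
    define f where "f = kernel D w0 - kernel D w1"
    have supp: "support_H f \<subseteq> smooth D"
      by (auto simp: support_H_def f_def minus_dirichlet_H.rep_eq coeff_kernel w point_eval_def split: if_splits)
    have "(norm f)\<^sup>2 = inner f (kernel D w0) - inner f (kernel D w1)"
      by (simp add: power2_norm_eq_inner f_def inner_diff_right)
    also have "\<dots> = Re (pair_H f (point_eval (smooth D) w0) - pair_H f (point_eval (smooth D) w1))"
      by (simp add: inner_kernel w)
    also have "pair_H f (point_eval (smooth D) w0) - pair_H f (point_eval (smooth D) w1) =
        pair_H (Top f) (point_eval (smooth D) (s k))"
      unfolding Top_def w0_def w1_def
      by (simp add: pair_H_diff[OF summable_point_eval[OF s(1)]] p0.pair_composition_op[OF D(2) supp s(1)]
          p1.pair_composition_op[OF D(3) supp s(1)])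
    also have "Re \<dots> \<le> norm (pair_H (Top f) (point_eval (smooth D) (s k)))" by (rule complex_Re_le_cmod)
    also have "\<dots> \<le> e * sqrt (rzeta D (2 * Re (s k))) * norm f"
    proof (cases "f = 0")
      case True
      have "pair_H 0 (point_eval (smooth D) (s k)) = 0" by (simp add: pair_H_def zero_dirichlet_H.rep_eq)
      then show ?thesis using True by (simp add: Top.zero)
    next
      case False
      define g where "g = (1 / norm f) *\<^sub>R f"
      have fg: "f = norm f *\<^sub>R g" using False by (simp add: g_def)
      have "norm g \<le> 1" using False by (simp add: g_def)
      then have "norm (l k (Top g)) \<le> e"
        using elim closure_subset by (metis (no_types, lifting) image_eqI mem_cball_0 subsetD)
      then have "norm (pair_H (Top g) (point_eval (smooth D) (s k))) \<le> e * sqrt (rzeta D (2 * Re (s k)))"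
        using z[of k] by (simp add: l_def norm_divide divide_le_eq)
      moreover have "pair_H (Top f) (point_eval (smooth D) (s k)) = norm f *\<^sub>R pair_H (Top g) (point_eval (smooth D) (s k))"
        by (subst fg) (simp add: Top.scaleR pair_H_scaleR[OF summable_point_eval[OF s(1)]])
      ultimately show ?thesis by (simp add: mult.commute mult_left_mono)
    qed
    finally have "norm f * norm f \<le> e * sqrt (rzeta D (2 * Re (s k))) * norm f" by (simp add: power2_eq_square)
    then have "norm f \<le> e * sqrt (rzeta D (2 * Re (s k)))"
    proof (cases "norm f = 0")
      case True
      then show ?thesis using e z[of k] by simp
    qed (auto dest: mult_right_le_imp_le)
    then show ?case by (simp add: f_def w0_def w1_def)
  qed
qed

end

text \<open>
  A single prime determines \<open>L\<close> only modulo \<open>2 \<pi> \<i> / ln p\<close>; this is why kernels over at least two primes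
  are used even when the symbols involve only one.
\<close>

lemma dterm_two_primes:
  assumes p: "prime p" "prime q" "p \<noteq> q" and L: "dterm p L = 1" "dterm q L = 1"
  shows "L = 0"
proof -
  have pq: "p > 1" "q > 1" using p prime_gt_1_nat by auto
  have lp: "ln (real p) > 0" "ln (real q) > 0" using pq by auto
  obtain m where m: "Re (- (of_real (ln (real p)) * L)) = 0" "Im (- (of_real (ln (real p)) * L)) = of_int (2 * m) * pi"
    using L(1) unfolding dterm_def exp_eq_1 by blast
  obtain n where n: "Im (- (of_real (ln (real q)) * L)) = of_int (2 * n) * pi"
    using L(2) unfolding dterm_def exp_eq_1 by blast
  have Re0: "Re L = 0" using m(1) lp by simp
  have mI: "- (ln (real p) * Im L) = of_int (2 * m) * pi" and nI: "- (ln (real q) * Im L) = of_int (2 * n) * pi"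
    using m(2) n by simp_all
  have "Im L = 0"
  proof (rule ccontr)
    assume I: "Im L \<noteq> 0"
    then have "m \<noteq> 0" "n \<noteq> 0" using mI nI lp by auto
    have "ln (real p) * (of_int (2 * n) * pi) = ln (real q) * (of_int (2 * m) * pi)"
      unfolding mI[symmetric] nI[symmetric] by simp
    then have "ln (real p) * real_of_int n = ln (real q) * real_of_int m" by simp
    then have "\<bar>ln (real p) * real_of_int n\<bar> = \<bar>ln (real q) * real_of_int m\<bar>" by simp
    then have "real (nat \<bar>n\<bar>) * ln (real p) = real (nat \<bar>m\<bar>) * ln (real q)"
      using lp by (simp add: abs_mult mult.commute)
    then have "ln (real p ^ nat \<bar>n\<bar>) = ln (real q ^ nat \<bar>m\<bar>)"
      using pq by (simp add: ln_realpow)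
    then have "real p ^ nat \<bar>n\<bar> = real q ^ nat \<bar>m\<bar>" using pq by (subst (asm) ln_inj_iff) auto
    then have "p ^ nat \<bar>n\<bar> = q ^ nat \<bar>m\<bar>" by (simp flip: of_nat_power)
    moreover have "p dvd p ^ nat \<bar>n\<bar>" using \<open>n \<noteq> 0\<close> by (intro dvd_power) simp
    ultimately have "p dvd q" using p prime_dvd_power by metis
    then show False using p primes_dvd_imp_eq by blast
  qed
  then show ?thesis using Re0 by (simp add: complex_eq_iff)
qed

text \<open>For small \<open>w\<close> the remainder \<open>exp w - 1 - w\<close> is at most half of
  \<open>norm w\<close>, so the exponential can be inverted with constant 2.\<close>

lemma norm_le_exp_minus_1:
  fixes w :: complex
  assumes "norm w \<le> 1 / 4"
  shows "norm w \<le> 2 * norm (exp w - 1)"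
proof -
  have "norm (exp w - (\<Sum>i\<le>1. w ^ i / fact i)) \<le> exp (norm w) * norm w ^ Suc 1 / fact 1"
    by (rule Taylor_exp_field)
  moreover have "exp (norm w) \<le> 2" using exp_bound_half[of "norm w"] assms by simp
  then have "exp (norm w) * norm w ^ 2 \<le> 2 * (norm w * (1 / 4))"
    unfolding power2_eq_square using assms by (intro mult_mono) auto
  ultimately have "norm (exp w - 1 - w) \<le> norm w / 2" by (simp add: power2_eq_square algebra_simps)
  moreover have "norm w \<le> norm (exp w - 1) + norm (exp w - 1 - w)"
    using norm_triangle_ineq4[of "exp w - 1" "exp w - 1 - w"] by simp
  ultimately show ?thesis by linarith
qed

section \<open>From close kernels to close symbols\<close>

context symbol_pair
begin

text \<open>Close kernels mean small pseudohyperbolic distance between \<open>u\<close> and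
  \<open>v\<close>, the values of \<open>dterm (nth_prime i)\<close> at the two images. Since
  \<open>1 - (cmod u)\<^sup>2\<close> is \<open>O(Re s)\<close>, this forces \<open>u - v\<close>,
  and hence the quotient \<open>q = v / u\<close> minus 1, to be \<open>o(Re s)\<close>.\<close>

lemma multiplier_close:
  assumes T: "compact_operator (\<lambda>f. composition_op \<phi>0 f - composition_op \<phi>1 f)"
    and D: "A \<subseteq> smooth D" "B \<subseteq> smooth D"
    and s: "\<And>k. Re (s k) > 0" "(\<lambda>k. Re (s k)) \<longlonglongrightarrow> 0"
    and V: "\<And>k. Re (dsym c0 A a (s k)) \<le> real V * Re (s k)" and i: "i < D" and e: "e > 0"
  shows "\<forall>\<^sub>F k in sequentially.
    cmod (1 - dterm (nth_prime i) (dsym c0 B b (s k) - dsym c0 A a (s k))) \<le> e * Re (s k)"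
proof -
  define l where "l = ln (real (nth_prime i))"
  have l: "l > 0" by (simp add: l_def ln_nth_prime_pos)
  have w0: "Re (dsym c0 A a (s k)) > 0" and w1: "Re (dsym c0 B b (s k)) > 0" for k
    using p0.Re_dsym_pos p1.Re_dsym_pos s(1) by auto
  have "real V * Re (s 0) > 0" using w0[of 0] V[of 0] by linarith
  then have V1: "real V \<ge> 1" using s(1)[of 0] by (simp add: zero_less_mult_iff Suc_leI)
  \<comment> \<open>The bound \<open>1 / 4\<close> lets the term in \<open>cmod (1 - q)\<close> be
    absorbed on the left; what remains, \<open>4 * \<eta> * (1 - (cmod u)\<^sup>2)\<close>, is at
    most \<open>8 * \<eta> * l * V * Re s\<close>, which dictates the second entry.\<close>
  define \<eta> where "\<eta> = min (1 / 4) (e / (8 * l * real V))"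
  have \<eta>: "\<eta> > 0" "\<eta> \<le> 1 / 4" "8 * \<eta> * l * real V \<le> e"
  proof -
    show "\<eta> > 0" using e l V1 by (simp add: \<eta>_def)
    have "\<eta> * (8 * l * real V) \<le> e / (8 * l * real V) * (8 * l * real V)"
      using l V1 by (intro mult_right_mono) (auto simp: \<eta>_def)
    then show "8 * \<eta> * l * real V \<le> e" using l V1 by (simp add: mult_ac)
  qed (simp add: \<eta>_def)
  \<comment> \<open>Compensates the factor \<open>V ^ D\<close> incurred when the norm at
    \<open>s\<close> is replaced by the one at its image.\<close>
  define e1 where "e1 = \<eta> / real V ^ D"
  have e1: "e1 > 0" using \<eta> V1 by (simp add: e1_def)
  have "e1\<^sup>2 * real V ^ D \<le> \<eta>\<^sup>2"
  proof -
    have "1 \<le> real V ^ D" using V1 by (rule one_le_power)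
    then have "\<eta>\<^sup>2 / real V ^ D \<le> \<eta>\<^sup>2 / 1" by (intro divide_left_mono) (use V1 in auto)
    moreover have "e1\<^sup>2 * real V ^ D = \<eta>\<^sup>2 / real V ^ D"
      using V1 by (simp add: e1_def power_divide power2_eq_square)
    ultimately show ?thesis by simp
  qed
  note e1V = this
  have "\<forall>\<^sub>F k in sequentially. norm (kernel D (dsym c0 A a (s k)) - kernel D (dsym c0 B b (s k)))
    \<le> e1 * sqrt (rzeta D (2 * Re (s k)))"
    using kernel_images_close[OF T _ D s e1] i by simp
  \<comment> \<open>Guarantees \<open>cmod u \<ge> 1 / 2\<close>, so that division by
    \<open>u\<close> is harmless.\<close>
  moreover have "\<forall>\<^sub>F k in sequentially. exp (- (l * (real V * Re (s k)))) > 1 / 2"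
  proof (rule order_tendstoD(1))
    show "(\<lambda>k. exp (- (l * (real V * Re (s k))))) \<longlonglongrightarrow> exp (- (l * (real V * 0)))"
      by (intro tendsto_intros s(2))
  qed simp
  ultimately show ?thesis
  proof eventually_elim
    case (elim k)
    define W0 where "W0 = dsym c0 A a (s k)"
    define W1 where "W1 = dsym c0 B b (s k)"
    define u where "u = dterm (nth_prime i) W0"
    define v where "v = dterm (nth_prime i) W1"
    define q where "q = dterm (nth_prime i) (W1 - W0)"
    have uq: "v = u * q" unfolding u_def v_def q_def dterm_add[symmetric] by simp
    have R0: "Re W0 > 0" and R1: "Re W1 > 0" using w0 w1 by (auto simp: W0_def W1_def)
    define z where "z = rzeta D (2 * Re W0)"
    have z: "z > 0" using R0 by (simp add: z_def rzeta_pos)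
    have "(norm (kernel D W0 - kernel D W1))\<^sup>2 \<le> (e1 * sqrt (rzeta D (2 * Re (s k))))\<^sup>2"
      using elim(1) by (intro power_mono) (auto simp: W0_def W1_def)
    also have "\<dots> = e1\<^sup>2 * rzeta D (2 * Re (s k))"
      using s(1)[of k] by (simp add: power_mult_distrib less_imp_le rzeta_pos)
    also have "\<dots> \<le> e1\<^sup>2 * (real V ^ D * z)"
      unfolding z_def using s(1)[of k] R0 V[of k] by (intro mult_left_mono rzeta_compare) (auto simp: W0_def)
    also have "\<dots> \<le> \<eta>\<^sup>2 * z"
      using mult_right_mono[OF e1V, of z] z by (simp add: mult.assoc)
    finally have close: "(norm (kernel D W0 - kernel D W1))\<^sup>2 \<le> \<eta>\<^sup>2 * z" .
    have "z * (cmod (u - v))\<^sup>2 \<le> (norm (kernel D W0 - kernel D W1))\<^sup>2 * (cmod (1 - cnj u * v))\<^sup>2"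
      using kernel_distance[OF R0 R1 i] by (simp add: norm_kernel_sq[OF R0] z_def u_def v_def)
    also have "\<dots> \<le> \<eta>\<^sup>2 * z * (cmod (1 - cnj u * v))\<^sup>2" by (intro mult_right_mono close) auto
    finally have "z * (cmod (u - v))\<^sup>2 \<le> z * (\<eta> * cmod (1 - cnj u * v))\<^sup>2"
      by (simp add: power_mult_distrib mult_ac)
    then have "(cmod (u - v))\<^sup>2 \<le> (\<eta> * cmod (1 - cnj u * v))\<^sup>2" using z by simp
    then have uv: "cmod (u - v) \<le> \<eta> * cmod (1 - cnj u * v)"
      by (rule power2_le_imp_le) (use \<eta> in simp)
    have nu: "cmod u = exp (- (l * Re W0))" by (simp add: u_def norm_dterm l_def)
    have lW: "l * Re W0 \<le> l * (real V * Re (s k))" using V[of k] l by (intro mult_left_mono) (auto simp: W0_def)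
    have u1: "cmod u \<le> 1" "cmod u \<ge> 1 / 2"
      using l R0 elim(2) lW unfolding nu by (auto intro: order_trans[OF less_imp_le])
    have "cmod (u - v) = cmod u * cmod (1 - q)"
      unfolding uq norm_mult[symmetric] by (simp add: algebra_simps)
    moreover have "cmod (1 - cnj u * v) \<le> (1 - (cmod u)\<^sup>2) + (cmod u)\<^sup>2 * cmod (1 - q)"
    proof -
      have "cnj u * v = of_real ((cmod u)\<^sup>2) * q"
        unfolding uq complex_norm_square by (simp add: mult_ac)
      then have "1 - cnj u * v = of_real (1 - (cmod u)\<^sup>2) + of_real ((cmod u)\<^sup>2) * (1 - q)"
        by (simp add: algebra_simps)
      moreover have "(cmod u)\<^sup>2 \<le> 1" using u1 by (simp add: power_le_one)
      ultimately show ?thesis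
        by (metis (no_types, lifting) abs_of_nonneg diff_ge_0_iff_ge norm_mult norm_of_real norm_triangle_ineq zero_le_power2)
    qed
    ultimately have "cmod u * cmod (1 - q) \<le> \<eta> * ((1 - (cmod u)\<^sup>2) + (cmod u)\<^sup>2 * cmod (1 - q))"
      using uv mult_left_mono[of "cmod (1 - cnj u * v)" _ \<eta>] \<eta>(1) by (smt (verit))
    moreover have "1 / 2 * cmod (1 - q) \<le> cmod u * cmod (1 - q)" using u1 by (intro mult_right_mono) auto
    moreover have "\<eta> * ((cmod u)\<^sup>2 * cmod (1 - q)) \<le> 1 / 4 * (1 * cmod (1 - q))"
      using \<eta> u1 by (intro mult_mono) (auto simp: power_le_one)
    ultimately have "cmod (1 - q) \<le> 4 * \<eta> * (1 - (cmod u)\<^sup>2)" by (simp add: algebra_simps)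
    also have "1 - (cmod u)\<^sup>2 \<le> 2 * (l * Re W0)"
      using exp_ge_add_one_self[of "- (2 * (l * Re W0))"] unfolding nu by (simp flip: exp_of_nat_mult)
    also have "\<dots> \<le> 2 * (l * (real V * Re (s k)))" using lW by simp
    finally have "cmod (1 - q) \<le> 8 * \<eta> * l * real V * Re (s k)"
      using \<eta>(1) by (simp add: mult_ac)
    also have "\<dots> \<le> e * Re (s k)" using \<eta>(3) s(1)[of k] by (intro mult_right_mono) auto
    finally show ?case by (simp add: q_def W0_def W1_def)
  qed
qed

text \<open>A multiplier close to 1 determines the difference only up to periods, hence the
  assumption of a limit \<open>L\<close>: two primes force \<open>L = 0\<close>, and near 0 a single
  prime gives the rate.\<close>

lemma symbol_difference_little_o:
  assumes T: "compact_operator (\<lambda>f. composition_op \<phi>0 f - composition_op \<phi>1 f)"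
    and D: "D \<ge> 2" "A \<subseteq> smooth D" "B \<subseteq> smooth D"
    and s: "\<And>k. Re (s k) > 0" "(\<lambda>k. Re (s k)) \<longlonglongrightarrow> 0"
    and V: "\<And>k. Re (dsym c0 A a (s k)) \<le> real V * Re (s k)"
    and L: "(\<lambda>k. dpoly A a (s k) - dpoly B b (s k)) \<longlonglongrightarrow> L"
  shows "L = 0" and "(\<lambda>k. (dpoly A a (s k) - dpoly B b (s k)) / of_real (Re (s k))) \<longlonglongrightarrow> 0"
proof -
  define \<delta> where "\<delta> = (\<lambda>k. dpoly A a (s k) - dpoly B b (s k))"
  have \<delta>: "dsym c0 B b (s k) - dsym c0 A a (s k) = - \<delta> k" for k by (simp add: dsym_def \<delta>_def)
  have L': "\<delta> \<longlonglongrightarrow> L" using L by (simp add: \<delta>_def)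
  have close: "\<forall>\<^sub>F k in sequentially. cmod (1 - dterm (nth_prime i) (- \<delta> k)) \<le> e * Re (s k)" if "i < D" "e > 0" for i e
    using multiplier_close[OF T D(2,3) s V that] by (simp add: \<delta>)
  have lim1: "(\<lambda>k. 1 - dterm (nth_prime i) (- \<delta> k)) \<longlonglongrightarrow> 0" if "i < D" for i
    by (rule Lim_null_comparison[OF close[OF that, of 1]]) (use s(2) in auto)
  have "dterm (nth_prime i) (- L) = 1" if "i < D" for i
  proof -
    have "(\<lambda>k. 1 - dterm (nth_prime i) (- \<delta> k)) \<longlonglongrightarrow> 1 - dterm (nth_prime i) (- L)"
      unfolding dterm_def by (intro tendsto_intros L')
    then show ?thesis using LIMSEQ_unique[OF lim1[OF that]] by fastforce
  qed
  from dterm_two_primes[OF _ _ _ this this, of 0 1] D(1)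
  show L0: "L = 0" by (simp add: nth_prime_prime nth_prime_inj)
  define l where "l = ln (real (nth_prime 0))"
  have l: "l > 0" by (simp add: l_def ln_nth_prime_pos)
  show "(\<lambda>k. (dpoly A a (s k) - dpoly B b (s k)) / of_real (Re (s k))) \<longlonglongrightarrow> 0"
  proof (rule tendstoI)
    fix e :: real assume e: "e > 0"
    have "(\<lambda>k. norm (of_real l * \<delta> k)) \<longlonglongrightarrow> norm (of_real l * L)" by (intro tendsto_intros L')
    then have "\<forall>\<^sub>F k in sequentially. norm (of_real l * \<delta> k) < 1 / 4"
      by (rule order_tendstoD) (simp add: L0)
    moreover have "\<forall>\<^sub>F k in sequentially. cmod (1 - dterm (nth_prime 0) (- \<delta> k)) \<le> (l * e / 4) * Re (s k)"
      using D(1) e l by (intro close) auto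
    ultimately show "\<forall>\<^sub>F k in sequentially. dist ((dpoly A a (s k) - dpoly B b (s k)) / of_real (Re (s k))) 0 < e"
    proof eventually_elim
      case (elim k)
      have "norm (of_real l * \<delta> k) \<le> 2 * norm (exp (of_real l * \<delta> k) - 1)"
        by (rule norm_le_exp_minus_1) (use elim in simp)
      also have "exp (of_real l * \<delta> k) = dterm (nth_prime 0) (- \<delta> k)" by (simp add: dterm_def l_def)
      also have "2 * norm (dterm (nth_prime 0) (- \<delta> k) - 1) \<le> 2 * ((l * e / 4) * Re (s k))"
        using elim(2) by (subst norm_minus_commute) (rule mult_left_mono, simp_all)
      finally have "l * norm (\<delta> k) \<le> l * (e / 2 * Re (s k))" using l by (simp add: norm_mult mult_ac)
      then have "norm (\<delta> k) \<le> e / 2 * Re (s k)" using l by simp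
      also have "\<dots> < e * Re (s k)" using e s(1)[of k] by simp
      finally show ?case using s(1)[of k] by (simp add: \<delta>_def norm_divide divide_less_eq)
    qed
  qed
qed

end

section \<open>Density of vertical lines in the torus\<close>

text \<open>Unique factorization: the positive and the negative parts of the \<open>k j\<close> give
  two products of prime powers with equal logarithms.\<close>

lemma int_relation_ln_nth_prime:
  fixes k :: "nat \<Rightarrow> int"
  assumes "finite J" and rel: "(\<Sum>j\<in>J. of_int (k j) * ln (real (nth_prime j))) = 0" and j: "j \<in> J"
  shows "k j = 0"
proof -
  define P where "P = (\<lambda>e :: nat \<Rightarrow> nat. \<Prod>j\<in>J. nth_prime j ^ e j)"
  have lnP: "ln (real (P e)) = (\<Sum>j\<in>J. real (e j) * ln (real (nth_prime j)))" for e
    unfolding P_def of_nat_prod using assms(1) by (subst ln_prod) (auto simp: ln_realpow)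
  have P0: "P e > 0" for e by (simp add: P_def prod_pos)
  have "ln (real (P (\<lambda>j. nat (k j)))) - ln (real (P (\<lambda>j. nat (- k j)))) = (\<Sum>j\<in>J. of_int (k j) * ln (real (nth_prime j)))"
    unfolding lnP sum_subtractf[symmetric] left_diff_distrib[symmetric] by (intro sum.cong refl) auto
  then have "ln (real (P (\<lambda>j. nat (k j)))) = ln (real (P (\<lambda>j. nat (- k j))))" using rel by simp
  then have eq: "P (\<lambda>j. nat (k j)) = P (\<lambda>j. nat (- k j))"
    using P0 by (subst (asm) ln_inj_iff) auto
  have "multiplicity (nth_prime j) (P e) = e j" for e
  proof -
    have inj: "inj nth_prime" by (simp add: inj_def nth_prime_inj)
    have "P e = (\<Prod>p\<in>nth_prime ` J. p ^ e (inv nth_prime p))"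
      unfolding P_def by (subst prod.reindex) (auto simp: inv_f_f[OF inj] intro: inj_on_subset[OF inj])
    also have "multiplicity (nth_prime j) \<dots> = (if nth_prime j \<in> nth_prime ` J then e (inv nth_prime (nth_prime j)) else 0)"
      by (rule multiplicity_prod_prime_powers) (use assms(1) nth_prime_prime in auto)
    finally show ?thesis using j by (simp add: inv_f_f[OF inj])
  qed
  from this[of "\<lambda>j. nat (k j)"] this[of "\<lambda>j. nat (- k j)"] eq have "nat (k j) = nat (- k j)" by simp
  then show ?thesis by simp
qed

lemma norm_cis_diff_le: "cmod (cis (x + y) - cis x) \<le> \<bar>y\<bar>"
proof -
  have "cis (x + y) - cis x = cis x * (cis y - 1)" by (simp add: cis_mult algebra_simps)
  moreover have "cmod (cis y - 1) \<le> \<bar>y\<bar>"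
    using Taylor_exp[of "\<i> * of_real y" 0] by (simp add: cis_conv_exp norm_mult)
  ultimately show ?thesis by (simp add: norm_mult)
qed

text \<open>Kronecker's theorem for the frequencies \<open>- ln p / (2 * pi)\<close>, which are
  independent over the integers; the sign is that of the exponent in \<open>dterm\<close>.\<close>

lemma kronecker_primes:
  assumes "\<epsilon> > 0"
  obtains t where "\<And>j. j < D \<Longrightarrow> cmod (dterm (nth_prime j) (\<i> * of_real t) - cis (\<alpha> j)) \<le> \<epsilon>"
proof -
  define \<theta> where "\<theta> = (\<lambda>j. - ln (real (nth_prime j)) / (2 * pi))"
  have inj: "inj_on \<theta> {..<D}"
    by (auto simp: inj_on_def \<theta>_def nth_prime_inj)
  interpret M: Modules.module "(\<lambda>r. (*) (real_of_int r))"
    by (simp add: Modules.module.intro distrib_left mult.commute)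
  have indep: "M.independent (\<theta> ` {..<D})"
    unfolding M.dependent_explicit
  proof (safe)
    fix t u v assume t: "finite t" "t \<subseteq> \<theta> ` {..<D}" "(\<Sum>v\<in>t. real_of_int (u v) * v) = 0" and v: "v \<in> t" "u v \<noteq> 0"
    obtain J where J: "J \<subseteq> {..<D}" "t = \<theta> ` J" using t(2) by (auto simp: subset_image_iff)
    have fJ: "finite J" using J(1) finite_subset by blast
    have "(\<Sum>v\<in>t. real_of_int (u v) * v) = (\<Sum>j\<in>J. of_int (u (\<theta> j)) * \<theta> j)"
      unfolding J(2) using inj_on_subset[OF inj J(1)] by (simp add: sum.reindex)
    also have "\<dots> = - (\<Sum>j\<in>J. of_int (u (\<theta> j)) * ln (real (nth_prime j))) / (2 * pi)"
      by (simp add: \<theta>_def sum_divide_distrib sum_negf)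
    finally have rel: "(\<Sum>j\<in>J. of_int (u (\<theta> j)) * ln (real (nth_prime j))) = 0" using t(3) by simp
    obtain j where "j \<in> J" "v = \<theta> j" using v J by auto
    then show False using int_relation_ln_nth_prime[OF fJ rel] v by blast
  qed
  obtain t h where th: "\<And>i. i < D \<Longrightarrow> \<bar>t * \<theta> i - of_int (h i) - \<alpha> i / (2 * pi)\<bar> < \<epsilon> / (2 * pi)"
    using Kronecker_thm_1[OF indep inj, of "\<epsilon> / (2 * pi)" "\<lambda>i. \<alpha> i / (2 * pi)"] assms by auto
  show thesis
  proof
    fix j assume j: "j < D"
    define x where "x = t * \<theta> j - of_int (h j) - \<alpha> j / (2 * pi)"
    define r where "r = 2 * pi * x"
    have "\<bar>x\<bar> \<le> \<epsilon> / (2 * pi)" using th[OF j] by (simp add: x_def)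
    then have r: "\<bar>r\<bar> \<le> \<epsilon>" by (simp add: r_def abs_mult field_simps)
    have "t * \<theta> j = x + of_int (h j) + \<alpha> j / (2 * pi)" by (simp add: x_def)
    then have "2 * pi * (t * \<theta> j) = \<alpha> j + r + 2 * pi * of_int (h j)"
      by (simp add: r_def ring_distribs)
    moreover have "2 * pi * (t * \<theta> j) = - (ln (real (nth_prime j)) * t)"
      by (simp add: \<theta>_def)
    moreover have "dterm (nth_prime j) (\<i> * of_real t) = cis (- (ln (real (nth_prime j)) * t))"
      by (simp add: dterm_def cis_conv_exp mult_ac)
    ultimately have "dterm (nth_prime j) (\<i> * of_real t) = cis (\<alpha> j + r + 2 * pi * of_int (h j))" by simp
    also have "\<dots> = cis (\<alpha> j + r)"
      by (simp add: cis_mult[symmetric] cis_multiple_2pi)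
    finally show "cmod (dterm (nth_prime j) (\<i> * of_real t) - cis (\<alpha> j)) \<le> \<epsilon>"
      using norm_cis_diff_le[of "\<alpha> j" r] r by simp
  qed
qed

text \<open>Closeness at the primes passes to any finite set of monomials by continuity.\<close>

lemma vertical_approximation:
  assumes U: "finite U" "U \<subseteq> smooth D" and z: "\<And>j. j < D \<Longrightarrow> cmod (z j) = 1" and \<epsilon>: "\<epsilon> > 0"
  shows "\<exists>t. \<forall>n\<in>U. cmod (dterm n (\<i> * of_real t) - monom_at D z n) < \<epsilon>"
proof -
  define \<alpha> where "\<alpha> = (\<lambda>j. Arg (z j))"
  have \<alpha>: "cis (\<alpha> j) = z j" if "j < D" for j
    using z[OF that] by (simp add: \<alpha>_def complex_norm_eq_1_exp_eq cis_conv_exp)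
  have "\<forall>k. \<exists>t. \<forall>j<D. cmod (dterm (nth_prime j) (\<i> * of_real t) - cis (\<alpha> j)) \<le> 1 / real (Suc k)"
    using kronecker_primes[of "1 / real (Suc _)" D \<alpha>] by (metis of_nat_0_less_iff zero_less_Suc zero_less_divide_1_iff)
  then obtain t where t: "\<And>k j. j < D \<Longrightarrow> cmod (dterm (nth_prime j) (\<i> * of_real (t k)) - cis (\<alpha> j)) \<le> 1 / real (Suc k)"
    by metis
  have lim: "(\<lambda>k. dterm (nth_prime j) (\<i> * of_real (t k))) \<longlonglongrightarrow> z j" if "j < D" for j
  proof (rule LIM_zero_cancel, rule Lim_null_comparison[OF always_eventually])
    show "\<forall>k. cmod (dterm (nth_prime j) (\<i> * of_real (t k)) - z j) \<le> 1 / real (Suc k)"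
      using t[OF that] \<alpha>[OF that] by simp
    show "(\<lambda>k. 1 / real (Suc k)) \<longlonglongrightarrow> 0" by (rule LIMSEQ_Suc[OF lim_1_over_n])
  qed
  have "\<forall>\<^sub>F k in sequentially. \<forall>n\<in>U. cmod (dterm n (\<i> * of_real (t k)) - monom_at D z n) < \<epsilon>"
  proof (rule eventually_ball_finite[OF U(1)], rule ballI)
    fix n assume n: "n \<in> U"
    have "(\<lambda>k. monom_at D (\<lambda>j. dterm (nth_prime j) (\<i> * of_real (t k))) n) \<longlonglongrightarrow> monom_at D z n"
      by (intro tendsto_monom_at lim)
    then have "(\<lambda>k. dterm n (\<i> * of_real (t k))) \<longlonglongrightarrow> monom_at D z n"
      using n U(2) by (simp add: monom_at_dterm subset_iff)
    from tendstoD[OF this \<epsilon>] show "\<forall>\<^sub>F k in sequentially. cmod (dterm n (\<i> * of_real (t k)) - monom_at D z n) < \<epsilon>"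
      by (simp add: dist_norm)
  qed
  then obtain k where "\<forall>n\<in>U. cmod (dterm n (\<i> * of_real (t k)) - monom_at D z n) < \<epsilon>"
    using eventually_happens trivial_limit_sequentially by blast
  then show ?thesis by blast
qed

section \<open>Necessity: extraction of the moments\<close>

text \<open>The exponent is \<open>\<i> * y * A - l * y\<^sup>2\<close>, so the parabolic scaling
  puts \<open>l\<close> beside \<open>A\<^sup>2 / 2\<close> in the coefficient of
  \<open>y\<^sup>2\<close>. Terms of degree 3 and 4 go into the error because
  \<open>\<bar>y\<bar> \<le> 1\<close>.\<close>

lemma exp_quadratic_Taylor:
  fixes A l :: real
  shows "\<exists>C\<ge>0. \<forall>y. \<bar>y\<bar> \<le> 1 \<longrightarrow> norm (cis (y * A) * exp (- of_real (l * y\<^sup>2)) -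
    (1 + \<i> * of_real (y * A) - of_real (y\<^sup>2 * (A\<^sup>2 / 2 + l)))) \<le> C * \<bar>y\<bar> ^ 3"
proof -
  define M where "M = \<bar>A\<bar> + \<bar>l\<bar>"
  define C where "C = exp M * M ^ 3 / 2 + \<bar>A\<bar> * \<bar>l\<bar> + l\<^sup>2 / 2"
  have C0: "C \<ge> 0" by (simp add: C_def M_def)
  have "norm (cis (y * A) * exp (- of_real (l * y\<^sup>2)) - (1 + \<i> * of_real (y * A) - of_real (y\<^sup>2 * (A\<^sup>2 / 2 + l)))) \<le> C * \<bar>y\<bar> ^ 3"
    if y: "\<bar>y\<bar> \<le> 1" for y
  proof -
    define w where "w = \<i> * of_real (y * A) - complex_of_real (l * y\<^sup>2)"
    have y2: "y\<^sup>2 \<le> \<bar>y\<bar>" using y by (metis abs_ge_zero mult_left_le power2_abs power2_eq_square)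
    have "norm w \<le> norm (\<i> * complex_of_real (y * A)) + norm (complex_of_real (l * y\<^sup>2))"
      unfolding w_def by (rule norm_triangle_ineq4)
    also have "\<dots> = \<bar>y\<bar> * \<bar>A\<bar> + \<bar>l\<bar> * y\<^sup>2" by (simp add: norm_mult abs_mult norm_power)
    also have "\<dots> \<le> \<bar>y\<bar> * \<bar>A\<bar> + \<bar>l\<bar> * \<bar>y\<bar>" using y2 by (intro add_mono mult_left_mono) auto
    finally have nw: "norm w \<le> M * \<bar>y\<bar>" by (simp add: M_def algebra_simps)
    have M0: "M \<ge> 0" by (simp add: M_def)
    have nwM: "norm w \<le> M" using nw mult_left_le[OF y M0] by linarith
    have "norm (exp w - (\<Sum>i\<le>2. w ^ i / fact i)) \<le> exp (norm w) * norm w ^ Suc 2 / fact 2"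
      by (rule Taylor_exp_field)
    also have "(\<Sum>i\<le>2. w ^ i / fact i) = 1 + w + w\<^sup>2 / 2" by (simp add: eval_nat_numeral fact_numeral)
    also have "exp (norm w) * norm w ^ Suc 2 / fact 2 \<le> exp M * (M * \<bar>y\<bar>) ^ 3 / 2"
      using nw nwM by (simp add: divide_right_mono mult_mono power_mono eval_nat_numeral(3)[symmetric] numeral_3_eq_3[symmetric])
    finally have 1: "norm (exp w - (1 + w + w\<^sup>2 / 2)) \<le> exp M * M ^ 3 / 2 * \<bar>y\<bar> ^ 3"
      by (simp add: power_mult_distrib)
    define t where "t = 1 + \<i> * of_real (y * A) - complex_of_real (y\<^sup>2 * (A\<^sup>2 / 2 + l))"
    have "w\<^sup>2 = - ((of_real (y * A)) ^ 2) - 2 * \<i> * of_real (y * A) * of_real (l * y\<^sup>2) + (of_real (l * y\<^sup>2)) ^ 2"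
      unfolding w_def by (simp add: power2_eq_square algebra_simps)
    then have "(1 + w + w\<^sup>2 / 2) - t = of_real (l\<^sup>2 / 2 * y ^ 4) - \<i> * of_real (A * l * y ^ 3)"
      unfolding t_def w_def
      by (simp add: power2_eq_square power3_eq_cube power4_eq_xxxx algebra_simps add_divide_distrib diff_divide_distrib)
    then have "norm ((1 + w + w\<^sup>2 / 2) - t) \<le> norm (complex_of_real (l\<^sup>2 / 2 * y ^ 4)) + norm (\<i> * complex_of_real (A * l * y ^ 3))"
      by (simp only: norm_triangle_ineq4)
    also have "\<dots> = l\<^sup>2 / 2 * y ^ 4 + \<bar>A\<bar> * \<bar>l\<bar> * \<bar>y\<bar> ^ 3"
      by (simp add: norm_mult abs_mult norm_divide norm_power power_abs)
    also have "y ^ 4 \<le> \<bar>y\<bar> ^ 3"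
    proof -
      have "y ^ 4 = \<bar>y\<bar> ^ 4" by simp
      also have "\<dots> \<le> \<bar>y\<bar> ^ 3" using y by (intro power_decreasing) auto
      finally show ?thesis .
    qed
    then have "l\<^sup>2 / 2 * y ^ 4 + \<bar>A\<bar> * \<bar>l\<bar> * \<bar>y\<bar> ^ 3 \<le> l\<^sup>2 / 2 * \<bar>y\<bar> ^ 3 + \<bar>A\<bar> * \<bar>l\<bar> * \<bar>y\<bar> ^ 3"
      by (intro add_right_mono mult_left_mono) auto
    finally have 2: "norm ((1 + w + w\<^sup>2 / 2) - t) \<le> l\<^sup>2 / 2 * \<bar>y\<bar> ^ 3 + \<bar>A\<bar> * \<bar>l\<bar> * \<bar>y\<bar> ^ 3" .
    have "cis (y * A) * exp (- of_real (l * y\<^sup>2)) = exp w"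
      by (simp add: w_def cis_conv_exp exp_diff exp_minus field_simps)
    then have "norm (cis (y * A) * exp (- of_real (l * y\<^sup>2)) - t) \<le> norm (exp w - (1 + w + w\<^sup>2 / 2)) + norm ((1 + w + w\<^sup>2 / 2) - t)"
      using norm_triangle_ineq[of "exp w - (1 + w + w\<^sup>2 / 2)" "(1 + w + w\<^sup>2 / 2) - t"] by simp
    then show ?thesis using 1 2 unfolding t_def C_def by (simp add: algebra_simps)
  qed
  then show ?thesis using C0 by blast
qed

lemma sum_quadratic_Taylor:
  fixes g :: "nat \<Rightarrow> complex" and A :: "nat \<Rightarrow> real"
  shows "\<exists>C\<ge>0. \<forall>y. \<bar>y\<bar> \<le> 1 \<longrightarrow> norm ((\<Sum>n\<in>U. g n * (cis (y * A n) * dterm n (of_real (y\<^sup>2)))) -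
    ((\<Sum>n\<in>U. g n) + \<i> * of_real y * (\<Sum>n\<in>U. g n * of_real (A n)) -
       of_real (y\<^sup>2) * (\<Sum>n\<in>U. g n * of_real ((A n)\<^sup>2 / 2 + ln (real n))))) \<le> C * \<bar>y\<bar> ^ 3"
proof -
  define P where "P = (\<lambda>n (C::real). C \<ge> 0 \<and> (\<forall>y. \<bar>y\<bar> \<le> 1 \<longrightarrow> norm (cis (y * A n) * exp (- of_real (ln (real n) * y\<^sup>2)) -
    (1 + \<i> * of_real (y * A n) - of_real (y\<^sup>2 * ((A n)\<^sup>2 / 2 + ln (real n))))) \<le> C * \<bar>y\<bar> ^ 3))"
  have "\<forall>n. \<exists>C. P n C" unfolding P_def using exp_quadratic_Taylor by blast
  then obtain C where "\<And>n. P n (C n)" by metis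
  then have C: "C n \<ge> 0" "\<bar>y\<bar> \<le> 1 \<Longrightarrow> norm (cis (y * A n) * exp (- of_real (ln (real n) * y\<^sup>2)) -
    (1 + \<i> * of_real (y * A n) - of_real (y\<^sup>2 * ((A n)\<^sup>2 / 2 + ln (real n))))) \<le> C n * \<bar>y\<bar> ^ 3" for n y
    unfolding P_def by blast+
  show ?thesis
  proof (intro exI[of _ "\<Sum>n\<in>U. norm (g n) * C n"] conjI allI impI)
    show "0 \<le> (\<Sum>n\<in>U. norm (g n) * C n)" by (intro sum_nonneg mult_nonneg_nonneg C(1)) auto
    fix y :: real assume y: "\<bar>y\<bar> \<le> 1"
    have "(\<Sum>n\<in>U. g n * (cis (y * A n) * dterm n (of_real (y\<^sup>2)))) -
      ((\<Sum>n\<in>U. g n) + \<i> * of_real y * (\<Sum>n\<in>U. g n * of_real (A n)) -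
       of_real (y\<^sup>2) * (\<Sum>n\<in>U. g n * of_real ((A n)\<^sup>2 / 2 + ln (real n)))) =
      (\<Sum>n\<in>U. g n * (cis (y * A n) * exp (- of_real (ln (real n) * y\<^sup>2)) -
        (1 + \<i> * of_real (y * A n) - of_real (y\<^sup>2 * ((A n)\<^sup>2 / 2 + ln (real n))))))"
      by (simp add: dterm_def sum_distrib_left algebra_simps sum.distrib sum_subtractf)
    also have "norm \<dots> \<le> (\<Sum>n\<in>U. norm (g n) * (C n * \<bar>y\<bar> ^ 3))"
      by (intro sum_norm_le) (auto simp: norm_mult intro!: mult_left_mono C(2) y simp del: of_real_mult of_real_add of_real_power of_real_divide)
    also have "\<dots> = (\<Sum>n\<in>U. norm (g n) * C n) * \<bar>y\<bar> ^ 3"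
      by (simp add: sum_distrib_right mult.assoc)
    finally show "norm ((\<Sum>n\<in>U. g n * (cis (y * A n) * dterm n (of_real (y\<^sup>2)))) -
      ((\<Sum>n\<in>U. g n) + \<i> * of_real y * (\<Sum>n\<in>U. g n * of_real (A n)) -
       of_real (y\<^sup>2) * (\<Sum>n\<in>U. g n * of_real ((A n)\<^sup>2 / 2 + ln (real n))))) \<le> (\<Sum>n\<in>U. norm (g n) * C n) * \<bar>y\<bar> ^ 3" .
  qed
qed

text \<open>The vertical line is dense in the torus, so nonnegativity on the imaginary axis carries
  over to the lift.\<close>

lemma Re_bohr_lift_nonneg:
  assumes fin: "finite (dirichlet_support c)" and pos: "\<And>t. Re (dpoly (dirichlet_support c) c (\<i> * of_real t)) \<ge> 0"
    and z: "\<And>j. j < bohr_dim c \<Longrightarrow> cmod (z j) = 1"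
  shows "Re (bohr_lift c z) \<ge> 0"
proof (rule field_le_epsilon)
  fix e :: real assume e: "e > 0"
  define M where "M = (\<Sum>n\<in>dirichlet_support c. norm (c n)) + 1"
  have M: "M > 0" unfolding M_def by (simp add: add_nonneg_pos sum_nonneg)
  obtain t where t: "\<And>n. n \<in> dirichlet_support c \<Longrightarrow> cmod (dterm n (\<i> * of_real t) - monom_at (bohr_dim c) z n) < e / M"
    using vertical_approximation[OF fin support_smooth[OF fin], of z "e / M"] z e M by auto
  have "norm (dpoly (dirichlet_support c) c (\<i> * of_real t) - bohr_lift c z) \<le> (\<Sum>n\<in>dirichlet_support c. norm (c n) * (e / M))"
    unfolding dpoly_def bohr_lift_eq sum_subtractf[symmetric] right_diff_distrib[symmetric]
    by (intro sum_norm_le) (simp only: norm_mult mult_left_mono less_imp_le[OF t] norm_ge_zero)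
  also have "\<dots> \<le> M * (e / M)"
    unfolding sum_distrib_right[symmetric] using e M by (intro mult_right_mono) (auto simp: M_def)
  finally have "norm (dpoly (dirichlet_support c) c (\<i> * of_real t) - bohr_lift c z) \<le> e" using M by simp
  then show "0 \<le> Re (bohr_lift c z) + e"
    using pos[of t] abs_Re_le_cmod[of "dpoly (dirichlet_support c) c (\<i> * of_real t) - bohr_lift c z"] by simp
qed

text \<open>The real part has a minimum at \<open>y = 0\<close>, so its derivative there
  vanishes.\<close>

lemma first_moment_at_minimum:
  fixes g :: "nat \<Rightarrow> complex" and A :: "nat \<Rightarrow> real"
  assumes nonneg: "\<And>y. Re (\<Sum>n\<in>U. g n * cis (y * A n)) \<ge> 0" and zero: "Re (\<Sum>n\<in>U. g n) = 0"
  shows "Re (\<i> * (\<Sum>n\<in>U. g n * of_real (A n))) = 0"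
proof -
  define h where "h = (\<lambda>y. \<Sum>n\<in>U. Re (g n) * cos (y * A n) - Im (g n) * sin (y * A n))"
  have h: "h y = Re (\<Sum>n\<in>U. g n * cis (y * A n))" for y by (simp add: h_def)
  have "(h has_real_derivative (\<Sum>n\<in>U. - Im (g n) * A n)) (at 0)"
    unfolding h_def by (auto intro!: derivative_eq_intros sum.cong)
  moreover have "\<forall>y. \<bar>0 - y\<bar> < 1 \<longrightarrow> h 0 \<le> h y"
    using nonneg zero by (simp add: h)
  ultimately have "(\<Sum>n\<in>U. - Im (g n) * A n) = 0" by (intro DERIV_local_min[of h _ 0 1]) auto
  then show ?thesis by (simp add: sum_negf)
qed

text \<open>The difference expands as \<open>G0 + \<i> * y * G1 - y\<^sup>2 * G2\<close> up to
  \<open>O(y ^ 3)\<close> and must be \<open>o(y\<^sup>2)\<close>, so all three coefficients vanish,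
  for every direction \<open>v\<close>. The point \<open>z\<close> has \<open>D\<close> coordinates,
  possibly more than the symbols use, so that two primes are available.\<close>

lemma necessary_moments:
  assumes s0: "dirichlet_polynomial_symbol \<phi>0 c0 a" and s1: "dirichlet_polynomial_symbol \<phi>1 c0 b" and c0: "c0 \<ge> 1"
    and T: "compact_operator (\<lambda>f. composition_op \<phi>0 f - composition_op \<phi>1 f)"
    and D: "D \<ge> 2" "bohr_dim a \<le> D" "bohr_dim b \<le> D"
    and z: "\<And>j. j < D \<Longrightarrow> cmod (z j) = 1" and zero: "Re (bohr_lift a z) = 0"
  shows "moments_vanish D a b z"
proof -
  interpret symbol_pair \<phi>0 \<phi>1 c0 "dirichlet_support a" a "dirichlet_support b" b
    using polynomial_symbol_of_dirichlet[OF s0 c0] polynomial_symbol_of_dirichlet[OF s1 c0]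
    by (rule symbol_pair.intro)
  note fin = p0.fin p1.fin
  have sub: "dirichlet_support a \<subseteq> smooth D" "dirichlet_support b \<subseteq> smooth D"
    using support_smooth fin smooth_mono D by blast+
  define U where "U = joint_support a b"
  have U: "finite U" "U \<subseteq> smooth D" using fin sub by (auto simp: U_def joint_support_def)
  define g where "g = gap D a b z"
  define m where "m = (\<lambda>n j. real (multiplicity (nth_prime j) n))"
  define ga where "ga = (\<lambda>n. a n * monom_at D z n)"
  have key: "(\<Sum>n\<in>U. g n) = 0 \<and> (\<Sum>n\<in>U. g n * of_real (\<Sum>j<D. v j * m n j)) = 0 \<and>
      (\<Sum>n\<in>U. g n * of_real ((\<Sum>j<D. v j * m n j)\<^sup>2 / 2 + ln (real n))) = 0" for v :: "nat \<Rightarrow> real"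
  proof -
    define A where "A = (\<lambda>n. \<Sum>j<D. v j * m n j)"
    define y where "y = (\<lambda>k. 1 / real (Suc k))"
    have y: "0 < y k" "y k \<le> 1" for k by (auto simp: y_def)
    have ylim: "y \<longlonglongrightarrow> 0" unfolding y_def by (rule LIMSEQ_Suc[OF lim_1_over_n])
    have mon: "monom_at D (\<lambda>j. z j * cis (r * v j)) n = monom_at D z n * cis (r * A n)" for r n
      by (simp add: monom_at_mult monom_at_cis A_def m_def sum_distrib_left mult.assoc)
    \<comment> \<open>The Kronecker error is taken below \<open>y ^ 4\<close>, so the cubic
      remainder of the expansion absorbs it.\<close>
    have "\<exists>t. \<forall>n\<in>U. cmod (dterm n (\<i> * of_real t) - monom_at D (\<lambda>j. z j * cis (y k * v j)) n) < y k ^ 4" for k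
    proof -
      have "cmod (z j * cis (y k * v j)) = 1" if "j < D" for j using z[OF that] by (simp add: norm_mult)
      moreover have "y k ^ 4 > 0" using y[of k] by simp
      ultimately show ?thesis
        using vertical_approximation[OF U, of "\<lambda>j. z j * cis (y k * v j)" "y k ^ 4"] by blast
    qed
    then obtain t where t: "\<And>k n. n \<in> U \<Longrightarrow> cmod (dterm n (\<i> * of_real (t k)) - monom_at D z n * cis (y k * A n)) < y k ^ 4"
      unfolding mon by metis
    define s where "s = (\<lambda>k. complex_of_real ((y k)\<^sup>2) + \<i> * of_real (t k))"
    have Res: "Re (s k) = (y k)\<^sup>2" for k by (simp add: s_def)
    have approx: "norm ((\<Sum>n\<in>X. e n * dterm n (s k)) - (\<Sum>n\<in>X. (e n * monom_at D z n) * (cis (y k * A n) * dterm n (of_real ((y k)\<^sup>2)))))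
       \<le> (\<Sum>n\<in>X. norm (e n)) * y k ^ 4" if X: "X \<subseteq> U" for X e k
      unfolding sum_subtractf[symmetric] sum_distrib_right
    proof (rule sum_norm_le)
      fix n assume n: "n \<in> X"
      have eq: "e n * dterm n (s k) - (e n * monom_at D z n) * (cis (y k * A n) * dterm n (of_real ((y k)\<^sup>2))) =
        e n * (dterm n (of_real ((y k)\<^sup>2)) * (dterm n (\<i> * of_real (t k)) - monom_at D z n * cis (y k * A n)))"
        unfolding s_def dterm_add by (simp add: algebra_simps)
      have "norm (dterm n (of_real ((y k)\<^sup>2))) \<le> 1" by (rule norm_dterm_le) simp
      then have "norm (dterm n (of_real ((y k)\<^sup>2)) * (dterm n (\<i> * of_real (t k)) - monom_at D z n * cis (y k * A n))) \<le> 1 * y k ^ 4"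
        unfolding norm_mult[of "dterm n _"] using t[of n k] n X by (intro mult_mono) auto
      then show "norm (e n * dterm n (s k) - (e n * monom_at D z n) * (cis (y k * A n) * dterm n (of_real ((y k)\<^sup>2)))) \<le> norm (e n) * y k ^ 4"
        unfolding eq norm_mult[of "e n"] by (intro mult_left_mono) auto
    qed
    have y43: "y k ^ 4 \<le> y k ^ 3" and y42: "y k ^ 4 \<le> y k ^ 2" and y32: "y k ^ 3 \<le> y k ^ 2" for k
      using y[of k] by (auto intro!: power_decreasing)
    define G0 where "G0 = (\<Sum>n\<in>U. g n)"
    define G1 where "G1 = (\<Sum>n\<in>U. g n * of_real (A n))"
    define G2 where "G2 = (\<Sum>n\<in>U. g n * of_real ((A n)\<^sup>2 / 2 + ln (real n)))"
    define \<Delta> where "\<Delta> = (\<lambda>k. dpoly (dirichlet_support a) a (s k) - dpoly (dirichlet_support b) b (s k))"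
    obtain C where C: "C \<ge> 0" "\<And>r. \<bar>r\<bar> \<le> 1 \<Longrightarrow> norm ((\<Sum>n\<in>U. g n * (cis (r * A n) * dterm n (of_real (r\<^sup>2)))) -
      (G0 + \<i> * of_real r * G1 - of_real (r\<^sup>2) * G2)) \<le> C * \<bar>r\<bar> ^ 3"
      using sum_quadratic_Taylor[where U = U and g = g and A = A] unfolding G0_def G1_def G2_def by blast
    define M where "M = (\<Sum>n\<in>U. norm (a n - b n)) + C"
    have expand: "norm (\<Delta> k - (G0 + \<i> * of_real (y k) * G1 - of_real ((y k)\<^sup>2) * G2)) \<le> M * y k ^ 3" for k
    proof -
      have "\<Delta> k = (\<Sum>n\<in>U. (a n - b n) * dterm n (s k))"
        unfolding \<Delta>_def dpoly_def U_def by (rule sum_over_joint_support[OF fin])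
      then have "norm (\<Delta> k - (\<Sum>n\<in>U. g n * (cis (y k * A n) * dterm n (of_real ((y k)\<^sup>2))))) \<le> (\<Sum>n\<in>U. norm (a n - b n)) * y k ^ 4"
        using approx[of U "\<lambda>n. a n - b n" k] by (simp add: g_def gap_def)
      also have "\<dots> \<le> (\<Sum>n\<in>U. norm (a n - b n)) * y k ^ 3" using y43 by (intro mult_left_mono sum_nonneg) auto
      finally have 1: "norm (\<Delta> k - (\<Sum>n\<in>U. g n * (cis (y k * A n) * dterm n (of_real ((y k)\<^sup>2))))) \<le> (\<Sum>n\<in>U. norm (a n - b n)) * y k ^ 3" .
      have 2: "norm ((\<Sum>n\<in>U. g n * (cis (y k * A n) * dterm n (of_real ((y k)\<^sup>2)))) -
        (G0 + \<i> * of_real (y k) * G1 - of_real ((y k)\<^sup>2) * G2)) \<le> C * y k ^ 3"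
        using C(2)[of "y k"] y[of k] by simp
      show ?thesis
        using norm_diff_triangle_le[OF 1 2] by (simp only: M_def distrib_right)
    qed
    \<comment> \<open>A prerequisite of the kernel test. At \<open>z\<close> the constant term has
      real part 0, and so has the linear term because the lift has nonnegative real part on the
      torus; the rest is \<open>O(y\<^sup>2)\<close>, that is \<open>O(Re s)\<close>.\<close>
    have Re_bound: "\<exists>V::nat. \<forall>k. Re (dsym c0 (dirichlet_support a) a (s k)) \<le> real V * Re (s k)"
    proof -
      define H1 where "H1 = (\<Sum>n\<in>dirichlet_support a. ga n * of_real (A n))"
      define H2 where "H2 = (\<Sum>n\<in>dirichlet_support a. ga n * of_real ((A n)\<^sup>2 / 2 + ln (real n)))"
      have lift: "bohr_lift a (\<lambda>j. z j * cis (r * v j)) = (\<Sum>n\<in>dirichlet_support a. ga n * cis (r * A n))" for r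
        unfolding bohr_lift_eq_ge[OF fin(1) D(2)] mon by (simp add: ga_def mult.assoc)
      have zero': "Re (\<Sum>n\<in>dirichlet_support a. ga n) = 0"
        using zero lift[of 0] by simp
      have ReH1: "Re (\<i> * H1) = 0"
        unfolding H1_def
      proof (rule first_moment_at_minimum[OF _ zero'])
        show "0 \<le> Re (\<Sum>n\<in>dirichlet_support a. ga n * cis (r * A n))" for r
          unfolding lift[symmetric]
          by (rule Re_bohr_lift_nonneg[OF fin(1) p0.pos]) (use z D in \<open>auto simp: norm_mult\<close>)
      qed
      obtain C' where C': "C' \<ge> 0" "\<And>r. \<bar>r\<bar> \<le> 1 \<Longrightarrow> norm ((\<Sum>n\<in>dirichlet_support a. ga n * (cis (r * A n) * dterm n (of_real (r\<^sup>2)))) -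
        ((\<Sum>n\<in>dirichlet_support a. ga n) + \<i> * of_real r * H1 - of_real (r\<^sup>2) * H2)) \<le> C' * \<bar>r\<bar> ^ 3"
        using sum_quadratic_Taylor[where U = "dirichlet_support a" and g = ga and A = A] unfolding H1_def H2_def by blast
      define Na where "Na = (\<Sum>n\<in>dirichlet_support a. norm (a n))"
      have Na: "Na \<ge> 0" by (simp add: Na_def sum_nonneg)
      have "Re (dsym c0 (dirichlet_support a) a (s k)) \<le> (real c0 + norm H2 + C' + Na) * Re (s k)" for k
      proof -
        define P where "P = dpoly (dirichlet_support a) a (s k)"
        define Q where "Q = (\<Sum>n\<in>dirichlet_support a. ga n * (cis (y k * A n) * dterm n (of_real ((y k)\<^sup>2))))"
        define R where "R = (\<Sum>n\<in>dirichlet_support a. ga n) + \<i> * of_real (y k) * H1 - of_real ((y k)\<^sup>2) * H2"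
        have "norm (P - Q) \<le> Na * y k ^ 4"
          using approx[of "dirichlet_support a" a k] by (simp add: P_def Q_def Na_def dpoly_def ga_def U_def joint_support_def)
        then have "Re P - Re Q \<le> Na * y k ^ 2"
          using mult_left_mono[OF y42[of k] Na] complex_Re_le_cmod[of "P - Q"] by simp
        moreover have "norm (Q - R) \<le> C' * y k ^ 3"
          using C'(2)[of "y k"] y[of k] by (simp add: Q_def R_def)
        then have "Re Q - Re R \<le> C' * y k ^ 2"
          using mult_left_mono[OF y32[of k] C'(1)] complex_Re_le_cmod[of "Q - R"] by simp
        moreover have "Re R \<le> norm H2 * y k ^ 2"
        proof -
          have "Re R = y k * Re (\<i> * H1) - (y k)\<^sup>2 * Re H2"
            using zero' by (simp add: R_def)
          also have "\<dots> = (y k)\<^sup>2 * (- Re H2)" using ReH1 by simp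
          also have "\<dots> \<le> (y k)\<^sup>2 * norm H2"
            using abs_Re_le_cmod[of H2] by (intro mult_left_mono) auto
          finally show ?thesis by (simp add: mult.commute)
        qed
        ultimately have "Re P \<le> (norm H2 + C' + Na) * (y k)\<^sup>2" by (simp add: ring_distribs)
        moreover have "Re (dsym c0 (dirichlet_support a) a (s k)) = real c0 * (y k)\<^sup>2 + Re P"
          by (simp add: dsym_def P_def Res)
        ultimately show ?thesis by (simp add: Res ring_distribs)
      qed
      note bound = this
      obtain V :: nat where V: "real c0 + norm H2 + C' + Na \<le> real V" using real_arch_simple by blast
      have "(real c0 + norm H2 + C' + Na) * Re (s k) \<le> real V * Re (s k)" for k
        by (rule mult_right_mono[OF V]) (simp add: Res)
      then have "Re (dsym c0 (dirichlet_support a) a (s k)) \<le> real V * Re (s k)" for k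
        using bound order_trans by blast
      then show ?thesis by blast
    qed
    then obtain V :: nat where V: "\<And>k. Re (dsym c0 (dirichlet_support a) a (s k)) \<le> real V * Re (s k)" by blast
    have spos: "Re (s k) > 0" for k using y[of k] by (simp add: Res)
    have slim: "(\<lambda>k. Re (s k)) \<longlonglongrightarrow> 0"
      unfolding Res using tendsto_power[OF ylim, of 2] by simp
    have rem: "(\<lambda>k. M * y k ^ 3) \<longlonglongrightarrow> 0" and rem1: "(\<lambda>k. M * y k) \<longlonglongrightarrow> 0"
      using tendsto_mult[OF tendsto_const tendsto_power[OF ylim, of 3], of M] tendsto_mult[OF tendsto_const ylim, of M] by simp_all
    have "\<Delta> \<longlonglongrightarrow> G0"
    proof -
      have "(\<lambda>k. \<Delta> k - (G0 + \<i> * of_real (y k) * G1 - of_real ((y k)\<^sup>2) * G2)) \<longlonglongrightarrow> 0"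
        by (rule Lim_null_comparison[OF always_eventually rem]) (use expand in blast)
      moreover have "(\<lambda>k. G0 + \<i> * of_real (y k) * G1 - of_real ((y k)\<^sup>2) * G2) \<longlonglongrightarrow> G0 + \<i> * of_real 0 * G1 - of_real (0\<^sup>2) * G2"
        by (intro tendsto_intros ylim)
      ultimately show ?thesis using tendsto_add by fastforce
    qed
    then have L: "G0 = 0" "(\<lambda>k. \<Delta> k / of_real (Re (s k))) \<longlonglongrightarrow> 0"
      using symbol_difference_little_o[OF T D(1) sub spos slim V] unfolding \<Delta>_def by blast+
    \<comment> \<open>What remains of the expansion over \<open>Re s = y\<^sup>2\<close> once
      \<open>G0 = 0\<close>. Multiplying by \<open>y\<close> isolates \<open>G1\<close>; after that
      \<open>q\<close> is the constant \<open>- G2\<close>.\<close>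
    define q where "q = (\<lambda>k. \<i> * G1 / of_real (y k) - G2)"
    have "(\<lambda>k. \<Delta> k / of_real (Re (s k)) - q k) \<longlonglongrightarrow> 0"
    proof (rule Lim_null_comparison[OF always_eventually rem1], rule allI)
      fix k
      have "\<Delta> k / of_real (Re (s k)) - q k = (\<Delta> k - (G0 + \<i> * of_real (y k) * G1 - of_real ((y k)\<^sup>2) * G2)) / of_real ((y k)\<^sup>2)"
        using y[of k] by (simp add: q_def Res L(1) field_simps power2_eq_square)
      also have "norm \<dots> \<le> M * y k ^ 3 / (y k)\<^sup>2"
        unfolding norm_divide norm_of_real abs_power2 by (intro divide_right_mono expand) simp
      also have "\<dots> = M * y k" using y[of k] by (simp add: power2_eq_square power3_eq_cube)
      finally show "norm (\<Delta> k / of_real (Re (s k)) - q k) \<le> M * y k" .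
    qed
    then have q0: "q \<longlonglongrightarrow> 0" using tendsto_diff[OF L(2)] by fastforce
    have "(\<lambda>k. of_real (y k) * q k + of_real (y k) * G2) \<longlonglongrightarrow> of_real 0 * 0 + of_real 0 * G2"
      by (intro tendsto_intros ylim q0)
    moreover have "of_real (y k) * q k + of_real (y k) * G2 = \<i> * G1" for k
      using y[of k] by (simp add: q_def field_simps)
    ultimately have G1: "G1 = 0" using LIMSEQ_const_iff by fastforce
    then have "(\<lambda>k::nat. - G2) \<longlonglongrightarrow> 0" using q0 by (simp add: q_def)
    then have "- G2 = 0" by (rule LIMSEQ_unique[OF tendsto_const])
    then have "G2 = 0" by simp
    then show ?thesis using L(1) G1 unfolding G0_def G1_def G2_def A_def by blast
  qed
  have delta: "(\<Sum>j<D. (if j = i then c else 0) * m n j) = c * m n i" if "i < D" for i n c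
    using that by (simp add: if_distrib[of "\<lambda>x. x * _"] cong: if_cong)
  have first: "(\<Sum>n\<in>U. g n * of_real (m n i)) = 0" if "i < D" for i
    using key[of "\<lambda>j. if j = i then 1 else 0"] unfolding delta[OF that] by simp
  \<comment> \<open>Along the direction \<open>v j = ln (nth_prime j)\<close> the linear form is
    \<open>ln n\<close> itself, so the logarithmic moment is a first moment and drops out of
    \<open>G2\<close>.\<close>
  have logs: "(\<Sum>n\<in>U. g n * of_real (ln (real n))) = 0"
  proof -
    have "ln (real n) = (\<Sum>j<D. ln (real (nth_prime j)) * m n j)" if "n \<in> U" for n
    proof -
      have "ln (real n) = ln (real (\<Prod>j<D. nth_prime j ^ multiplicity (nth_prime j) n))"
      proof -
        have "n \<in> smooth D" using that U(2) by blast
        then show ?thesis by (subst smooth_factorization[of n D, symmetric]) auto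
      qed
      also have "\<dots> = (\<Sum>j<D. ln (real (nth_prime j)) * m n j)"
        unfolding of_nat_prod by (subst ln_prod) (auto simp: ln_realpow m_def mult.commute)
      finally show ?thesis .
    qed
    then show ?thesis using key[of "\<lambda>j. ln (real (nth_prime j))"] by simp
  qed
  have second: "(\<Sum>n\<in>U. g n * of_real ((\<Sum>j<D. v j * m n j)\<^sup>2)) = 0" for v
  proof -
    have "(\<Sum>n\<in>U. g n * of_real ((\<Sum>j<D. v j * m n j)\<^sup>2 / 2 + ln (real n))) =
      (\<Sum>n\<in>U. g n * of_real ((\<Sum>j<D. v j * m n j)\<^sup>2)) / 2 + (\<Sum>n\<in>U. g n * of_real (ln (real n)))"
      unfolding sum_divide_distrib sum.distrib[symmetric] by (intro sum.cong refl) (simp add: ring_distribs)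
    then show ?thesis using key[of v] logs by simp
  qed
  \<comment> \<open>Polarization, with \<open>v\<close> the sum of two unit vectors;
    \<open>i = j\<close> is allowed.\<close>
  have mixed: "(\<Sum>n\<in>U. g n * of_real (m n i * m n j)) = 0" if "i < D" "j < D" for i j
  proof -
    have e: "(\<Sum>k<D. ((if k = i then 1 else 0) + (if k = j then 1 else 0)) * m n k) = m n i + m n j" for n
      using delta[OF that(1), of 1 n] delta[OF that(2), of 1 n] by (simp add: distrib_right sum.distrib)
    have sq: "(\<Sum>n\<in>U. g n * of_real ((m n k)\<^sup>2)) = 0" if "k < D" for k
      using second[of "\<lambda>j. if j = k then 1 else 0"] unfolding delta[OF that] by simp
    have "(\<Sum>n\<in>U. g n * of_real ((m n i + m n j)\<^sup>2)) =
      (\<Sum>n\<in>U. g n * of_real ((m n i)\<^sup>2)) + (\<Sum>n\<in>U. g n * of_real ((m n j)\<^sup>2)) + 2 * (\<Sum>n\<in>U. g n * of_real (m n i * m n j))"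
      unfolding sum_distrib_left sum.distrib[symmetric] by (intro sum.cong refl) (simp add: power2_eq_square algebra_simps)
    then show ?thesis
      using second[of "\<lambda>k. (if k = i then 1 else 0) + (if k = j then 1 else 0)"] sq that unfolding e by simp
  qed
  show ?thesis
    using key[of "\<lambda>_. 0"] first mixed by (simp add: moments_vanish_def U_def g_def m_def)
qed

text \<open>The unit ball is symmetric, so both differences map it onto the same set.\<close>

lemma compact_operator_swap:
  assumes T: "compact_operator (\<lambda>f. S f - R f :: dirichlet_H)" and S: "bounded_linear S" and R: "bounded_linear R"
  shows "compact_operator (\<lambda>f. R f - S f)"
proof -
  have "(\<lambda>f. R f - S f) ` cball 0 1 = (\<lambda>f. S f - R f) ` cball 0 1"
  proof -
    have neg: "R f - S f = S (- f) - R (- f)" for f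
      by (simp add: linear_neg bounded_linear.linear[OF S] bounded_linear.linear[OF R])
    have neg': "S f - R f = R (- f) - S (- f)" for f
      by (simp add: linear_neg bounded_linear.linear[OF S] bounded_linear.linear[OF R])
    show ?thesis
    proof (intro equalityI image_subsetI)
      fix f :: 'a assume "f \<in> cball 0 1"
      then show "R f - S f \<in> (\<lambda>f. S f - R f) ` cball 0 1" by (subst neg) (auto intro!: image_eqI)
      show "S f - R f \<in> (\<lambda>f. R f - S f) ` cball 0 1" using \<open>f \<in> cball 0 1\<close> by (subst neg') (auto intro!: image_eqI)
    qed
  qed
  moreover have "bounded_linear (\<lambda>f. R f - S f)" by (intro bounded_linear_sub S R)
  ultimately show ?thesis using T by (simp add: compact_operator_def)
qed

text \<open>If \<open>b\<close> used more variables than \<open>a\<close>, the real part of its lift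
  would vanish along the whole coordinate of index \<open>bohr_dim a\<close>, which the lift of
  \<open>a\<close> does not see; contact of order two makes it strictly positive nearby.\<close>

lemma gamma_dims_le:
  assumes fin: "finite (dirichlet_support a)" "finite (dirichlet_support b)"
    and contact: "\<forall>z\<in>Gamma_set b. dirichlet_contact b 1 z"
    and same: "\<And>z. (\<And>j. j < D \<Longrightarrow> cmod (z j) = 1) \<Longrightarrow> Re (bohr_lift a z) = 0 \<Longrightarrow> Re (bohr_lift b z) = 0"
    and D: "bohr_dim a \<le> D" "bohr_dim b \<le> D" and z: "z \<in> Gamma_set a"
  shows "bohr_dim b \<le> bohr_dim a" and "Gamma_set b \<noteq> {}"
proof -
  define ext where "ext = (\<lambda>\<tau> j. if j < bohr_dim a then z j else cis (\<tau> j))"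
  have next1: "cmod (ext \<tau> j) = 1" for \<tau> j
    using z by (auto simp: ext_def Gamma_set_def torus_def)
  have "bohr_lift a (ext \<tau>) = bohr_lift a z" for \<tau> by (rule bohr_lift_cong) (simp add: ext_def)
  then have zero: "Re (bohr_lift b (ext \<tau>)) = 0" for \<tau>
    using z by (intro same next1) (simp add: Gamma_set_def)
  define w where "w = (\<lambda>j. if j < bohr_dim b then ext (\<lambda>_. 0) j else 0)"
  have "bohr_lift b w = bohr_lift b (ext (\<lambda>_. 0))" by (rule bohr_lift_cong) (simp add: w_def)
  then have w: "w \<in> Gamma_set b" using zero by (simp add: Gamma_set_def torus_def w_def next1)
  then show "Gamma_set b \<noteq> {}" by blast
  show "bohr_dim b \<le> bohr_dim a"
  proof (rule ccontr)
    assume "\<not> ?thesis"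
    then have lt: "bohr_dim a < bohr_dim b" by simp
    obtain C r where C: "C > 0" "r > 0" "\<And>\<delta>. L2_set \<delta> {..<bohr_dim b} < r \<Longrightarrow>
        C * (\<Sum>j<bohr_dim b. (\<delta> j)\<^sup>2) \<le> Re (bohr_lift b (\<lambda>j. w j * cis (\<delta> j)))"
      using dirichlet_contact_nearby[of b w] contact w by metis
    \<comment> \<open>Displaces only the first coordinate invisible to \<open>a\<close>; half the
      radius stays inside the contact ball.\<close>
    define \<delta> where "\<delta> = (\<lambda>j. if j = bohr_dim a then r / 2 else 0)"
    have sum: "(\<Sum>j<bohr_dim b. (\<delta> j)\<^sup>2) = (r / 2)\<^sup>2"
      using lt by (simp add: \<delta>_def if_distrib[of "\<lambda>x. x\<^sup>2"] cong: if_cong)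
    have "bohr_lift b (\<lambda>j. w j * cis (\<delta> j)) = bohr_lift b (ext \<delta>)"
      by (rule bohr_lift_cong) (auto simp: w_def ext_def \<delta>_def)
    then have "C * (r / 2)\<^sup>2 \<le> 0"
      using C(3)[of \<delta>] C(2) zero by (simp add: L2_set_def sum)
    then show False using C by (simp add: mult_le_0_iff)
  qed
qed

theorem theorem5p22:
  fixes \<phi>0 \<phi>1 :: "complex \<Rightarrow> complex" and c0 :: nat and a b :: "nat \<Rightarrow> complex"
  assumes "dirichlet_polynomial_symbol \<phi>0 c0 a"
    and "dirichlet_polynomial_symbol \<phi>1 c0 b"
    and "c0 \<ge> 1"
    and "\<forall>z\<in>Gamma_set a. dirichlet_contact a 1 z"
    and "\<forall>z\<in>Gamma_set b. dirichlet_contact b 1 z"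
  shows "compact_operator (\<lambda>f. composition_op \<phi>0 f - composition_op \<phi>1 f) \<longleftrightarrow>
    (Gamma_set a = Gamma_set b \<and>
     (\<forall>z\<in>Gamma_set a.
        bohr_lift a z = bohr_lift b z \<and>
        (\<forall>\<alpha> :: nat \<Rightarrow> nat. (\<Sum>j<bohr_dim a. \<alpha> j) \<le> 2 \<longrightarrow>
           mixed_partial (bohr_dim a) \<alpha> (bohr_lift a) z =
           mixed_partial (bohr_dim a) \<alpha> (bohr_lift b) z)))"
    (is "?compact \<longleftrightarrow> ?equal \<and> ?derivatives")
proof -
  interpret symbol_pair \<phi>0 \<phi>1 c0 "dirichlet_support a" a "dirichlet_support b" b
    using polynomial_symbol_of_dirichlet[OF assms(1,3)] polynomial_symbol_of_dirichlet[OF assms(2,3)]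
    by (rule symbol_pair.intro)
  note fin = p0.fin p1.fin
  show ?thesis
  proof (intro iffI conjI)
    assume eq: "?equal \<and> ?derivatives"
    have "moments_vanish (bohr_dim a) a b z" if z: "z \<in> Gamma_set a" for z
    proof -
      have "z \<in> Gamma_set b" using z eq by blast
      then have tor: "z \<in> torus (bohr_dim a)" "z \<in> torus (bohr_dim b)" using z by (auto simp: Gamma_set_def)
      then have d: "bohr_dim b = bohr_dim a" using torus_dim_unique by blast
      show ?thesis
        by (rule moments_vanish_iff_partials[OF fin d tor(1), THEN iffD2, OF bspec[OF conjunct2[OF eq] z]])
    qed
    then show ?compact using compact_if_moments_vanish[OF assms] eq by blast
  next
    assume T: ?compact
    then have T': "compact_operator (\<lambda>f. composition_op \<phi>1 f - composition_op \<phi>0 f)"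
      by (rule compact_operator_swap) (rule p0.bounded_linear_composition_op p1.bounded_linear_composition_op)+
    \<comment> \<open>At least 2 for the two-prime argument, and large enough for both
      symbols.\<close>
    define D where "D = max 2 (max (bohr_dim a) (bohr_dim b))"
    have D: "D \<ge> 2" "bohr_dim a \<le> D" "bohr_dim b \<le> D" by (auto simp: D_def)
    note moments = necessary_moments[OF assms(1,2,3) T D]
    note moments' = necessary_moments[OF assms(2,1,3) T' D(1,3,2)]
    have lift_eq: "bohr_lift a z = bohr_lift b z" if "moments_vanish D a b z" for z
      using that bohr_lift_diff[OF fin D(2,3), of z] by (simp add: moments_vanish_def)
    have ab: "Re (bohr_lift b z) = 0" if "\<And>j. j < D \<Longrightarrow> cmod (z j) = 1" "Re (bohr_lift a z) = 0" for z
      using lift_eq[OF moments[OF that]] that(2) by simp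
    have ba: "Re (bohr_lift a z) = 0" if "\<And>j. j < D \<Longrightarrow> cmod (z j) = 1" "Re (bohr_lift b z) = 0" for z
      using lift_eq[OF moments_vanish_commute[OF moments'[OF that]]] that(2) by simp
    have dims: "bohr_dim a = bohr_dim b" if "Gamma_set a \<noteq> {} \<or> Gamma_set b \<noteq> {}"
    proof -
      have "Gamma_set a \<noteq> {}" "Gamma_set b \<noteq> {}"
        using that gamma_dims_le(2)[OF fin assms(5) ab D(2,3)] gamma_dims_le(2)[OF fin(2,1) assms(4) ba D(3,2)] by blast+
      then show ?thesis
        using gamma_dims_le(1)[OF fin assms(5) ab D(2,3)] gamma_dims_le(1)[OF fin(2,1) assms(4) ba D(3,2)]
        by (metis all_not_in_conv le_antisym)
    qed
    \<comment> \<open>Torus points continue with zeros; continuing with 1 makes all \<open>D\<close>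
      coordinates unimodular and leaves the lift of \<open>a\<close> unchanged.\<close>
    define ext where "ext = (\<lambda>z j. if j < bohr_dim a then z j else (1::complex))"
    have ext: "cmod (ext z j) = 1" if "z \<in> torus (bohr_dim a)" for z j
      using that by (auto simp: ext_def torus_def)
    have ext_a: "bohr_lift a (ext z) = bohr_lift a z" for z
      by (rule bohr_lift_cong) (simp add: ext_def)
    have ext_b: "bohr_lift b (ext z) = bohr_lift b z" if "bohr_dim a = bohr_dim b" for z
      by (rule bohr_lift_cong) (simp add: ext_def that)
    show ?equal
    \<comment> \<open>If both sets are empty the dimensions may differ, but equality is then
      trivial.\<close>
    proof (cases "Gamma_set a \<noteq> {} \<or> Gamma_set b \<noteq> {}")
      case True
      note d = dims[OF True]
      have "Re (bohr_lift a z) = 0 \<longleftrightarrow> Re (bohr_lift b z) = 0" if "z \<in> torus (bohr_dim a)" for z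
        using ab[of "ext z"] ba[of "ext z"] ext[OF that] by (auto simp: ext_a ext_b[OF d])
      then show ?thesis by (auto simp: Gamma_set_def d)
    qed blast
    show ?derivatives
    proof
      fix z assume z: "z \<in> Gamma_set a"
      then have d: "bohr_dim b = bohr_dim a" using dims by fastforce
      have tor: "z \<in> torus (bohr_dim a)" using z by (simp add: Gamma_set_def)
      have "moments_vanish D a b (ext z)"
        by (rule moments) (use z ext[OF tor] in \<open>simp_all add: ext_a Gamma_set_def\<close>)
      \<comment> \<open>Every index of the joint support uses only the first
        \<open>bohr_dim a\<close> primes, so the moments do not see the extension.\<close>
      moreover have "gap D a b (ext z) n = gap (bohr_dim a) a b z n" if "n \<in> joint_support a b" for n
      proof -
        have "n \<in> smooth (bohr_dim a)"
          using that support_smooth[OF fin(1)] support_smooth[OF fin(2)] d by (auto simp: joint_support_def)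
        then have "monom_at D (ext z) n = monom_at (bohr_dim a) (ext z) n" by (rule monom_at_mono[OF _ D(2)])
        also have "\<dots> = monom_at (bohr_dim a) z n" by (rule monom_at_cong) (simp add: ext_def)
        finally show ?thesis by (simp add: gap_def)
      qed
      ultimately have "moments_vanish (bohr_dim a) a b z"
        using D(2) unfolding moments_vanish_def by (simp cong: sum.cong)
      then show "bohr_lift a z = bohr_lift b z \<and>
        (\<forall>\<alpha> :: nat \<Rightarrow> nat. (\<Sum>j<bohr_dim a. \<alpha> j) \<le> 2 \<longrightarrow>
           mixed_partial (bohr_dim a) \<alpha> (bohr_lift a) z =
           mixed_partial (bohr_dim a) \<alpha> (bohr_lift b) z)"
        by (rule moments_vanish_iff_partials[OF fin d tor, THEN iffD1])
    qed
  qed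
qed

end
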